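(* Let $l$ and $m$ be integers with $l>m\ge 0$, and let $a$ and $b$ be integers such that $a\ge 1$, $a+b\ge 1$ and $\gcd(a,b)=1$. If $l\ge (a+1)m$, then $$\log \operatorname{lcm}_{mn<i\le ln}\{ai+b\}\sim \frac{aln}{\varphi(a)}\sum_{\substack{r=1\\ \gcd(r,a)=1}}^{a}\frac{1}{r}$$ as $n\to\infty$ through the positive integers.
   Context: For a positive integer $n$, $\operatorname{lcm}_{mn<i\le ln}\{ai+b\}$ denotes the least common multiple of the positive integers $ai+b$, where $i$ runs over all integers with $mn<i\le ln$. $\varphi(a)$ is the number of integers between $1$ and $a$ that are relatively prime to $a$. The expression $aln$ is the product $a\cdot l\cdot n$. $f(n)\sim g(n)$ means $f(n)/g(n)\to 1$. *)

theory Defs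
  imports "HOL-Library.Landau_Symbols" "HOL-Number_Theory.Number_Theory"
begin

end

(*
  The logarithm of the lcm is the sum of the von Mangoldt function over all q dividing some a i + b.
  For q coprime to a, let r in [1, a] be the residue with q r = b (mod a). The multiples of q that
  are congruent to b modulo a are q (r + a j), j >= 0. As l >= (a + 1) m, consecutive ones have
  ratio at most l / m, so that q divides a term essentially if and only if q r <= a l n + b; the
  exceptional q divide one of boundedly many numbers just above a l n + b. Hence the logarithm is,
  up to O(log n), the sum over r of psi((a l n + b) / r; a, b / r), and the claim follows from the
  prime number theorem for arithmetic progressions.

  The latter is obtained from Newman's Tauberian theorem, applied to the series with
  coefficients psi(n; a, c) / n - 1 / phi(a). Non-vanishing of L(s, chi) on Re s = 1 comes from the
  3-4-1 inequality, except at s = 1 for real chi, where Monsky's argument with the Lambert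
  series of chi is used.
*)
theory Submission
  imports Defs "HOL-Complex_Analysis.Complex_Analysis" "HOL-Real_Asymp.Real_Asymp"
begin

section \<open>Estimates for Dirichlet series\<close>

text \<open>The ratio of consecutive multiples is (r + a (j + 1)) / (r + a j), largest for r = 1 and
  j = 0, where it equals a + 1; the hypothesis on l and m has to cover this worst case. Newman's
  theorem asks for bounded coefficients, hence Chebyshev's bound, and yields only convergence of the
  series of (psi(n; a, c) / n - 1 / phi(a)) / n; monotonicity of psi turns this into the asymptotic
  law. The Dirichlet series of psi(n; a, c) / n is reached from - L'/L by Abel summation, since
  n^(-s) - (n + 1)^(-s) equals s n^(-s - 1) up to an error whose series is holomorphic on Re s > 0.
  The 3-4-1 inequality is inconclusive only if X^2 is principal and t = 0, because then L(s, X^2)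
  has a pole at the same point as L(s, X_0). For such X, L(1, X) = 0 would keep the Lambert series
  bounded as x tends to 1, whereas it dominates every partial sum of x^(k^2).\<close>

lemma norm_powr_diff_le:
  fixes x y :: real and s :: complex
  assumes "0 < x" "x \<le> y" "Re s > -1"
  shows "norm (of_real x powr (-s) - of_real y powr (-s)) \<le> norm s * x powr (- Re s - 1) * (y - x)"
proof -
  have "norm ((of_real x :: complex) powr (-s) - of_real y powr (-s))
      \<le> norm s * x powr (- Re s - 1) * norm (of_real x - of_real y :: complex)"
  proof (rule field_differentiable_bound[of "of_real ` {x..y}" "\<lambda>z. z powr (-s)" "\<lambda>z. - s * z powr (-s - 1)"])
    show "convex ((of_real :: real \<Rightarrow> complex) ` {x..y})"
      by (intro convex_linear_image) (auto intro!: linearI simp: scaleR_conv_of_real)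
    fix z :: complex assume z: "z \<in> of_real ` {x..y}"
    then obtain t where t: "z = of_real t" "x \<le> t" "t \<le> y" by auto
    with assms have tp: "t > 0" by simp
    show "((\<lambda>z. z powr (-s)) has_field_derivative - s * z powr (-s - 1)) (at z within of_real ` {x..y})"
      using tp t by (auto intro!: derivative_eq_intros)
    have "norm (- s * z powr (-s - 1)) = norm s * t powr (- Re s - 1)"
      using tp t by (simp add: norm_mult norm_powr_real_powr)
    also have "\<dots> \<le> norm s * x powr (- Re s - 1)"
      using assms t by (intro mult_left_mono powr_mono2') auto
    finally show "norm (- s * z powr (-s - 1)) \<le> norm s * x powr (- Re s - 1)" .
  qed (use assms in auto)
  also have "norm (of_real x - of_real y :: complex) = y - x"
    using assms by (simp flip: of_real_diff)
  finally show ?thesis .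
qed

text \<open>The left side is g(n + 1) - g(n) for g(z) = - z^(-w) - w z n^(-w - 1). The derivative w
  (z^(-w - 1) - n^(-w - 1)) is small by \<open>norm_powr_diff_le\<close>, so two powers of n are
  saved in all.\<close>

lemma norm_powr_second_diff_le:
  fixes w :: complex
  assumes "n > 0" "Re w > -2"
  shows "norm (of_nat n powr (-w) - of_nat (Suc n) powr (-w) - w * of_nat n powr (-w - 1))
       \<le> norm w * norm (w + 1) * real n powr (- Re w - 2)"
proof -
  define c where "c = (of_nat n :: complex) powr (-w - 1)"
  define x where "x = real n"
  have x: "x > 0" using assms by (simp add: x_def)
  have "norm ((- (of_real (x + 1) powr (-w)) - w * of_real (x + 1) * c) - (- (of_real x powr (-w)) - w * of_real x * c))
      \<le> norm w * norm (w + 1) * x powr (- Re w - 2) * norm (of_real (x + 1) - of_real x :: complex)"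
  proof (rule field_differentiable_bound[of "of_real ` {x..x+1}" "\<lambda>z. - (z powr (-w)) - w * z * c"
           "\<lambda>z. w * z powr (-w - 1) - w * c"])
    show "convex ((of_real :: real \<Rightarrow> complex) ` {x..x+1})"
      by (intro convex_linear_image) (auto intro!: linearI simp: scaleR_conv_of_real)
    fix z :: complex assume z: "z \<in> of_real ` {x..x+1}"
    then obtain t where t: "z = of_real t" "x \<le> t" "t \<le> x + 1" by auto
    with x have tp: "t > 0" by simp
    show "((\<lambda>z. - (z powr (-w)) - w * z * c) has_field_derivative w * z powr (-w - 1) - w * c) (at z within of_real ` {x..x+1})"
      using tp t by (auto intro!: derivative_eq_intros)
    have "w * z powr (-w - 1) - w * c = - w * (of_real x powr (-(w + 1)) - of_real t powr (-(w + 1)))"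
      by (simp add: c_def t x_def right_diff_distrib)
    also have "norm \<dots> = norm w * norm (of_real x powr (-(w + 1)) - of_real t powr (-(w + 1)))"
      by (simp add: norm_mult)
    also have "\<dots> \<le> norm w * (norm (w + 1) * x powr (- Re (w + 1) - 1) * (t - x))"
      using assms x t by (intro mult_left_mono norm_powr_diff_le) auto
    also have "\<dots> \<le> norm w * (norm (w + 1) * x powr (- Re (w + 1) - 1) * 1)"
      using t by (intro mult_left_mono) auto
    finally show "norm (w * z powr (-w - 1) - w * c) \<le> norm w * norm (w + 1) * x powr (- Re w - 2)"
      by (simp add: algebra_simps)
  next
    show "complex_of_real (x + 1) \<in> of_real ` {x..x+1}" "complex_of_real x \<in> of_real ` {x..x+1}" by (intro imageI; simp)+
  qed
  also have "(- (of_real (x + 1) powr (-w)) - w * of_real (x + 1) * c) - (- (of_real x powr (-w)) - w * of_real x * c)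
     = of_nat n powr (-w) - of_nat (Suc n) powr (-w) - w * of_nat n powr (-w - 1)"
    by (simp add: x_def c_def algebra_simps)
  finally show ?thesis by (simp add: x_def)
qed

text \<open>Around \<open>x\<close> take the disc whose radius \<open>d\<close> is half the distance
  to the line Re s = \<open>\<alpha>\<close>: there every term is at most its bound at abscissa
  \<open>\<alpha> + d\<close>, so Weierstrass' test applies locally. \<open>K\<close> absorbs growth
  in |s|, and its monotonicity makes \<open>K (norm x + d)\<close> valid on the whole disc.\<close>

lemma dirichlet_type_series_holomorphic:
  fixes f f' :: "nat \<Rightarrow> complex \<Rightarrow> complex" and c :: "nat \<Rightarrow> real" and K :: "real \<Rightarrow> real"
  assumes deriv: "\<And>n s. Re s > \<alpha> \<Longrightarrow> (f n has_field_derivative f' n s) (at s)"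
    and bound: "\<And>n s. n > 0 \<Longrightarrow> Re s > \<alpha> \<Longrightarrow> norm (f n s) \<le> K (norm s) * c n * real n powr (- Re s)"
    and K: "mono_on {0..} K" "\<And>t. t \<ge> 0 \<Longrightarrow> K t \<ge> 0" and c: "\<And>n. c n \<ge> 0"
    and summable: "\<And>\<beta>. \<beta> > \<alpha> \<Longrightarrow> summable (\<lambda>n. c n * real n powr (-\<beta>))"
  obtains g where "g holomorphic_on {s. Re s > \<alpha>}"
    "\<And>s. Re s > \<alpha> \<Longrightarrow> (\<lambda>n. f n s) sums g s"
    "\<And>s. Re s > \<alpha> \<Longrightarrow> (\<lambda>n. f' n s) sums deriv g s"
proof -
  have "\<exists>g g'. \<forall>x\<in>{s. Re s > \<alpha>}. ((\<lambda>n. f n x) sums g x) \<and> ((\<lambda>n. f' n x) sums g' x) \<and> (g has_field_derivative g' x) (at x)"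
  proof (rule series_and_derivative_comparison_local)
    show "open {s. Re s > \<alpha>}" by (rule open_halfspace_Re_gt)
    show "(f n has_field_derivative f' n x) (at x)" if "x \<in> {s. Re s > \<alpha>}" for n x
      using that deriv by auto
    fix x assume x: "x \<in> {s. Re s > \<alpha>}"
    define d where "d = (Re x - \<alpha>) / 2"
    have d: "d > 0" using x by (simp add: d_def)
    have "summable (\<lambda>n. K (norm x + d) * (c n * real n powr (-(\<alpha> + d))))"
      using d by (intro summable_mult summable) auto
    moreover have "norm (f n y) \<le> K (norm x + d) * (c n * real n powr (-(\<alpha> + d)))"
      if n: "n \<ge> 1" and y: "y \<in> ball x d \<inter> {s. Re s > \<alpha>}" for n y
    proof -
      have ny: "norm y \<le> norm x + d"
        using y norm_triangle_ineq2[of y x] by (auto simp: dist_norm norm_minus_commute)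
      have "\<bar>Re (x - y)\<bar> < d" using y abs_Re_le_cmod[of "x - y"] by (auto simp: dist_norm)
      hence "Re x - d < Re y" by auto
      moreover have "Re x - d = \<alpha> + d" by (simp add: d_def field_simps)
      ultimately have re: "Re y \<ge> \<alpha> + d" by simp
      have "norm (f n y) \<le> K (norm y) * c n * real n powr (- Re y)"
        using n y by (intro bound) auto
      also have "\<dots> \<le> K (norm x + d) * c n * real n powr (-(\<alpha> + d))"
        using ny re d c n K(2) by (intro mult_mono mult_nonneg_nonneg powr_mono mono_onD[OF K(1)]) auto
      finally show ?thesis by (simp add: mult_ac)
    qed
    ultimately show "\<exists>d h. 0 < d \<and> summable h \<and> (\<forall>\<^sub>F n in sequentially. \<forall>y\<in>ball x d \<inter> {s. Re s > \<alpha>}. norm (f n y) \<le> h n)"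
      using d by (intro exI[of _ d] exI[of _ "\<lambda>n. K (norm x + d) * (c n * real n powr (-(\<alpha> + d)))"])
        (auto simp: eventually_sequentially intro!: exI[of _ 1])
  qed
  then obtain g g' where g: "\<And>x. Re x > \<alpha> \<Longrightarrow> (\<lambda>n. f n x) sums g x" "\<And>x. Re x > \<alpha> \<Longrightarrow> (\<lambda>n. f' n x) sums g' x"
    "\<And>x. Re x > \<alpha> \<Longrightarrow> (g has_field_derivative g' x) (at x)" by auto
  show ?thesis
  proof (rule that)
    show "g holomorphic_on {s. Re s > \<alpha>}"
      using g(3) by (subst holomorphic_on_open) (auto simp: open_halfspace_Re_gt)
    show "(\<lambda>n. f' n s) sums deriv g s" if "Re s > \<alpha>" for s
      using g(2,3)[OF that] DERIV_imp_deriv by metis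
  qed (use g in auto)
qed

text \<open>The case used for continuations: terms of size n^(-Re s - 1), that is,
  \<open>c n\<close> = 1 / n and abscissa 0.\<close>

lemma entire_series_holomorphic:
  fixes f :: "nat \<Rightarrow> complex \<Rightarrow> complex" and K :: "real \<Rightarrow> real"
  assumes hol: "\<And>n. f n holomorphic_on UNIV"
    and bound: "\<And>n s. n > 0 \<Longrightarrow> Re s > 0 \<Longrightarrow> norm (f n s) \<le> K (norm s) * real n powr (- Re s - 1)"
    and K: "mono_on {0..} K" "\<And>t. t \<ge> 0 \<Longrightarrow> K t \<ge> 0"
  obtains g where "g holomorphic_on {s. Re s > 0}" "\<And>s. Re s > 0 \<Longrightarrow> (\<lambda>n. f n s) sums g s"
proof (rule dirichlet_type_series_holomorphic[of 0 f "\<lambda>n. deriv (f n)" K "\<lambda>n. real n powr (-1)"])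
  have eq: "real n powr (-1) * real n powr (-\<beta>) = real n powr (-\<beta> - 1)" for n and \<beta> :: real
    by (subst powr_add[symmetric]) (simp add: minus_diff_commute)
  show "norm (f n s) \<le> K (norm s) * real n powr (-1) * real n powr (- Re s)" if "n > 0" "Re s > 0" for n s
    using bound[OF that] by (simp only: mult.assoc eq)
  show "summable (\<lambda>n. real n powr (-1) * real n powr (-\<beta>))" if "\<beta> > 0" for \<beta> :: real
    unfolding eq using that by (subst summable_real_powr_iff) simp
qed (use hol K that in \<open>auto intro: holomorphic_derivI\<close>)

lemma summable_ln_powr: "\<beta> > 1 \<Longrightarrow> summable (\<lambda>n. ln (real n) * real n powr (-\<beta>))"
proof -
  assume b: "\<beta> > 1"
  \<comment> \<open>Half of the room above 1 is spent on ln n <= n^e / e; the other half keeps the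
    series convergent.\<close>
  define e where "e = (\<beta> - 1) / 2"
  have e: "e > 0" using b by (simp add: e_def)
  have *: "summable (\<lambda>n. real n powr (e - \<beta>) / e)"
    using b by (intro summable_divide) (simp add: summable_real_powr_iff e_def field_simps)
  show ?thesis
  proof (rule summable_comparison_test'[OF *, of 1])
    fix n :: nat assume n: "n \<ge> 1"
    have "ln (real n) * real n powr (-\<beta>) \<le> real n powr e / e * real n powr (-\<beta>)"
      using n e by (intro mult_right_mono ln_powr_bound) auto
    also have "\<dots> = real n powr (e - \<beta>) / e" by (simp add: powr_diff powr_minus field_simps)
    finally show "norm (ln (real n) * real n powr (-\<beta>)) \<le> real n powr (e - \<beta>) / e" using n by simp
  qed
qed

section \<open>Newman's Tauberian theorem\<close>

lemma powr_diff_MVT: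
  fixes x y u :: real
  assumes "0 < x" "x < y"
  obtains t where "x < t" "t < y" "y powr u - x powr u = (y - x) * (u * t powr (u - 1))"
proof -
  have "\<exists>t. t > x \<and> t < y \<and> y powr u - x powr u = (y - x) * (u * t powr (u - 1))"
    using assms by (intro MVT2) (auto intro!: derivative_eq_intros)
  thus ?thesis using that by blast
qed

text \<open>Comparison with the integral of t^(x - 1) by telescoping t^x. The integrand increases
  for x >= 1 and decreases for x < 1, so a term is compared with the unit interval to its right or
  to its left. The last term is split off and accounts for 1 / N.\<close>

lemma sum_powr_le:
  fixes x :: real
  assumes "x > 0" "N > 0"
  shows "(\<Sum>n=1..N. real n powr (x - 1)) \<le> real N powr x * (1 / real N + 1 / x)"
proof -
  obtain M where N: "N = Suc M" using assms by (cases N) auto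
  have "x * (\<Sum>n=1..M. real n powr (x - 1)) \<le> real N powr x"
  proof (cases "x \<ge> 1")
    case True
    have "x * (\<Sum>n=1..k. real n powr (x - 1)) \<le> real (Suc k) powr x" for k
    proof (induction k)
      case (Suc k)
      obtain t where t: "real (Suc k) < t" "t < real (Suc (Suc k))"
        "real (Suc (Suc k)) powr x - real (Suc k) powr x = (real (Suc (Suc k)) - real (Suc k)) * (x * t powr (x - 1))"
        by (rule powr_diff_MVT[of "real (Suc k)" "real (Suc (Suc k))" x]) auto
      have "x * real (Suc k) powr (x - 1) \<le> x * t powr (x - 1)"
        using t True by (intro mult_left_mono powr_mono2) auto
      with t Suc.IH show ?case by (simp add: distrib_left)
    qed auto
    thus ?thesis using N by simp
  next
    case False
    have "x * (\<Sum>n=1..k. real n powr (x - 1)) \<le> real k powr x" for k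
    proof (induction k)
      case (Suc k)
      show ?case
      \<comment> \<open>The mean value theorem needs a positive left endpoint; at k = 0 the claim is
        just x <= 1.\<close>
      proof (cases "k = 0")
        case True thus ?thesis using False by simp
      next
        case k: False
        obtain t where t: "real k < t" "t < real (Suc k)"
          "real (Suc k) powr x - real k powr x = (real (Suc k) - real k) * (x * t powr (x - 1))"
          by (rule powr_diff_MVT[of "real k" "real (Suc k)" x]) (use k in auto)
        have "x * real (Suc k) powr (x - 1) \<le> x * t powr (x - 1)"
          using t False k assms by (intro mult_left_mono powr_mono2') auto
        with t Suc.IH show ?thesis by (simp add: distrib_left)
      qed
    qed auto
    from this[of M] have "x * (\<Sum>n=1..M. real n powr (x - 1)) \<le> real M powr x" .
    also have "\<dots> \<le> real N powr x" using assms N by (intro powr_mono2) auto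
    finally show ?thesis .
  qed
  hence "(\<Sum>n=1..M. real n powr (x - 1)) \<le> real N powr x / x"
    using assms by (simp add: field_simps)
  moreover have "(\<Sum>n=1..N. real n powr (x - 1)) = (\<Sum>n=1..M. real n powr (x - 1)) + real N powr x / real N"
    using assms by (simp add: N powr_diff)
  ultimately show ?thesis by (simp add: algebra_simps)
qed

lemma powr_telescope_sums:
  fixes x :: real
  assumes "x > 0"
  shows "(\<lambda>k. real (k + N) powr (-x) - real (Suc k + N) powr (-x)) sums (real N powr (-x))"
proof -
  have "((\<lambda>k. real (k + N) powr (-x)) \<longlongrightarrow> 0) sequentially"
    using assms by real_asymp
  from telescope_sums'[OF this] show ?thesis by simp
qed

text \<open>With x = Re z, n^(-x - 1) is at most a mean value of t^(-x - 1) on [n - 1, n], which is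
  a telescoping difference divided by x. The factor 1 / Re z blows up at the imaginary axis;
  Newman's kernel will cancel it.\<close>

lemma norm_dirichlet_tail_le:
  fixes a :: "nat \<Rightarrow> complex"
  assumes a: "\<And>n. norm (a n) \<le> C" and z: "Re z > 0" and N: "N > 0"
    and s: "(\<lambda>n. a n * of_nat n powr (-(1+z))) sums S"
  shows "norm (S - (\<Sum>n=1..N. a n * of_nat n powr (-(1+z)))) \<le> C * (real N powr (- Re z) / Re z)"
proof -
  define x where "x = Re z"
  define f where "f = (\<lambda>n. a n * of_nat n powr (-(1+z)))"
  have C: "C \<ge> 0" using a[of 0] norm_ge_zero order_trans by blast
  have x: "x > 0" using z by (simp add: x_def)
  have tail: "(\<lambda>k. f (k + Suc N)) sums (S - (\<Sum>n<Suc N. f n))"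
    using s unfolding f_def by (rule sums_split_initial_segment)
  \<comment> \<open>The term with index 0 vanishes, as \<open>0 powr w\<close> is 0.\<close>
  have eq: "(\<Sum>n<Suc N. f n) = (\<Sum>n=1..N. f n)"
  proof -
    have "{..<Suc N} = insert 0 {1..N}" by auto
    thus ?thesis by (simp add: f_def)
  qed
  have bound: "norm (f (k + Suc N)) \<le> C / x * (real (k + N) powr (-x) - real (Suc k + N) powr (-x))" for k
  proof -
    define m where "m = k + N"
    have m: "m > 0" using N by (simp add: m_def)
    obtain t where t: "real m < t" "t < real (Suc m)"
      "real (Suc m) powr (-x) - real m powr (-x) = (real (Suc m) - real m) * ((-x) * t powr (-x - 1))"
      by (rule powr_diff_MVT[of "real m" "real (Suc m)" "-x"]) (use m in auto)
    have "norm (f (Suc m)) = norm (a (Suc m)) * norm ((of_nat (Suc m) :: complex) powr (-(1+z)))" 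
      unfolding f_def by (rule norm_mult)
    also have "norm ((of_nat (Suc m) :: complex) powr (-(1+z))) = real (Suc m) powr (-x-1)"
      using norm_powr_real_powr[of "of_nat (Suc m)" "-(1+z)"] by (simp add: x_def minus_diff_commute del: of_nat_Suc)
    also have "norm (a (Suc m)) * real (Suc m) powr (-x-1) \<le> C * t powr (-x-1)"
      using t m a C x by (intro mult_mono powr_mono2') auto
    also have "\<dots> = C / x * (real m powr (-x) - real (Suc m) powr (-x))"
    proof -
      have "real m powr (-x) - real (Suc m) powr (-x) = x * t powr (-x - 1)" using t(3) by simp
      thus ?thesis using x by simp
    qed
    finally show ?thesis by (simp add: m_def)
  qed
  have sm: "(\<lambda>k. C / x * (real (k + N) powr (-x) - real (Suc k + N) powr (-x))) sums (C / x * real N powr (-x))"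
    by (intro sums_mult powr_telescope_sums x)
  have "norm (\<Sum>k. f (k + Suc N)) \<le> (\<Sum>k. C / x * (real (k + N) powr (-x) - real (Suc k + N) powr (-x)))"
    by (rule norm_suminf_le[OF bound sums_summable[OF sm]])
  also have "(\<Sum>k. f (k + Suc N)) = S - (\<Sum>n=1..N. f n)" using tail eq by (simp add: sums_iff)
  also have "(\<Sum>k. C / x * (real (k + N) powr (-x) - real (Suc k + N) powr (-x))) = C / x * real N powr (-x)"
    using sm by (simp add: sums_iff)
  finally show ?thesis by (simp add: f_def x_def)
qed

lemma norm_dirichlet_head_le:
  fixes a :: "nat \<Rightarrow> complex"
  assumes a: "\<And>n. norm (a n) \<le> C" and z: "Re z < 0" and N: "N > 0"
  shows "norm (\<Sum>n=1..N. a n * of_nat n powr (-(1+z))) \<le> C * (real N powr (- Re z) * (1 / real N + 1 / (- Re z)))"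
proof -
  define x where "x = - Re z"
  have C: "C \<ge> 0" using a[of 0] norm_ge_zero order_trans by blast
  have "norm (\<Sum>n=1..N. a n * of_nat n powr (-(1+z))) \<le> (\<Sum>n=1..N. C * real n powr (x - 1))"
  proof (rule sum_norm_le)
    fix n assume n: "n \<in> {1..N}"
    have "norm (a n * of_nat n powr (-(1+z))) = norm (a n) * real n powr (x - 1)"
      using n norm_powr_real_powr[of "of_nat n" "-(1+z)"] by (simp add: norm_mult x_def minus_diff_commute)
    also have "\<dots> \<le> C * real n powr (x - 1)" by (intro mult_right_mono a) auto
    finally show "norm (a n * of_nat n powr (-(1+z))) \<le> C * real n powr (x - 1)" .
  qed
  also have "\<dots> = C * (\<Sum>n=1..N. real n powr (x - 1))" by (simp add: sum_distrib_left)
  also have "\<dots> \<le> C * (real N powr x * (1 / real N + 1 / x))"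
    using z N C by (intro mult_left_mono sum_powr_le) (auto simp: x_def)
  finally show ?thesis by (simp add: x_def)
qed

section \<open>Contour integrals for Newman's argument\<close>

lemma contour_integral_inverse_part_circlepath:
  assumes "s < t" "R > 0"
  shows "((\<lambda>z. c / z) has_contour_integral (c * \<i> * of_real (t - s))) (part_circlepath 0 R s t)"
proof -
  have "((\<lambda>u::real. c * \<i>) has_integral (c * \<i> * of_real (t - s))) {s..t}"
    using has_integral_const_real[of "c * \<i>" s t] assms by (simp add: scaleR_conv_of_real mult_ac)
  thus ?thesis
    using assms by (subst has_contour_integral_part_circlepath_iff) (auto simp: field_simps)
qed

text \<open>Q z / z splits into (Q z - Q 0) / z, which is entire and integrates to 0 round the
  circle, and Q 0 / z, which is integrated explicitly on each arc. The cut at the points of the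
  imaginary axis allows different estimates on the two halves.\<close>

lemma Cauchy_integral_two_arcs:
  assumes Q: "Q holomorphic_on UNIV" and R: "R > 0"
  shows "contour_integral (part_circlepath 0 R (-pi/2) (pi/2)) (\<lambda>z. Q z / z)
       + contour_integral (part_circlepath 0 R (pi/2) (3*pi/2)) (\<lambda>z. Q z / z) = 2 * of_real pi * \<i> * Q 0"
proof -
  define q where "q = (\<lambda>z. if z = 0 then deriv Q 0 else (Q z - Q 0) / (z - 0))"
  have q: "q holomorphic_on UNIV" unfolding q_def by (rule pole_lemma[OF Q]) auto
  define A where "A = part_circlepath 0 R (-pi/2) (pi/2)"
  define B where "B = part_circlepath 0 R (pi/2) (3*pi/2)"
  have ci: "q contour_integrable_on part_circlepath 0 R s t" for s t
    by (intro contour_integrable_continuous_part_circlepath holomorphic_on_imp_continuous_on holomorphic_on_subset[OF q]) auto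
  have arc: "contour_integral (part_circlepath 0 R s t) (\<lambda>z. Q z / z) 
     = contour_integral (part_circlepath 0 R s t) q + Q 0 * \<i> * of_real (t - s)" if "s < t" for s t
  proof (rule contour_integral_unique)
    have "((\<lambda>z. q z + Q 0 / z) has_contour_integral 
       (contour_integral (part_circlepath 0 R s t) q + Q 0 * \<i> * of_real (t - s))) (part_circlepath 0 R s t)"
      using that R by (intro has_contour_integral_add has_contour_integral_integral ci contour_integral_inverse_part_circlepath) auto
    thus "((\<lambda>z. Q z / z) has_contour_integral 
       (contour_integral (part_circlepath 0 R s t) q + Q 0 * \<i> * of_real (t - s))) (part_circlepath 0 R s t)"
    proof (rule has_contour_integral_eq)
      fix z assume "z \<in> path_image (part_circlepath 0 R s t)"
      hence "norm (z - 0) = R" using in_path_image_part_circlepath[of z 0 R s t] that R by auto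
      thus "q z + Q 0 / z = Q z / z" using R by (auto simp: q_def diff_divide_distrib)
    qed
  qed
  have "(q has_contour_integral 0) (A +++ B)"
  proof (rule Cauchy_theorem_convex_simple[OF q])
    have "exp (\<i> * (3 * of_real pi / 2)) = exp (\<i> * of_real (-pi/2))"
      by (subst exp_eq) (auto intro!: exI[of _ 1] simp: field_simps)
    thus "pathfinish (A +++ B) = pathstart (A +++ B)" by (simp add: A_def B_def)
    show "valid_path (A +++ B)" by (intro valid_path_join) (auto simp: A_def B_def)
  qed auto
  hence "0 = contour_integral (A +++ B) q" by (simp add: contour_integral_unique)
  also have "\<dots> = contour_integral A q + contour_integral B q"
    unfolding A_def B_def by (intro contour_integral_join ci) auto
  finally show ?thesis using arc[of "-pi/2" "pi/2"] arc[of "pi/2" "3*pi/2"] 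
    by (simp add: A_def B_def algebra_simps field_simps)
qed

text \<open>On the circle 1 / z is the conjugate of z divided by R^2. This is Newman's kernel: it is
  proportional to |Re z| and so cancels the factor 1 / |Re z| of the tail and head
  estimates.\<close>

lemma norm_inverse_plus_scaled:
  fixes z :: complex
  assumes "norm z = R" "R > 0"
  shows "norm (1 / z + z / of_real (R\<^sup>2)) = 2 * \<bar>Re z\<bar> / R\<^sup>2"
proof -
  have z: "z \<noteq> 0" using assms by auto
  have "1 / z = cnj z / of_real (R\<^sup>2)"
    using assms z complex_norm_square[of z] by (simp add: field_simps)
  hence "1 / z + z / of_real (R\<^sup>2) = of_real (2 * Re z) / of_real (R\<^sup>2)"
    using complex_add_cnj[of z] by (simp add: add_divide_distrib[symmetric] add.commute)
  also have "norm \<dots> = 2 * \<bar>Re z\<bar> / R\<^sup>2" by (simp add: norm_divide norm_power norm_mult)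
  finally show ?thesis .
qed

text \<open>A quantitative Riemann-Lebesgue lemma: exp (z L) has modulus 1 on the segment, and one
  integration by parts gains 1 / L. What matters is that \<open>K\<close> does not depend on L,
  which will be ln N.\<close>

lemma contour_integral_exp_segment_bound:
  assumes H: "H holomorphic_on U" and U: "open U" "closed_segment (\<i> * of_real R) (- \<i> * of_real R) \<subseteq> U" and R: "R > 0"
  obtains K where "\<And>L::real. L > 0 \<Longrightarrow>
    norm (contour_integral (linepath (\<i> * of_real R) (- \<i> * of_real R)) (\<lambda>z. exp (z * of_real L) * H z)) \<le> K / L"
proof -
  let ?T = "closed_segment (\<i> * of_real R) (- \<i> * of_real R)"
  have H': "deriv H holomorphic_on U" using H U by (intro holomorphic_deriv)
  have "bounded (H ` ?T)" "bounded (deriv H ` ?T)"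
    by (intro compact_imp_bounded compact_continuous_image holomorphic_on_imp_continuous_on
          holomorphic_on_subset[OF H U(2)] holomorphic_on_subset[OF H' U(2)] compact_segment)+
  then obtain M1 M2 where M12: "\<And>z. z \<in> ?T \<Longrightarrow> norm (H z) \<le> M1" "\<And>z. z \<in> ?T \<Longrightarrow> norm (deriv H z) \<le> M2"
    unfolding bounded_iff by (metis imageI)
  define M where "M = max 0 (max M1 M2)"
  have M: "M \<ge> 0" "norm (H z) \<le> M" "norm (deriv H z) \<le> M" if "z \<in> ?T" for z
    using M12[OF that] by (auto simp: M_def)
  have M0: "M \<ge> 0" by (simp add: M_def)
  have Re0: "Re z = 0" if "z \<in> ?T" for z
    using that by (auto simp: closed_segment_def scaleR_conv_of_real)
  show ?thesis
  \<comment> \<open>Two boundary terms of size M, and an integral of size M over a segment of length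
    2 R.\<close>
  proof (rule that[of "2 * M + M * (2 * R)"])
    fix L :: real assume L: "L > 0"
    define \<Phi> where "\<Phi> = (\<lambda>z. exp (z * of_real L) * H z / of_real L)"
    let ?g = "linepath (\<i> * of_real R) (- \<i> * of_real R)"
    have 1: "((\<lambda>z. exp (z * of_real L) * H z + exp (z * of_real L) * deriv H z / of_real L)
           has_contour_integral (\<Phi> (pathfinish ?g) - \<Phi> (pathstart ?g))) ?g"
    proof (rule contour_integral_primitive)
      fix z assume "z \<in> U"
      hence "(H has_field_derivative deriv H z) (at z)" using H U by (intro holomorphic_derivI)
      hence "(H has_field_derivative deriv H z) (at z within U)" by (rule has_field_derivative_at_within)
      thus "(\<Phi> has_field_derivative (exp (z * of_real L) * H z + exp (z * of_real L) * deriv H z / of_real L)) (at z within U)"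
        unfolding \<Phi>_def using L by (auto intro!: derivative_eq_intros simp: field_simps)
    qed (use U in auto)
    have "(\<lambda>z. exp (z * of_real L) * deriv H z / of_real L) contour_integrable_on ?g"
      by (intro contour_integrable_continuous_linepath holomorphic_on_imp_continuous_on holomorphic_intros
            holomorphic_on_subset[OF H' U(2)]) (use L in auto)
    then obtain J where J: "((\<lambda>z. exp (z * of_real L) * deriv H z / of_real L) has_contour_integral J) ?g"
      by (auto simp: contour_integrable_on_def)
    have Jb: "norm J \<le> M / L * norm (- \<i> * of_real R - \<i> * of_real R)"
    proof (rule has_contour_integral_bound_linepath[OF J])
      fix z assume "z \<in> ?T"
      thus "norm (exp (z * of_real L) * deriv H z / of_real L) \<le> M / L"
        using M(3)[of z] Re0[of z] L by (simp add: norm_mult norm_divide divide_right_mono)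
    qed (use M0 L in auto)
    have "norm (- \<i> * of_real R - \<i> * of_real R) = 2 * R"
      using R by (simp add: norm_mult flip: mult_2_right)
    with Jb have Jb: "norm J \<le> M / L * (2 * R)" by simp
    have "((\<lambda>z. exp (z * of_real L) * H z) has_contour_integral (\<Phi> (pathfinish ?g) - \<Phi> (pathstart ?g) - J)) ?g"
      using has_contour_integral_diff[OF 1 J] by simp
    hence "contour_integral ?g (\<lambda>z. exp (z * of_real L) * H z) = \<Phi> (- \<i> * of_real R) - \<Phi> (\<i> * of_real R) - J"
      by (simp add: contour_integral_unique)
    moreover have "norm (\<Phi> z) \<le> M / L" if "z \<in> ?T" for z
      using M(2)[of z] Re0[of z] that L by (simp add: \<Phi>_def norm_mult norm_divide divide_right_mono)
    hence "norm (\<Phi> (- \<i> * of_real R)) \<le> M / L" "norm (\<Phi> (\<i> * of_real R)) \<le> M / L" by auto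
    hence "norm (\<Phi> (- \<i> * of_real R) - \<Phi> (\<i> * of_real R) - J) \<le> M / L + M / L + M / L * (2 * R)"
      using Jb by (meson add_mono norm_triangle_le_diff order_trans norm_triangle_ineq4)
    ultimately show "norm (contour_integral ?g (\<lambda>z. exp (z * of_real L) * H z)) \<le> (2 * M + M * (2 * R)) / L"
      by (simp add: add_divide_distrib)
  qed
qed

text \<open>Cauchy's formula recovers the partial sum \<open>P 0\<close> from \<open>Q\<close>,
  which is \<open>P\<close> weighted by N^z and the kernel. On the right arc \<open>P\<close> is the
  full sum minus the tail, and the full sum is moved to the imaginary axis, where the oscillation of
  N^z makes it O(1 / ln N). On the left arc \<open>P\<close> is bounded directly. Each arc costs
  about C / R, and R remains free.\<close>

lemma newman_partial_sum_bound:
  fixes a :: "nat \<Rightarrow> complex"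
  assumes C: "\<And>n. norm (a n) \<le> C" and U: "open U" "{z. Re z \<ge> 0} \<subseteq> U" and G: "G holomorphic_on U"
    and sums: "\<And>z. Re z > 0 \<Longrightarrow> (\<lambda>n. a n * of_nat n powr (-(1+z))) sums (z * G z)" and R: "R > 0"
  obtains K where "\<And>N. N \<ge> 2 \<Longrightarrow> norm (\<Sum>n=1..N. a n / of_nat n) \<le> 2 * C / R + C / N + K / ln (real N)"
proof -
  let ?A = "part_circlepath 0 R (-pi/2) (pi/2)" and ?B = "part_circlepath 0 R (pi/2) (3*pi/2)"
  let ?E = "{\<i> * of_real R, - \<i> * of_real R}"
  have C0: "C \<ge> 0" using C[of 0] norm_ge_zero order_trans by blast
  define A where "A = ?A"
  define B where "B = ?B"
  \<comment> \<open>As the series sums to \<open>z * G z\<close>, its factor z cancels the pole of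
    the kernel, so \<open>H\<close> is holomorphic at 0 too.\<close>
  define H where "H = (\<lambda>z. G z * (1 + z\<^sup>2 / of_real (R\<^sup>2)))"
  have H: "H holomorphic_on U" unfolding H_def by (intro holomorphic_intros G) (use R in auto)
  let ?T = "closed_segment (\<i> * of_real R) (- \<i> * of_real R)"
  let ?g = "linepath (\<i> * of_real R) (- \<i> * of_real R)"
  have T: "?T \<subseteq> {z. Re z \<ge> 0}"
    by (auto simp: closed_segment_def scaleR_conv_of_real)
  have TU: "?T \<subseteq> U" using T U by blast
  obtain K where K: "\<And>L::real. L > 0 \<Longrightarrow> norm (contour_integral ?g (\<lambda>z. exp (z * of_real L) * H z)) \<le> K / L"
    using contour_integral_exp_segment_bound[OF H U(1) TU R] by blast
  have exp_half: "exp (\<i> * (of_real pi / 2)) = \<i>" "exp (- (\<i> * (of_real pi / 2))) = - \<i>"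
    using cis_conv_exp[of "pi/2"] cis_conv_exp[of "-(pi/2)"] by (simp_all add: cis_pi_half complex_eq_iff)
  have A_img: "norm z = R" "Re z \<ge> 0" if "z \<in> path_image A" for z
  proof -
    have "z \<in> {0 + of_real R * exp (\<i> * of_real x) | x. -pi/2 \<le> x \<and> x \<le> pi/2}"
      using that path_image_part_circlepath[of "-pi/2" "pi/2" 0 R] by (simp add: A_def)
    then obtain x where x: "z = of_real R * exp (\<i> * of_real x)" "-pi/2 \<le> x" "x \<le> pi/2" by auto
    show "norm z = R" using x R by (simp add: norm_mult)
    have "Re z = R * cos x" using x by (simp add: Re_exp)
    thus "Re z \<ge> 0" using x R by (auto intro!: mult_nonneg_nonneg cos_ge_zero)
  qed
  have B_img: "norm z = R" "Re z \<le> 0" if "z \<in> path_image B" for z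
  proof -
    have "z \<in> {0 + of_real R * exp (\<i> * of_real x) | x. pi/2 \<le> x \<and> x \<le> 3*pi/2}"
      using that path_image_part_circlepath[of "pi/2" "3*pi/2" 0 R] by (simp add: B_def)
    then obtain x where x: "z = of_real R * exp (\<i> * of_real x)" "pi/2 \<le> x" "x \<le> 3*pi/2" by auto
    show "norm z = R" using x R by (simp add: norm_mult)
    have "Re z = R * cos x" using x by (simp add: Re_exp)
    also have "cos x = - cos (x - pi)" by (simp add: cos_diff)
    also have "R * \<dots> \<le> 0"
      using mult_nonneg_nonneg[of R "cos (x - pi)"] cos_ge_zero[of "x - pi"] x R by simp
    finally show "Re z \<le> 0" .
  qed
  \<comment> \<open>The two arc endpoints have to be excluded from the pointwise estimates, which
    divide by Re z; a finite exceptional set does not affect the integral bounds.\<close>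
  have arcend: "z = \<i> * of_real R \<or> z = - \<i> * of_real R" if "norm z = R" "Re z = 0" for z
    using that R by (auto simp: complex_eq_iff cmod_def abs_real_def split: if_splits)
  have sqR: "R * R = R\<^sup>2" by (simp add: power2_eq_square)
  show ?thesis
  proof (rule that[of "K / (2 * pi)"])
    fix N :: nat assume N: "N \<ge> 2"
    define L where "L = ln (real N)"
    have L: "L > 0" using N by (simp add: L_def)
    define h where "h = (\<lambda>z. exp (z * of_real L) * H z)"
    have h: "h holomorphic_on Y" if "Y \<subseteq> U" for Y
      unfolding h_def by (intro holomorphic_intros holomorphic_on_subset[OF H that])
    have Kh: "norm (contour_integral ?g h) \<le> K / L" unfolding h_def by (rule K[OF L])
    have powrL: "real N powr x = exp (x * L)" for x using N by (simp add: powr_def L_def)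
    define P where "P = (\<lambda>z. \<Sum>n=1..N. a n * of_nat n powr (-(1+z)))"
    define Q where "Q = (\<lambda>z. P z * exp (z * of_real L) * (1 + z\<^sup>2 / of_real (R\<^sup>2)))"
    let ?IA = "contour_integral A (\<lambda>z. Q z / z)" and ?IB = "contour_integral B (\<lambda>z. Q z / z)"
    define k where "k = (\<lambda>z::complex. exp (z * of_real L) * (1 / z + z / of_real (R\<^sup>2)))"
    have P: "P holomorphic_on X" for X unfolding P_def
      by (intro holomorphic_intros) auto
    have Q: "Q holomorphic_on X" for X unfolding Q_def by (intro holomorphic_intros P) (use R in auto)
    have Q0: "Q 0 = (\<Sum>n=1..N. a n / of_nat n)"
      by (simp add: Q_def P_def powr_minus divide_inverse)
    have Qz: "Q z / z = P z * k z" if "z \<noteq> 0" for z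
      using that by (simp add: Q_def k_def field_simps power2_eq_square)
    have Hz: "h z = z * G z * k z" if "z \<noteq> 0" for z
      using that by (simp add: h_def H_def k_def field_simps power2_eq_square)
    have normk: "norm (k z) = exp (Re z * L) * (2 * \<bar>Re z\<bar> / R\<^sup>2)" if "norm z = R" for z
      using norm_inverse_plus_scaled[OF that R] by (simp add: k_def norm_mult)
    have intQ: "(\<lambda>z. Q z / z) contour_integrable_on part_circlepath 0 R s t" if "s \<le> t" for s t
    proof (intro contour_integrable_continuous_part_circlepath holomorphic_on_imp_continuous_on holomorphic_intros Q)
      fix z assume "z \<in> path_image (part_circlepath 0 R s t)"
      hence "norm (z - 0) = R" using in_path_image_part_circlepath[of z 0 R s t] that R by auto
      thus "z \<noteq> 0" using R by auto
    qed
    have "path_image A \<subseteq> U" using U A_img by blast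
    hence intH: "h contour_integrable_on A"
      unfolding A_def by (intro contour_integrable_continuous_part_circlepath holomorphic_on_imp_continuous_on h)
    have intHg: "h contour_integrable_on ?g"
      using TU by (intro contour_integrable_continuous_linepath holomorphic_on_imp_continuous_on h)
    \<comment> \<open>Right arc and segment close up inside the closed right half-plane, which is
      convex and free of poles of \<open>h\<close>; so the arc can be traded for the
      segment.\<close>
    have "(h has_contour_integral 0) (A +++ ?g)"
    proof (rule Cauchy_theorem_convex_simple)
      show "h holomorphic_on {z. Re z \<ge> 0}"
        by (rule h[OF U(2)])
      show "convex {z. Re z \<ge> 0}" by (rule convex_halfspace_Re_ge)
      show "valid_path (A +++ ?g)" using exp_half by (intro valid_path_join) (auto simp: A_def)
      show "path_image (A +++ ?g) \<subseteq> {z. Re z \<ge> 0}"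
        using path_image_join_subset[of A ?g] A_img T by auto
      show "pathfinish (A +++ ?g) = pathstart (A +++ ?g)" using exp_half by (auto simp: A_def)
    qed
    hence cauchy: "contour_integral A h = - contour_integral ?g h"
      using contour_integral_join[OF intH intHg] exp_half
      by (simp add: contour_integral_unique A_def eq_neg_iff_add_eq_0)
    have "norm (?IA - contour_integral A h) \<le> 2 * C / R\<^sup>2 * R * (pi/2 - (-pi/2))"
    proof (rule has_contour_integral_bound_part_circlepath_strong[where k = "?E"])
      show "((\<lambda>z. Q z / z - h z) has_contour_integral
        (?IA - contour_integral A h)) ?A"
        using intH intQ[of "-pi/2" "pi/2"] unfolding A_def by (intro has_contour_integral_diff has_contour_integral_integral) auto
      fix z assume z: "z \<in> path_image ?A - ?E"
      hence nz: "norm z = R" "Re z > 0" "z \<noteq> 0" using A_img[of z] arcend[of z] R by (auto simp: A_def less_le)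
      have "norm (Q z / z - h z) = norm (z * G z - P z) * norm (k z)"
        using nz by (simp add: Qz Hz norm_mult[symmetric] left_diff_distrib[symmetric] norm_minus_commute)
      also have "\<dots> \<le> C * (real N powr (- Re z) / Re z) * norm (k z)"
        unfolding P_def using N by (intro mult_right_mono norm_dirichlet_tail_le sums C nz) auto
      \<comment> \<open>The factors N^(-Re z) and 1 / Re z of the tail cancel exactly against the
        modulus exp (L Re z) 2 |Re z| / R^2 of \<open>k\<close>.\<close>
      also have "\<dots> = 2 * C / R\<^sup>2"
        using nz by (simp add: normk powrL exp_minus field_simps)
      finally show "norm (Q z / z - h z) \<le> 2 * C / R\<^sup>2" .
    qed (use R C0 in auto)
    hence bA: "norm (?IA + contour_integral ?g h) \<le> 2 * pi * C / R"
      using R unfolding cauchy diff_minus_eq_add by (simp add: field_simps power2_eq_square)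
    have "norm ?IB \<le> (2 * C / R\<^sup>2 * (R / N + 1)) * R * (3*pi/2 - pi/2)"
    proof (rule has_contour_integral_bound_part_circlepath_strong[where k = "?E"])
      show "((\<lambda>z. Q z / z) has_contour_integral ?IB) ?B"
        using intQ[of "pi/2" "3*pi/2"] unfolding B_def by (intro has_contour_integral_integral) auto
      fix z assume z: "z \<in> path_image ?B - ?E"
      hence nz: "norm z = R" "Re z < 0" "z \<noteq> 0" using B_img[of z] arcend[of z] R by (auto simp: B_def less_le)
      have "norm (Q z / z) = norm (P z) * norm (k z)" using nz by (simp add: Qz norm_mult)
      also have "\<dots> \<le> C * (real N powr (- Re z) * (1 / real N + 1 / (- Re z))) * norm (k z)"
        unfolding P_def using N by (intro mult_right_mono norm_dirichlet_head_le C nz) auto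
      also have "\<dots> = 2 * C / R\<^sup>2 * (\<bar>Re z\<bar> / N + 1)"
        using nz N R by (simp add: normk powrL exp_minus field_simps)
      also have "\<dots> \<le> 2 * C / R\<^sup>2 * (R / N + 1)"
        using C0 abs_Re_le_cmod[of z] nz by (intro mult_left_mono add_mono divide_right_mono) auto
      finally show "norm (Q z / z) \<le> 2 * C / R\<^sup>2 * (R / N + 1)" .
    qed (use R C0 in auto)
    also have "(2 * C / R\<^sup>2 * (R / N + 1)) * R * (3*pi/2 - pi/2) = 2 * pi * (C / N + C / R)"
      using R N by (simp add: field_simps power2_eq_square)
    finally have bB: "norm ?IB \<le> 2 * pi * (C / N + C / R)" .
    have "2 * of_real pi * \<i> * Q 0 = (?IA + contour_integral ?g h)
       + ?IB - contour_integral ?g h"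
      using Cauchy_integral_two_arcs[OF Q R] by (simp add: A_def B_def)
    also have "norm \<dots> \<le> 2 * pi * C / R + 2 * pi * (C / N + C / R) + K / L"
      by (intro order_trans[OF norm_triangle_ineq4] add_mono order_trans[OF norm_triangle_ineq] bA bB Kh)
    also have "\<dots> = 2 * pi * (2 * C / R + C / N + K / (2 * pi) / L)"
      using R L N by (simp add: field_simps)
    finally have "2 * pi * norm (Q 0) \<le> 2 * pi * (2 * C / R + C / N + K / (2 * pi) / L)"
      by (simp add: norm_mult)
    hence "norm (Q 0) \<le> 2 * C / R + C / N + K / (2 * pi) / L"
      using pi_gt_zero by (subst (asm) mult_le_cancel_left_pos) auto
    thus "norm (\<Sum>n=1..N. a n / of_nat n) \<le> 2 * C / R + C / N + K / (2 * pi) / ln (real N)"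
      by (simp add: Q0 L_def)
  qed
qed

lemma newman_vanishing:
  fixes a :: "nat \<Rightarrow> complex"
  assumes C: "\<And>n. norm (a n) \<le> C" and U: "open U" "{z. Re z \<ge> 0} \<subseteq> U" and G: "G holomorphic_on U"
    and sums: "\<And>z. Re z > 0 \<Longrightarrow> (\<lambda>n. a n * of_nat n powr (-(1+z))) sums (z * G z)"
  shows "(\<lambda>n. a n / of_nat n) sums 0"
proof -
  have C0: "C \<ge> 0" using C[of 0] norm_ge_zero order_trans by blast
  have "(\<lambda>N. \<Sum>n=1..N. a n / of_nat n) \<longlonglongrightarrow> 0"
  proof (rule tendstoI)
    fix e :: real assume e: "e > 0"
    \<comment> \<open>This makes 2 C / R equal to e / 2 times C / (C + 1), hence less than e / 2; C
      + 1 instead of C keeps R positive for C = 0.\<close>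
    define R where "R = 4 * (C + 1) / e"
    have R: "R > 0" using e C0 by (simp add: R_def)
    obtain K where K: "\<And>N. N \<ge> 2 \<Longrightarrow> norm (\<Sum>n=1..N. a n / of_nat n) \<le> 2 * C / R + C / N + K / ln (real N)"
      using newman_partial_sum_bound[OF C U G sums R] by blast
    have "2 * C / R = e / 2 * (C / (C + 1))" using e C0 by (simp add: R_def field_simps)
    also have "\<dots> < e / 2 * 1" using e C0 by (intro mult_strict_left_mono) auto
    finally have "2 * C / R < e / 2" by simp
    moreover have "(\<lambda>N::nat. C / N + K / ln (real N)) \<longlonglongrightarrow> 0" by real_asymp
    hence "\<forall>\<^sub>F N::nat in sequentially. C / N + K / ln (real N) < e / 2"
      using e by (intro order_tendstoD) auto
    ultimately have "\<forall>\<^sub>F N::nat in sequentially. 2 * C / R + (C / N + K / ln (real N)) < e"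
      by (elim eventually_mono) linarith
    thus "\<forall>\<^sub>F N in sequentially. dist (\<Sum>n=1..N. a n / of_nat n) 0 < e"
      using eventually_ge_at_top[of 2] by eventually_elim (use K in force)
  qed
  moreover have "(\<Sum>n<Suc N. a n / of_nat n) = (\<Sum>n=1..N. a n / of_nat n)" for N
  proof -
    have "{..<Suc N} = insert 0 {1..N}" by auto
    thus ?thesis by simp
  qed
  ultimately have "(\<lambda>N. \<Sum>n<Suc N. a n / of_nat n) \<longlonglongrightarrow> 0" by simp
  thus ?thesis unfolding sums_def by (subst (asm) filterlim_sequentially_Suc)
qed

text \<open>Subtracting \<open>F 1\<close> from the coefficient at n = 1 turns the sum into F (1 +
  z) - F 1, which is z times a holomorphic function by removal of the singularity; the vanishing
  case then applies.\<close>

theorem newman_tauberian: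
  fixes a :: "nat \<Rightarrow> complex"
  assumes C: "\<And>n. norm (a n) \<le> C" and U: "open U" "{s. Re s \<ge> 1} \<subseteq> U" and F: "F holomorphic_on U"
    and sums: "\<And>s. Re s > 1 \<Longrightarrow> (\<lambda>n. a n * of_nat n powr (-s)) sums F s"
  shows "(\<lambda>n. a n / of_nat n) sums F 1"
proof -
  define V where "V = (\<lambda>z. 1 + z) -` U"
  have V: "open V" "{z. Re z \<ge> 0} \<subseteq> V"
    using U(1) subsetD[OF U(2)] unfolding V_def by (auto intro!: open_vimage continuous_intros)
  define f where "f = (\<lambda>z. F (1 + z))"
  have "F \<circ> (\<lambda>z. 1 + z) holomorphic_on V"
    by (rule holomorphic_on_compose_gen[OF _ F]) (auto intro!: holomorphic_intros simp: V_def)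
  hence f: "f holomorphic_on V" by (simp add: f_def o_def)
  define G where "G = (\<lambda>z. if z = 0 then deriv f 0 else (f z - f 0) / (z - 0))"
  have G: "G holomorphic_on V"
    unfolding G_def by (rule pole_lemma[OF f]) (use V in \<open>auto simp: interior_open\<close>)
  define b where "b = (\<lambda>n. a n - (if n = 1 then F 1 else 0))"
  have "(\<lambda>n. b n / of_nat n) sums 0"
  proof (rule newman_vanishing[OF _ V G])
    show "norm (b n) \<le> C + norm (F 1)" for n
    proof -
      have "norm (b n) \<le> norm (a n) + norm (if n = 1 then F 1 else 0)"
        unfolding b_def by (rule norm_triangle_ineq4)
      also have "\<dots> \<le> C + norm (F 1)" using C by (intro add_mono) auto
      finally show ?thesis .
    qed
    fix z assume z: "Re z > 0"
    have "(\<lambda>n. a n * of_nat n powr (-(1+z)) - (if n = 1 then F 1 else 0)) sums (F (1 + z) - F 1)"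
      using z by (intro sums_diff sums sums_single[of 1 "\<lambda>_. F 1"]) auto
    moreover have "(\<lambda>n. a n * of_nat n powr (-(1+z)) - (if n = 1 then F 1 else 0)) = (\<lambda>n. b n * of_nat n powr (-(1+z)))"
      by (auto simp: b_def fun_eq_iff algebra_simps)
    moreover have "F (1 + z) - F 1 = z * G z" using z by (auto simp: G_def f_def)
    ultimately show "(\<lambda>n. b n * of_nat n powr (-(1+z))) sums (z * G z)" by simp
  qed
  hence "(\<lambda>n. b n / of_nat n + (if n = 1 then F 1 else 0)) sums (0 + F 1)"
    by (intro sums_add sums_single[of 1 "\<lambda>_. F 1"])
  moreover have "(\<lambda>n. b n / of_nat n + (if n = 1 then F 1 else 0)) = (\<lambda>n. a n / of_nat n)"
    by (auto simp: b_def fun_eq_iff)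
  ultimately show ?thesis by simp
qed

section \<open>The von Mangoldt function and Chebyshev's bound\<close>

text \<open>The exponent of p in an lcm is the maximum of the exponents in the arguments, so a
  single argument carries the whole prime power.\<close>

lemma primepow_dvd_Lcm_iff:
  fixes A :: "nat set"
  assumes "finite A" "0 \<notin> A" "primepow q"
  shows "q dvd Lcm A \<longleftrightarrow> (\<exists>x\<in>A. q dvd x)"
proof
  assume q: "q dvd Lcm A"
  obtain p k where p: "prime p" "k > 0" "q = p ^ k" using assms(3) by (auto simp: primepow_def)
  show "\<exists>x\<in>A. q dvd x" using assms(1,2) q
  proof (induction A rule: finite_induct)
    case (insert x A)
    have nz: "x \<noteq> 0" "Lcm A \<noteq> 0" using insert by (auto simp: Lcm_0_iff_nat)
    have "k \<le> multiplicity p (lcm x (Lcm A))"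
      using insert.prems p nz by (intro multiplicity_geI) (auto simp: lcm_eq_0_iff)
    also have "\<dots> = max (multiplicity p x) (multiplicity p (Lcm A))"
      using nz p by (intro multiplicity_lcm) auto
    finally have "q dvd x \<or> q dvd Lcm A" using p multiplicity_dvd' by (auto simp: le_max_iff_disj)
    thus ?case using insert by auto
  qed (use p in auto)
qed (auto intro: dvd_trans dvd_Lcm)

lemma ln_eq_sum_mangoldt: "n > 0 \<Longrightarrow> ln (real n) = (\<Sum>d | d dvd n. mangoldt d)"
  using mangoldt_sum[of n, where ?'a = real] by simp

text \<open>The q that divide the Lcm but no member of \<open>A\<close> are not prime powers and
  carry weight 0.\<close>

lemma ln_Lcm_eq_sum_mangoldt:
  fixes A :: "nat set"
  assumes "finite A" "0 \<notin> A"
  shows "ln (real (Lcm A)) = (\<Sum>q | \<exists>x\<in>A. q dvd x. mangoldt q)"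
proof -
  have "Lcm A > 0" using assms by (auto simp: Lcm_0_iff_nat intro!: Nat.gr0I)
  hence fin: "finite {q. q dvd Lcm A}" "Lcm A > 0" by auto
  have "ln (real (Lcm A)) = (\<Sum>q | q dvd Lcm A. mangoldt q)" using fin by (intro ln_eq_sum_mangoldt)
  also have "\<dots> = (\<Sum>q | \<exists>x\<in>A. q dvd x. mangoldt q)"
    using primepow_dvd_Lcm_iff[OF assms] fin
    by (intro sum.mono_neutral_right) (auto simp: mangoldt_def intro: dvd_trans dvd_Lcm)
  finally show ?thesis .
qed

text \<open>Passing from n to n + 1 raises \<open>n div d\<close> by one exactly if d divides n + 1,
  and these d contribute ln (n + 1).\<close>

lemma ln_fact_eq_sum_mangoldt:
  "ln (fact n) = (\<Sum>d=1..n. mangoldt d * real (n div d))"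
proof (induction n)
  case (Suc n)
  have "ln (fact (Suc n)) = ln (real (Suc n)) + ln (fact n :: real)"
    by (simp add: ln_mult del: of_nat_Suc)
  also have "ln (real (Suc n)) = (\<Sum>d | d dvd Suc n. mangoldt d)" by (rule ln_eq_sum_mangoldt) auto
  also have "\<dots> = (\<Sum>d\<in>{1..Suc n}. if d dvd Suc n then mangoldt d else 0)"
    by (subst sum.inter_filter [symmetric]) (auto intro!: sum.cong simp: Suc_le_eq dvd_imp_le dest: dvd_imp_le intro: Nat.gr0I)
  also have "ln (fact n) = (\<Sum>d=1..Suc n. mangoldt d * real (n div d))"
    by (simp add: Suc.IH)
  also have "(\<Sum>d\<in>{1..Suc n}. if d dvd Suc n then mangoldt d else 0) + (\<Sum>d=1..Suc n. mangoldt d * real (n div d))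
      = (\<Sum>d=1..Suc n. mangoldt d * real (Suc n div d))"
    by (subst sum.distrib [symmetric], intro sum.cong) (auto simp: div_Suc dvd_eq_mod_eq_0 algebra_simps)
  finally show ?case .
qed auto

definition psi :: "nat \<Rightarrow> real" where "psi n = (\<Sum>d=1..n. mangoldt d)"

text \<open>Chebyshev's argument: the weight floor(2 n / d) - 2 floor(n / d) is nonnegative, and at
  least 1 for n < d <= 2 n, while the weighted sum is the logarithm of the central binomial
  coefficient, which is at most 4^n.\<close>

lemma psi_double_le: "psi (2 * n) - psi n \<le> 2 * real n * ln 2"
proof -
  have "psi (2 * n) - psi n = (\<Sum>d\<in>{1..2*n} - {1..n}. mangoldt d)"
    unfolding psi_def by (subst sum_diff) auto
  also have "\<dots> \<le> (\<Sum>d\<in>{1..2*n} - {1..n}. mangoldt d * (real (2 * n div d) - 2 * real (n div d)))"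
  proof (rule sum_mono)
    fix d assume d: "d \<in> {1..2*n} - {1..n}"
    have "n div d = 0" "2 * n div d \<ge> 1" using d by (auto simp: Suc_le_eq div_greater_zero_iff)
    thus "mangoldt d \<le> mangoldt d * (real (2 * n div d) - 2 * real (n div d))"
      using mult_left_mono[of 1 "real (2 * n div d)" "mangoldt d"] mangoldt_nonneg[of d] by simp
  qed
  also have "\<dots> \<le> (\<Sum>d=1..2*n. mangoldt d * (real (2 * n div d) - 2 * real (n div d)))"
  proof (rule sum_mono2)
    fix d
    have "2 * (n div d) * d \<le> 2 * n" by simp
    hence "2 * (n div d) \<le> 2 * n div d" by (cases "d = 0") (simp_all add: less_eq_div_iff_mult_less_eq)
    hence "real (2 * (n div d)) \<le> real (2 * n div d)" by (simp only: of_nat_le_iff)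
    thus "0 \<le> mangoldt d * (real (2 * n div d) - 2 * real (n div d))"
      by (intro mult_nonneg_nonneg mangoldt_nonneg) auto
  qed auto
  also have "\<dots> = (\<Sum>d=1..2*n. mangoldt d * real (2 * n div d)) - 2 * (\<Sum>d=1..2*n. mangoldt d * real (n div d))"
    by (simp add: sum_subtractf right_diff_distrib sum_distrib_left mult_ac)
  also have "(\<Sum>d=1..2*n. mangoldt d * real (n div d)) = (\<Sum>d=1..n. mangoldt d * real (n div d))"
    by (intro sum.mono_neutral_right) auto
  also have "(\<Sum>d=1..2*n. mangoldt d * real (2 * n div d)) - 2 * (\<Sum>d=1..n. mangoldt d * real (n div d))
      = ln (fact (2 * n) / (fact n * fact n))"
    by (simp add: ln_div ln_mult ln_fact_eq_sum_mangoldt)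
  also have "fact (2 * n) / (fact n * fact n) = real ((2 * n) choose n)"
    using binomial_fact[of n "2 * n", where ?'a = real] by simp
  also have "ln \<dots> \<le> ln (2 ^ (2 * n))"
  proof (subst ln_le_cancel_iff)
    have "(2 * n) choose n \<le> (\<Sum>k\<le>2*n. (2 * n) choose k)" by (rule member_le_sum) auto
    also have "\<dots> = 2 ^ (2 * n)" by (rule choose_row_sum)
    finally show "real ((2 * n) choose n) \<le> 2 ^ (2 * n)" by (metis of_nat_le_iff of_nat_numeral of_nat_power)
  qed auto
  finally show ?thesis by (simp add: ln_realpow)
qed

text \<open>Halving with m = n div 2. The estimates ln 2 <= 1 and ln n <= n - 1 are crude, but 6 m +
  2 m + (n - 1) <= 6 n still closes the induction.\<close>

lemma psi_le: "psi n \<le> 6 * real n"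
proof (induction n rule: less_induct)
  case (less n)
  show ?case
  proof (cases "n \<le> 1")
    case True
    hence "n = 0 \<or> n = 1" by auto
    thus ?thesis by (auto simp: psi_def)
  next
    case False
    define m where "m = n div 2"
    have m: "m < n" "n = 2 * m \<or> n = Suc (2 * m)" "m > 0" using False unfolding m_def by presburger+
    have "psi n \<le> psi (2 * m) + ln (real n)"
      using m(2)
    proof
      assume n: "n = Suc (2 * m)"
      have "psi n = psi (2 * m) + mangoldt n" by (simp add: psi_def n)
      also have "mangoldt n \<le> ln (real n)" using n by (intro mangoldt_le) auto
      finally show ?thesis by simp
    qed (use False in auto)
    also have "psi (2 * m) \<le> psi m + 2 * real m * ln 2" using psi_double_le[of m] by simp
    also have "psi m \<le> 6 * real m" by (rule less.IH) (rule m)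
    also have "ln (real n) \<le> real n - 1" using False by (intro ln_le_minus_one) auto
    finally have "psi n \<le> 6 * real m + 2 * real m * ln 2 + (real n - 1)" by simp
    also have "2 * real m * ln 2 \<le> 2 * real m * 1" using ln_le_minus_one[of 2] by (intro mult_left_mono) auto
    also have "6 * real m + 2 * real m * 1 + (real n - 1) \<le> 6 * real n" using m(2) by auto
    finally show ?thesis by simp
  qed
qed

section \<open>Dirichlet characters\<close>

text \<open>A subgroup of the units modulo \<open>m\<close> is encoded by the set of all naturals in its residue
  classes. Closure under inverses is automatic, as the unit group is finite.\<close>

definition unit_subgroup :: "nat \<Rightarrow> nat set \<Rightarrow> bool" where
  "unit_subgroup m H \<longleftrightarrow> 1 \<in> H \<and> (\<forall>x\<in>H. coprime x m) \<and> (\<forall>x\<in>H. \<forall>y\<in>H. x * y \<in> H)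
     \<and> (\<forall>x\<in>H. \<forall>y. [x = y] (mod m) \<longrightarrow> y \<in> H)"

definition char_on :: "nat \<Rightarrow> nat set \<Rightarrow> (nat \<Rightarrow> complex) \<Rightarrow> bool" where
  "char_on m H X \<longleftrightarrow> X 1 = 1 \<and> (\<forall>x\<in>H. \<forall>y\<in>H. X (x * y) = X x * X y)
     \<and> (\<forall>x\<in>H. \<forall>y\<in>H. [x = y] (mod m) \<longrightarrow> X x = X y)"

lemma char_onD:
  assumes "char_on m H X"
  shows "X 1 = 1" "\<And>x y. x \<in> H \<Longrightarrow> y \<in> H \<Longrightarrow> X (x * y) = X x * X y"
    "\<And>x y. x \<in> H \<Longrightarrow> y \<in> H \<Longrightarrow> [x = y] (mod m) \<Longrightarrow> X x = X y"
  using assms unfolding char_on_def by blast+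

lemma unit_subgroupD:
  assumes "unit_subgroup m H"
  shows "1 \<in> H" "\<And>x. x \<in> H \<Longrightarrow> coprime x m" "\<And>x y. x \<in> H \<Longrightarrow> y \<in> H \<Longrightarrow> x * y \<in> H"
    "\<And>x y. x \<in> H \<Longrightarrow> [x = y] (mod m) \<Longrightarrow> y \<in> H"
  using assms unfolding unit_subgroup_def by blast+

section \<open>Extension of characters from a subgroup of the units\<close>

lemma unit_subgroup_power: "unit_subgroup m H \<Longrightarrow> x \<in> H \<Longrightarrow> x ^ k \<in> H"
  using unit_subgroupD(1)[of m H] by (induction k) (simp_all add: unit_subgroupD(3)[of m H])

lemma char_on_power: "unit_subgroup m H \<Longrightarrow> char_on m H X \<Longrightarrow> x \<in> H \<Longrightarrow> X (x ^ k) = X x ^ k"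
  using char_onD(1)[of m H X] by (induction k) (simp_all add: char_onD(2)[of m H X] unit_subgroup_power)

text \<open>By Euler's theorem \<open>X x\<close> is a root of unity. For m = 0 the only element
  coprime to m is 1.\<close>

lemma char_on_nonzero:
  assumes H: "unit_subgroup m H" and X: "char_on m H X" and x: "x \<in> H"
  shows "X x \<noteq> 0"
proof (cases "totient m = 0")
  case True
  hence "m = 0" by simp
  hence "x = 1" using unit_subgroupD(2)[OF H x] by simp
  thus ?thesis using X by (simp add: char_on_def)
next
  case False
  have "[x ^ totient m = 1] (mod m)" by (intro euler_theorem unit_subgroupD(2)[OF H x])
  hence "X (x ^ totient m) = 1"
    using char_onD(3)[OF X unit_subgroup_power[OF H x] unit_subgroupD(1)[OF H]] char_onD(1)[OF X] by simp
  hence "X x ^ totient m = 1" using char_on_power[OF H X x] by simp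
  thus ?thesis using False by (auto simp: power_0_left)
qed

text \<open>The power h^(totient m - 1) lies in the subgroup and acts as the inverse of h.\<close>

lemma unit_subgroup_cancel:
  assumes H: "unit_subgroup m H" and "h \<in> H" "h * x \<in> H"
  shows "x \<in> H"
proof (cases "m = 0")
  case True
  hence "h = 1" using unit_subgroupD(2)[OF H assms(2)] by simp
  thus ?thesis using assms by simp
next
  case False
  hence "totient m > 0" by simp
  hence "h ^ (totient m - 1) * h = h ^ totient m" by (metis Suc_diff_1 mult.commute power_Suc)
  moreover have "[h ^ totient m = 1] (mod m)" by (intro euler_theorem unit_subgroupD(2)[OF H assms(2)])
  ultimately have "[h ^ (totient m - 1) * (h * x) = x] (mod m)"
    by (metis cong_scalar_right mult.assoc mult_1)
  moreover have "h ^ (totient m - 1) * (h * x) \<in> H"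
    by (intro unit_subgroupD(3)[OF H] unit_subgroup_power[OF H] assms)
  ultimately show ?thesis using unit_subgroupD(4)[OF H] by blast
qed

text \<open>\<open>k\<close> is the order of g in the quotient of the unit group by
  \<open>H\<close>.\<close>

lemma unit_subgroup_order:
  assumes m: "m > 0" and H: "unit_subgroup m H" and g: "coprime g m"
  obtains k where "k > 0" "g ^ k \<in> H" "\<And>j. 0 < j \<Longrightarrow> j < k \<Longrightarrow> g ^ j \<notin> H"
proof -
  have "g ^ totient m \<in> H"
    by (rule unit_subgroupD(4)[OF H unit_subgroupD(1)[OF H] cong_sym[OF euler_theorem[OF g]]])
  hence "\<exists>k>0. g ^ k \<in> H" using m by (intro exI[of _ "totient m"]) auto
  from LeastI_ex[OF this] not_less_Least[of _ "\<lambda>k. k > 0 \<and> g ^ k \<in> H"] show ?thesis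
    by (intro that[of "LEAST k. k > 0 \<and> g ^ k \<in> H"]) auto
qed

text \<open>The extension to the subgroup generated by \<open>H\<close> and g sends h g^i to X h
  z^i. Two representations of an element differ by a power of g lying in \<open>H\<close>, that is,
  by a multiple of k in the exponent, and \<open>z ^ k = X (g ^ k)\<close> makes both give the same
  value.\<close>

lemma char_on_extend_step:
  assumes m: "m > 0" and H: "unit_subgroup m H" and X: "char_on m H X" and g: "coprime g m"
    and k: "k > 0" "g ^ k \<in> H" "\<And>j. 0 < j \<Longrightarrow> j < k \<Longrightarrow> g ^ j \<notin> H" and z: "z ^ k = X (g ^ k)"
  obtains H' X' where "unit_subgroup m H'" "char_on m H' X'" "H \<subseteq> H'" "g \<in> H'"
    "\<And>x. x \<in> H \<Longrightarrow> X' x = X x" "X' g = z"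
proof -
  have dvd: "k dvd j" if "g ^ j \<in> H" for j
  proof (rule ccontr)
    assume "\<not> k dvd j"
    hence "0 < j mod k" "j mod k < k" using k(1) by (auto simp: mod_greater_zero_iff_not_dvd)
    moreover have "(g ^ k) ^ (j div k) * g ^ (j mod k) = g ^ j"
      by (simp flip: power_mult power_add)
    hence "g ^ (j mod k) \<in> H"
      using unit_subgroup_cancel[OF H unit_subgroup_power[OF H k(2), of "j div k"], of "g ^ (j mod k)"] that by simp
    ultimately show False using k(3) by blast
  qed
  \<comment> \<open>A relation "x is represented by (h, i)" with unrestricted exponents: products of
    representations then just add exponents, without any reduction modulo k.\<close>
  define R where "R = (\<lambda>x (h, i). h \<in> H \<and> [x = h * g ^ i] (mod m))"
  define H' where "H' = {x. \<exists>p. R x p}"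
  define v where "v = (\<lambda>(h, i). X h * z ^ i)"
  \<comment> \<open>Exponents are natural numbers, so the smaller power of g is cancelled first; the
    case i > j is recovered by symmetry in \<open>wd\<close>.\<close>
  have wd1: "X h * z ^ i = X h' * z ^ j"
    if hh: "h \<in> H" "h' \<in> H" "[h * g ^ i = h' * g ^ j] (mod m)" "i \<le> j" for h h' i j
  proof -
    have "g ^ j = g ^ i * g ^ (j - i)" using hh(4) by (simp flip: power_add)
    hence "[g ^ i * h = g ^ i * (h' * g ^ (j - i))] (mod m)"
      using hh(3) by (simp add: mult_ac)
    hence c: "[h = h' * g ^ (j - i)] (mod m)" using g by (subst (asm) cong_mult_lcancel_nat) auto
    hence "h' * g ^ (j - i) \<in> H" using unit_subgroupD(4)[OF H hh(1)] by blast
    hence gH: "g ^ (j - i) \<in> H" using unit_subgroup_cancel[OF H hh(2)] by auto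
    have "k dvd j - i" by (rule dvd[OF gH])
    then obtain q where q: "j - i = k * q" by (rule dvdE)
    have "X h = X (h' * g ^ (j - i))"
      by (rule char_onD(3)[OF X hh(1) \<open>h' * g ^ (j - i) \<in> H\<close> c])
    also have "\<dots> = X h' * X (g ^ (j - i))" by (rule char_onD(2)[OF X hh(2) gH])
    also have "X (g ^ (j - i)) = z ^ (j - i)"
      using char_on_power[OF H X k(2), of q] z by (simp add: q power_mult)
    finally have "X h * z ^ i = X h' * (z ^ (j - i) * z ^ i)" by simp
    also have "z ^ (j - i) * z ^ i = z ^ j" using hh(4) by (simp flip: power_add)
    finally show ?thesis .
  qed
  have wd: "v p = v q" if "R x p" "R y q" "[x = y] (mod m)" for p q x y
  proof -
    obtain h i where p: "p = (h, i)" by (cases p) 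
    obtain h' j where q: "q = (h', j)" by (cases q) 
    have e: "[x = h * g ^ i] (mod m)" "[y = h' * g ^ j] (mod m)" using that by (auto simp: R_def p q)
    have c: "[h * g ^ i = h' * g ^ j] (mod m)" by (rule cong_trans[OF cong_sym[OF e(1)] cong_trans[OF that(3) e(2)]])
    have hh: "h \<in> H" "h' \<in> H" using that(1,2) by (simp_all add: R_def p q)
    show ?thesis using wd1[OF hh c] wd1[OF hh(2,1) cong_sym[OF c]]
      by (cases "i \<le> j") (simp_all add: v_def p q)
  qed
  \<comment> \<open>Any representation may be chosen because of \<open>wd\<close>; outside
    \<open>H'\<close> the value is arbitrary.\<close>
  define X' where "X' = (\<lambda>x. v (SOME p. R x p))"
  have X'_eq: "X' x = v p" if "R x p" for x p
    unfolding X'_def by (rule wd[OF someI[of "R x", OF that] that cong_refl])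
  have RH: "R x (x, 0)" if "x \<in> H" for x using that by (simp add: R_def)
  have Rg: "R g (1, 1)" using unit_subgroupD(1)[OF H] by (simp add: R_def)
  have R1: "R 1 (1, 0)" using unit_subgroupD(1)[OF H] by (simp add: R_def)
  have Rmult: "R (x * y) (h * h', i + j)" if "R x (h, i)" "R y (h', j)" for x y h h' i j
  proof -
    have "[x * y = (h * g ^ i) * (h' * g ^ j)] (mod m)" using that by (intro cong_mult) (auto simp: R_def)
    thus ?thesis using that unit_subgroupD(3)[OF H] by (auto simp: R_def power_add mult_ac)
  qed
  have Rcong: "R y p" if "R x p" "[x = y] (mod m)" for x y p
    using that(1) cong_trans[OF cong_sym[OF that(2)]] by (auto simp: R_def)
  show ?thesis
  proof (rule that[of H' X'])
    show "unit_subgroup m H'" unfolding unit_subgroup_def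
    proof (intro conjI ballI allI impI)
      show "1 \<in> H'" using R1 by (auto simp: H'_def)
      show "coprime x m" if x: "x \<in> H'" for x
      proof -
        obtain h i where "h \<in> H" "[x = h * g ^ i] (mod m)" using x by (auto simp: H'_def R_def)
        moreover have "coprime (h * g ^ i) m" using unit_subgroupD(2)[OF H \<open>h \<in> H\<close>] g by simp
        ultimately show ?thesis using cong_imp_coprime[of "h * g ^ i" x m] by (simp add: cong_sym_eq)
      qed
      show "x * y \<in> H'" if "x \<in> H'" "y \<in> H'" for x y
        using that Rmult unfolding H'_def by fast
      show "y \<in> H'" if "x \<in> H'" "[x = y] (mod m)" for x y
        using that Rcong[of x _ y] unfolding H'_def by blast
    qed
    show "char_on m H' X'" unfolding char_on_def
    proof (intro conjI ballI impI)
      show "X' 1 = 1" using X'_eq[OF R1] char_onD(1)[OF X] by (simp add: v_def)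
      show "X' (x * y) = X' x * X' y" if xy: "x \<in> H'" "y \<in> H'" for x y
      proof -
        obtain h i where 1: "R x (h, i)" using xy by (auto simp: H'_def)
        obtain h' j where 2: "R y (h', j)" using xy by (auto simp: H'_def)
        have "h \<in> H" "h' \<in> H" using 1 2 by (auto simp: R_def)
        thus ?thesis using char_onD(2)[OF X] X'_eq[OF 1] X'_eq[OF 2] X'_eq[OF Rmult[OF 1 2]]
          by (simp add: v_def power_add)
      qed
      show "X' x = X' y" if xy: "x \<in> H'" "y \<in> H'" "[x = y] (mod m)" for x y
      proof -
        obtain p where 1: "R x p" using xy by (auto simp: H'_def)
        from X'_eq[OF 1] X'_eq[OF Rcong[OF 1 xy(3)]] show ?thesis by simp
      qed
    qed
    show "H \<subseteq> H'" using RH by (auto simp: H'_def)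
    show "g \<in> H'" using Rg by (auto simp: H'_def)
    show "X' x = X x" if "x \<in> H" for x using X'_eq[OF RH[OF that]] by (simp add: v_def)
    show "X' g = z" using X'_eq[OF Rg] char_onD(1)[OF X] by (simp add: v_def)
  qed
qed

lemma complex_root_exists: "k > 0 \<Longrightarrow> w \<noteq> 0 \<Longrightarrow> \<exists>z::complex. z ^ k = w"
  by (intro exI[of _ "exp (Ln w / of_nat k)"]) (simp flip: exp_of_nat_mult)

text \<open>Induction on the number of reduced residues outside \<open>H\<close>, adjoining one g at
  a time. A k-th root of \<open>X (g ^ k)\<close> exists, and any of them serves, because that value
  is nonzero.\<close>

lemma char_on_extend:
  assumes m: "m > 0" and H: "unit_subgroup m H" and X: "char_on m H X"
  shows "\<exists>X'. char_on m {x. coprime x m} X' \<and> (\<forall>x\<in>H. X' x = X x)"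
  using H X
proof (induction "card {x. x < m \<and> coprime x m \<and> x \<notin> H}" arbitrary: H X rule: less_induct)
  case (less H X)
  show ?case
  proof (cases "\<exists>g. coprime g m \<and> g \<notin> H")
    case False
    hence "H = {x. coprime x m}" using unit_subgroupD(2)[OF less.prems(1)] by blast
    thus ?thesis using less.prems by auto
  next
    case True
    then obtain g where g: "coprime g m" "g \<notin> H" by blast
    obtain k where k: "k > 0" "g ^ k \<in> H" "\<And>j. 0 < j \<Longrightarrow> j < k \<Longrightarrow> g ^ j \<notin> H"
      by (rule unit_subgroup_order[OF m less.prems(1) g(1)]) blast
    obtain z where z: "z ^ k = X (g ^ k)"
      using complex_root_exists[OF k(1) char_on_nonzero[OF less.prems k(2)]] by blast
    obtain H' X' where H': "unit_subgroup m H'" "char_on m H' X'" "H \<subseteq> H'" "g \<in> H'"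
      "\<And>x. x \<in> H \<Longrightarrow> X' x = X x" "X' g = z"
      by (rule char_on_extend_step[OF m less.prems g(1) k z]) blast+
    have "card {x. x < m \<and> coprime x m \<and> x \<notin> H'} < card {x. x < m \<and> coprime x m \<and> x \<notin> H}"
    proof (rule psubset_card_mono)
      have gm: "[g mod m = g] (mod m)" by simp
      \<comment> \<open>Only representatives below m are counted, so g is replaced by its residue,
        which lies in the same class and hence in the same subgroups.\<close>
      have "g mod m \<notin> H" using g unit_subgroupD(4)[OF less.prems(1) _ gm] by blast
      moreover have "g mod m \<in> H'" by (rule unit_subgroupD(4)[OF H'(1,4) cong_sym[OF gm]])
      moreover have "coprime (g mod m) m" using g m by simp
      ultimately show "{x. x < m \<and> coprime x m \<and> x \<notin> H'} \<subset> {x. x < m \<and> coprime x m \<and> x \<notin> H}"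
        using H'(3) m by (intro psubsetI) (auto intro!: mod_less_divisor)
    qed auto
    then obtain X'' where X'': "char_on m {x. coprime x m} X''" "\<And>x. x \<in> H' \<Longrightarrow> X'' x = X' x"
      using less.hyps[OF _ H'(1,2)] by blast
    have "X'' x = X x" if "x \<in> H" for x using X''(2)[of x] H'(5)[OF that] that H'(3) by (simp add: subset_iff)
    with X''(1) show ?thesis by blast
  qed
qed

text \<open>Start from the trivial character on the class of 1, extend it to the cyclic group
  generated by g with a primitive root of unity at g, and then to all units.\<close>

lemma exists_separating_char:
  assumes m: "m > 0" and g: "coprime g m" "\<not> [g = 1] (mod m)"
  shows "\<exists>X. char_on m {x. coprime x m} X \<and> X g \<noteq> 1"
proof -
  define H where "H = {x. [x = 1] (mod m)}"
  have H: "unit_subgroup m H" unfolding unit_subgroup_def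
  proof (intro conjI ballI allI impI)
    show "coprime x m" if "x \<in> H" for x
      using that cong_imp_coprime[of 1 x m] by (simp add: H_def cong_sym_eq)
    show "x * y \<in> H" if "x \<in> H" "y \<in> H" for x y
      using that cong_mult[of x 1 m y 1] by (simp add: H_def)
    show "y \<in> H" if "x \<in> H" "[x = y] (mod m)" for x y
      using that cong_trans[OF cong_sym[OF that(2)], of 1] by (simp add: H_def)
  qed (simp add: H_def)
  have one: "char_on m H (\<lambda>_. 1)" by (simp add: char_on_def)
  obtain k where k: "k > 0" "g ^ k \<in> H" "\<And>j. 0 < j \<Longrightarrow> j < k \<Longrightarrow> g ^ j \<notin> H"
    by (rule unit_subgroup_order[OF m H g(1)]) blast
  \<comment> \<open>The order k of g exceeds 1, which is what makes the primitive k-th root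
    \<open>z\<close> differ from 1.\<close>
  have "k \<noteq> 1" using k(2) g by (auto simp: H_def)
  define z where "z = cis (2 * pi / k)"
  have "z ^ k = cis (real k * (2 * pi / k))" unfolding z_def by (rule Complex.DeMoivre)
  hence z: "z ^ k = 1" using k by simp
  have "z \<noteq> 1"
  proof
    assume "z = 1"
    hence "cos (2 * pi / k) = 1" by (simp add: z_def complex_eq_iff)
    then obtain n :: int where "2 * pi / k = n * 2 * pi" using cos_one_2pi_int by auto
    hence "real_of_int n * real k = 1" using k by (simp add: field_simps)
    hence "n * int k = 1" by (metis of_int_eq_1_iff of_int_mult of_int_of_nat_eq)
    hence "k = 1" by (auto simp: zmult_eq_1_iff)
    with \<open>k \<noteq> 1\<close> show False by simp
  qed
  obtain H' X' where H': "unit_subgroup m H'" "char_on m H' X'" "H \<subseteq> H'" "g \<in> H'"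
      "\<And>x. x \<in> H \<Longrightarrow> X' x = 1" "X' g = z"
    by (rule char_on_extend_step[OF m H one g(1) k z]) blast+
  obtain X'' where "char_on m {x. coprime x m} X''" "\<And>x. x \<in> H' \<Longrightarrow> X'' x = X' x"
    using char_on_extend[OF m H'(1,2)] by blast
  thus ?thesis using H'(4,6) \<open>z \<noteq> 1\<close> by auto
qed

section \<open>Dirichlet characters as periodic functions, and their orthogonality\<close>

definition dchars :: "nat \<Rightarrow> (nat \<Rightarrow> complex) set" where
  "dchars m = {X. (\<forall>x y. X (x * y) = X x * X y) \<and> (\<forall>x. X (x + m) = X x) \<and> (\<forall>x. X x \<noteq> 0 \<longleftrightarrow> coprime x m)}"

definition dchar0 :: "nat \<Rightarrow> nat \<Rightarrow> complex" where
  "dchar0 m x = (if coprime x m then 1 else 0)"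

lemma dchars_mult: "X \<in> dchars m \<Longrightarrow> X (x * y) = X x * X y"
  by (simp add: dchars_def)

lemma dchars_eq_0_iff: "X \<in> dchars m \<Longrightarrow> X x = 0 \<longleftrightarrow> \<not> coprime x m"
  unfolding dchars_def by blast

text \<open>X 1 is idempotent and, 1 being coprime to m, nonzero.\<close>

lemma dchars_1: "X \<in> dchars m \<Longrightarrow> X (Suc 0) = 1"
  using dchars_mult[of X m 1 1] dchars_eq_0_iff[of X m 1] by simp

lemma dchars_add_mult: "X \<in> dchars m \<Longrightarrow> X (x + m * k) = X x"
proof (induction k)
  case (Suc k)
  have "X (x + m * Suc k) = X (x + m * k + m)" by (simp add: add_ac)
  also have "\<dots> = X (x + m * k)" using Suc.prems unfolding dchars_def by blast
  finally show ?case using Suc by simp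
qed simp

lemma dchars_mod: "X \<in> dchars m \<Longrightarrow> X (x mod m) = X x"
  using dchars_add_mult[of X m "x mod m" "x div m"] by simp

lemma dchars_cong:
  assumes "X \<in> dchars m" "[x = y] (mod m)"
  shows "X x = X y"
proof -
  have "X x = X (x mod m)" by (rule dchars_mod[OF assms(1), symmetric])
  also have "x mod m = y mod m" using assms(2) by (simp add: unique_euclidean_semiring_class.cong_def)
  also have "X \<dots> = X y" by (rule dchars_mod[OF assms(1)])
  finally show ?thesis .
qed

lemma dchars_cong_1: "X \<in> dchars m \<Longrightarrow> [x = 1] (mod m) \<Longrightarrow> X x = 1"
  using dchars_cong[of X m x 1] dchars_1[of X m] by simp

lemma dchars_power: "X \<in> dchars m \<Longrightarrow> X (x ^ k) = X x ^ k"
  by (induction k) (simp_all add: dchars_mult dchars_1)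

lemma dchars_totient: "X \<in> dchars m \<Longrightarrow> coprime x m \<Longrightarrow> X x ^ totient m = 1"
  using dchars_cong[OF _ euler_theorem, of X m x] by (simp add: dchars_power dchars_1)

lemma norm_dchars:
  assumes "m > 0" "X \<in> dchars m"
  shows "norm (X x) = (if coprime x m then 1 else 0)"
proof (cases "coprime x m")
  case True
  have "norm (X x) ^ totient m = 1" using dchars_totient[OF assms(2) True] by (metis norm_one norm_power)
  thus ?thesis using True assms(1) power_eq_iff_eq_base[of "totient m" "norm (X x)" 1] by simp
qed (use dchars_eq_0_iff[OF assms(2), of x] in simp)

lemma norm_dchars_le: "m > 0 \<Longrightarrow> X \<in> dchars m \<Longrightarrow> norm (X x) \<le> 1"
  by (simp add: norm_dchars)

lemma dchars_mult_cnj: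
  assumes "m > 0" "X \<in> dchars m" "coprime x m"
  shows "X x * cnj (X x) = 1"
  using norm_dchars[OF assms(1,2), of x] assms(3) complex_norm_square[of "X x"] by simp

lemma coprime_add_self_iff: "coprime (x + m) m \<longleftrightarrow> coprime x (m :: nat)"
  unfolding coprime_iff_gcd_eq_1 gcd_add1 ..

lemma dchar0_in: "dchar0 m \<in> dchars m"
  by (auto simp: dchars_def dchar0_def coprime_add_self_iff)

lemma dchars_times: "X \<in> dchars m \<Longrightarrow> X' \<in> dchars m \<Longrightarrow> (\<lambda>x. X x * X' x) \<in> dchars m"
  by (auto simp: dchars_def)

text \<open>A character is determined by its values on the residues below m, and each value is 0 or
  a root of unity of order dividing \<open>totient m\<close>.\<close>

lemma finite_dchars:
  assumes m: "m > 0"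
  shows "finite (dchars m)"
proof (rule finite_imageD)
  let ?T = "insert 0 {z::complex. z ^ totient m = 1}"
  show "finite ((\<lambda>X. restrict X {..<m}) ` dchars m)"
  proof (rule finite_subset)
    show "(\<lambda>X. restrict X {..<m}) ` dchars m \<subseteq> {..<m} \<rightarrow>\<^sub>E ?T"
    proof (intro image_subsetI)
      fix X assume X: "X \<in> dchars m"
      have "X x \<in> ?T" for x
        using dchars_totient[OF X, of x] dchars_eq_0_iff[OF X, of x] by (cases "coprime x m") simp_all
      thus "restrict X {..<m} \<in> {..<m} \<rightarrow>\<^sub>E ?T" unfolding restrict_PiE_iff by blast
    qed
    show "finite ({..<m} \<rightarrow>\<^sub>E ?T)"
      using m finite_roots_unity[of "totient m", where ?'a = complex] by (intro finite_PiE) auto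
  qed
  show "inj_on (\<lambda>X. restrict X {..<m}) (dchars m)"
  proof (rule inj_onI, rule ext)
    fix X X' x assume *: "X \<in> dchars m" "X' \<in> dchars m" "restrict X {..<m} = restrict X' {..<m}"
    have "X (x mod m) = X' (x mod m)" using fun_cong[OF *(3), of "x mod m"] m by simp
    thus "X x = X' x" using dchars_mod[OF *(1)] dchars_mod[OF *(2)] by simp
  qed
qed

text \<open>If X y is neither 0 nor 1, multiplication by y permutes the residues and multiplies the
  sum by X y.\<close>

lemma sum_dchars_residues:
  assumes m: "m > 0" and X: "X \<in> dchars m"
  shows "(\<Sum>x<m. X x) = (if X = dchar0 m then of_nat (totient m) else 0)"
proof (cases "X = dchar0 m")
  case True
  have "card {x\<in>{..<m}. coprime x m} = totient m"
  \<comment> \<open>For m = 1 the residue set is {0} while the totatives are {1}; for larger m the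
    two sets agree.\<close>
  proof (cases "m = 1")
    case False
    have "{x\<in>{..<m}. coprime x m} = totatives m"
    proof (intro equalityI subsetI)
      fix x assume "x \<in> totatives m"
      moreover from this have "x \<noteq> m" using False by (auto simp: totatives_def)
      ultimately show "x \<in> {x\<in>{..<m}. coprime x m}" by (auto simp: totatives_def)
    qed (use False in \<open>auto simp: totatives_def intro!: Nat.gr0I\<close>)
    thus ?thesis by (simp add: totient_def)
  qed (simp add: lessThan_Suc)
  thus ?thesis using True by (simp add: dchar0_def sum.If_cases Int_def)
next
  case False
  then obtain y where "X y \<noteq> dchar0 m y" by auto
  hence y: "coprime y m" "X y \<noteq> 1" using dchars_eq_0_iff[OF X, of y] by (auto simp: dchar0_def split: if_splits)
  have bij: "bij_betw (\<lambda>x. y * x mod m) {..<m} {..<m}"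
  proof (rule bij_betw_imageI)
    show inj: "inj_on (\<lambda>x. y * x mod m) {..<m}"
    proof (rule inj_onI)
      fix u v assume uv: "u \<in> {..<m}" "v \<in> {..<m}" "y * u mod m = y * v mod m"
      hence "[y * u = y * v] (mod m)" by (simp add: unique_euclidean_semiring_class.cong_def)
      hence "[u = v] (mod m)" using y(1) by (simp add: cong_mult_lcancel_nat)
      thus "u = v" using uv by (simp add: unique_euclidean_semiring_class.cong_def)
    qed
    show "(\<lambda>x. y * x mod m) ` {..<m} = {..<m}"
      using m by (intro endo_inj_surj inj) auto
  qed
  have "X y * (\<Sum>x<m. X x) = (\<Sum>x<m. X (y * x mod m))"
    by (simp add: sum_distrib_left dchars_mult[OF X] dchars_mod[OF X])
  also have "\<dots> = (\<Sum>x<m. X x)" by (rule sum.reindex_bij_betw[OF bij])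
  finally show ?thesis using y False by simp
qed

lemma exists_separating_dchar:
  assumes m: "m > 0" and g: "coprime g m" "\<not> [g = 1] (mod m)"
  obtains X where "X \<in> dchars m" "X g \<noteq> 1"
proof -
  obtain \<eta> where \<eta>: "char_on m {x. coprime x m} \<eta>" "\<eta> g \<noteq> 1" using exists_separating_char[OF assms] by blast
  have H: "unit_subgroup m {x. coprime x m}"
    by (auto simp: unit_subgroup_def dest: cong_imp_coprime)
  define X where "X = (\<lambda>x. if coprime x m then \<eta> x else 0)"
  have "X \<in> dchars m" unfolding dchars_def
  proof (intro CollectI conjI allI)
    show "X (x * y) = X x * X y" for x y using char_onD(2)[OF \<eta>(1), of x y] by (auto simp: X_def)
    show "X (x + m) = X x" for x using char_onD(3)[OF \<eta>(1), of "x + m" x]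
      by (simp add: X_def coprime_add_self_iff unique_euclidean_semiring_class.cong_def)
    show "X x \<noteq> 0 \<longleftrightarrow> coprime x m" for x using char_on_nonzero[OF H \<eta>(1), of x] by (auto simp: X_def)
  qed
  moreover have "X g \<noteq> 1" using \<eta> g by (simp add: X_def)
  ultimately show ?thesis by (rule that)
qed

text \<open>Dually, multiplication by a character \<eta> with \<eta> x \<noteq> 1 permutes the
  characters and multiplies the sum by \<eta> x.\<close>

lemma sum_dchars_eq_0:
  assumes m: "m > 0" and x: "\<not> [x = 1] (mod m)"
  shows "(\<Sum>X\<in>dchars m. X x) = 0"
proof (cases "coprime x m")
  case False
  thus ?thesis by (intro sum.neutral) (auto simp: dchars_eq_0_iff)
next
  case True
  obtain \<eta> where \<eta>: "\<eta> \<in> dchars m" "\<eta> x \<noteq> 1" using exists_separating_dchar[OF m True x] by blast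
  define f where "f = (\<lambda>X y. \<eta> y * X y :: complex)"
  have inj: "inj_on f (dchars m)"
  proof (rule inj_onI, rule ext)
    fix X X' y assume *: "X \<in> dchars m" "X' \<in> dchars m" "f X = f X'"
    show "X y = X' y"
    proof (cases "coprime y m")
      case True
      thus ?thesis using fun_cong[OF *(3), of y] dchars_eq_0_iff[OF \<eta>(1), of y] by (simp add: f_def)
    next
      case False
      hence "X y = 0" "X' y = 0" using * dchars_eq_0_iff by auto
      thus ?thesis by simp
    qed
  qed
  have "f ` dchars m = dchars m"
    using \<eta>(1) dchars_times by (intro endo_inj_surj finite_dchars m inj) (auto simp: f_def)
  hence "(\<Sum>X\<in>dchars m. X x) = (\<Sum>X\<in>dchars m. f X x)"
    using sum.reindex[OF inj, of "\<lambda>X. X x"] by simp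
  also have "\<dots> = \<eta> x * (\<Sum>X\<in>dchars m. X x)" by (simp add: f_def sum_distrib_left)
  finally show ?thesis using \<eta>(2) by simp
qed

text \<open>Double counting of X x over all residues and all characters: in one order only the class
  of 1 survives, in the other only the principal character.\<close>

lemma card_dchars:
  assumes m: "m > 0"
  shows "card (dchars m) = totient m"
proof -
  \<comment> \<open>The class of 1 is written \<open>1 mod m\<close> because for m = 1 its
    representative is 0.\<close>
  have "(\<Sum>x<m. \<Sum>X\<in>dchars m. X x) = (\<Sum>x<m. if x = 1 mod m then of_nat (card (dchars m)) else 0 :: complex)"
  proof (intro sum.cong refl)
    fix x assume x: "x \<in> {..<m}"
    show "(\<Sum>X\<in>dchars m. X x) = (if x = 1 mod m then of_nat (card (dchars m)) else 0 :: complex)"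
    proof (cases "x = 1 mod m")
      case True
      hence "[x = 1] (mod m)" by (simp add: unique_euclidean_semiring_class.cong_def)
      hence "(\<Sum>X\<in>dchars m. X x) = (\<Sum>X\<in>dchars m. 1)"
        by (intro sum.cong refl dchars_cong_1)
      thus ?thesis using True by simp
    next
      case False
      hence "\<not> [x = 1] (mod m)" using x by (auto simp: unique_euclidean_semiring_class.cong_def)
      thus ?thesis using sum_dchars_eq_0[OF m] False by simp
    qed
  qed
  also have "\<dots> = of_nat (card (dchars m))" using m by simp
  also have "(\<Sum>x<m. \<Sum>X\<in>dchars m. X x) = (\<Sum>X\<in>dchars m. \<Sum>x<m. X x)" by (rule sum.swap)
  also have "\<dots> = (\<Sum>X\<in>dchars m. if X = dchar0 m then of_nat (totient m) else 0)"
    by (intro sum.cong refl sum_dchars_residues m)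
  also have "\<dots> = of_nat (totient m)" using finite_dchars[OF m] dchar0_in by simp
  finally show ?thesis by (simp only: of_nat_eq_iff)
qed

text \<open>The conjugate of X c is X d for an inverse d of c modulo m, which reduces the claim to
  the sum at d x.\<close>

lemma dchars_orthogonality:
  assumes m: "m > 0" and c: "coprime c m"
  shows "(\<Sum>X\<in>dchars m. cnj (X c) * X x) = (if [x = c] (mod m) then of_nat (totient m) else 0)"
proof -
  obtain d where d: "[c * d = 1] (mod m)" using cong_solve_coprime_nat[OF c] by auto
  have cd: "cnj (X c) * X x = X (d * x)" if X: "X \<in> dchars m" for X
  proof -
    have "X c * X d = 1" using dchars_cong[OF X d] by (simp add: dchars_mult[OF X] dchars_1[OF X])
    moreover have "X c * cnj (X c) = 1" by (rule dchars_mult_cnj[OF m X c])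
    ultimately have "cnj (X c) = X d" using dchars_eq_0_iff[OF X, of c] c by (metis mult_left_cancel)
    thus ?thesis by (simp add: dchars_mult[OF X])
  qed
  have eq: "[d * x = 1] (mod m) \<longleftrightarrow> [x = c] (mod m)"
  proof
    assume "[d * x = 1] (mod m)"
    hence "[c * (d * x) = c * 1] (mod m)" by (rule cong_scalar_left)
    moreover have "[c * d * x = 1 * x] (mod m)" by (rule cong_scalar_right[OF d])
    ultimately have "[c * (d * x) = c] (mod m)" "[c * (d * x) = x] (mod m)" by (simp_all add: mult.assoc)
    thus "[x = c] (mod m)" by (metis unique_euclidean_semiring_class.cong_def)
  next
    assume "[x = c] (mod m)"
    hence "[d * x = d * c] (mod m)" by (rule cong_scalar_left)
    moreover have "[d * c = 1] (mod m)" using d by (simp add: mult.commute)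
    ultimately show "[d * x = 1] (mod m)" by (rule cong_trans)
  qed
  have "(\<Sum>X\<in>dchars m. cnj (X c) * X x) = (\<Sum>X\<in>dchars m. X (d * x))" by (intro sum.cong refl cd)
  also have "\<dots> = (if [x = c] (mod m) then of_nat (totient m) else 0)"
  proof (cases "[x = c] (mod m)")
    case True
    hence "[d * x = 1] (mod m)" using eq by blast
    hence "(\<Sum>X\<in>dchars m. X (d * x)) = (\<Sum>X\<in>dchars m. 1)"
      by (intro sum.cong refl dchars_cong_1)
    thus ?thesis using True by (simp add: card_dchars[OF m])
  qed (use sum_dchars_eq_0[OF m] eq in simp)
  finally show ?thesis .
qed

section \<open>Non-vanishing at 1 for real characters\<close>

text \<open>Unconditional summation allows regrouping by the product n = d j, through the bijection
  (d, j) to (d j, d).\<close>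

lemma has_sum_divisor_rearrange:
  fixes T :: "nat \<Rightarrow> nat \<Rightarrow> 'a :: {topological_comm_monoid_add, t3_space}"
  assumes "((\<lambda>(d, j). T d j) has_sum S) ({0<..} \<times> {0<..})"
  shows "((\<lambda>n. \<Sum>d | d dvd n. T d (n div d)) has_sum S) {0<..}"
proof (rule has_sum_SigmaD)
  show "((\<lambda>(n, d). T d (n div d)) has_sum S) (Sigma {0<..} (\<lambda>n. {d. d dvd n}))"
    using assms
  proof (subst has_sum_reindex_bij_witness[where i = "\<lambda>(d, j). (d * j, d)" and j = "\<lambda>(n, d). (d, n div d)"
        and T = "{0<..} \<times> {0<..}" and h = "\<lambda>(d, j). T d j" and s' = S])
  qed (auto intro: Nat.gr0I elim!: dvdE)
  show "((\<lambda>d. case (n, d) of (n, d) \<Rightarrow> T d (n div d)) has_sum (\<Sum>d | d dvd n. T d (n div d))) {d. d dvd n}"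
    if "n \<in> {0<..}" for n
    using that by (simp add: has_sum_finite)
qed

text \<open>A divisor of a b is u v for unique u and v, recovered as its gcds with a and with
  b.\<close>

lemma sum_divisors_mult_coprime:
  fixes f :: "nat \<Rightarrow> 'a :: comm_semiring_1"
  assumes f: "\<And>x y. f (x * y) = f x * f y" and ab: "coprime a b" "a > 0" "b > 0"
  shows "(\<Sum>d | d dvd a * b. f d) = (\<Sum>d | d dvd a. f d) * (\<Sum>d | d dvd b. f d)"
proof -
  have gcds: "gcd (u * v) a = u" "gcd (u * v) b = v" if "u dvd a" "v dvd b" for u v
  proof -
    have "coprime u b" "coprime v a" using that ab(1) coprime_divisors[of u a b b] coprime_divisors[of v b a a]
      by (auto simp: coprime_commute)
    thus "gcd (u * v) a = u" "gcd (u * v) b = v"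
      using that by (simp_all add: gcd_mult_right_right_cancel gcd_mult_right_left_cancel gcd.commute
        gcd_proj1_if_dvd gcd_nat.absorb1 coprime_commute)
  qed
  have "(\<Sum>d | d dvd a. f d) * (\<Sum>d | d dvd b. f d) = (\<Sum>(d, e)\<in>{d. d dvd a} \<times> {e. e dvd b}. f (d * e))"
    by (simp add: sum_product sum.cartesian_product f)
  also have "\<dots> = (\<Sum>d | d dvd a * b. f d)"
  proof (rule sum.reindex_bij_witness[where i = "\<lambda>d. (gcd d a, gcd d b)" and j = "\<lambda>(d, e). d * e"])
    fix d assume "d \<in> {d. d dvd a * b}"
    then obtain u v where "d = u * v" "u dvd a" "v dvd b" by (auto elim: dvd_productE)
    thus "(case (gcd d a, gcd d b) of (d, e) \<Rightarrow> d * e) = d" using gcds by simp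
  qed (auto simp: gcds intro: mult_dvd_mono)
  finally show ?thesis ..
qed

lemma sum_divisors_prime_power:
  fixes f :: "nat \<Rightarrow> real"
  assumes f: "\<And>x y. f (x * y) = f x * f y" "f 1 = 1" and range: "\<And>x. f x \<in> {-1, 0, 1}" and p: "prime p"
  shows "(\<Sum>d | d dvd p ^ k. f d) \<ge> 0" "even k \<Longrightarrow> (\<Sum>d | d dvd p ^ k. f d) \<ge> 1"
proof -
  have pow: "f (p ^ i) = f p ^ i" for i by (induction i) (use f in auto)
  have "{d. d dvd p ^ k} = (\<lambda>i. p ^ i) ` {..k}"
    using p by (auto simp: divides_primepow_nat)
  moreover have "inj_on (\<lambda>i. p ^ i) {..k}" using p by (auto intro!: inj_onI simp: prime_gt_Suc_0_nat)
  ultimately have eq: "(\<Sum>d | d dvd p ^ k. f d) = (\<Sum>i\<le>k. f p ^ i)" by (simp add: sum.reindex pow)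
  consider "f p = -1" | "f p = 0" | "f p = 1" using range[of p] by auto
  hence "(\<Sum>i\<le>k. f p ^ i) \<ge> 0 \<and> (even k \<longrightarrow> (\<Sum>i\<le>k. f p ^ i) \<ge> 1)"
  proof cases
    case 1
    have "(\<Sum>i\<le>k. (-1) ^ i) = (if even k then 1 else 0 :: real)" by (induction k) auto
    thus ?thesis using 1 by simp
  qed (simp_all add: power_0_left)
  thus "(\<Sum>d | d dvd p ^ k. f d) \<ge> 0" "even k \<Longrightarrow> (\<Sum>d | d dvd p ^ k. f d) \<ge> 1" using eq by auto
qed

text \<open>Divisor sums are multiplicative, so the full power of one prime is split off at a time.
  A prime power contributes a nonnegative factor, and at least 1 if the exponent is even, as all
  exponents of a square are. These numbers will be the power series coefficients of the Lambert
  series.\<close>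

lemma sum_divisors_real_char_nonneg:
  fixes f :: "nat \<Rightarrow> real"
  assumes f: "\<And>x y. f (x * y) = f x * f y" "f 1 = 1" and range: "\<And>x. f x \<in> {-1, 0, 1}" and n: "n > 0"
  shows "(\<Sum>d | d dvd n. f d) \<ge> 0 \<and> (\<Sum>d | d dvd n\<^sup>2. f d) \<ge> 1"
  using n
proof (induction n rule: less_induct)
  case (less n)
  show ?case
  proof (cases "n = 1")
    case True
    thus ?thesis using f by simp
  next
    case False
    then obtain p where p: "prime p" "p dvd n" using prime_factor_nat by blast
    obtain r where r: "n = p ^ multiplicity p n * r" "\<not> p dvd r"
      using multiplicity_decompose'[of n p] p less.prems by (metis not_prime_unit neq0_conv)
    define k where "k = multiplicity p n"
    have k: "n = p ^ k * r" using r by (simp add: k_def)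
    have "k > 0" using p less.prems by (simp add: k_def prime_multiplicity_gt_zero_iff)
    have r0: "r > 0" using k less.prems by (auto intro: Nat.gr0I)
    have cop: "coprime (p ^ k) r" using p(1) r(2) by (simp add: prime_imp_coprime)
    have "1 < p ^ k" by (rule one_less_power[OF prime_gt_1_nat[OF p(1)] \<open>k > 0\<close>])
    hence "r < n" using r0 k by simp
    note IH = less.IH[OF this r0]
    have "n\<^sup>2 = p ^ (2 * k) * r\<^sup>2" by (simp add: k power_mult_distrib power_mult[symmetric] mult.commute)
    moreover have "coprime (p ^ (2 * k)) (r\<^sup>2)" using p(1) r(2) by (simp add: prime_imp_coprime)
    ultimately have "(\<Sum>d | d dvd n\<^sup>2. f d) = (\<Sum>d | d dvd p ^ (2 * k). f d) * (\<Sum>d | d dvd r\<^sup>2. f d)"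
      using sum_divisors_mult_coprime[of f "p ^ (2 * k)" "r\<^sup>2"] f(1) p(1) r0 by (simp add: prime_gt_0_nat)
    moreover have "(\<Sum>d | d dvd n. f d) = (\<Sum>d | d dvd p ^ k. f d) * (\<Sum>d | d dvd r. f d)"
      unfolding k using cop f(1) p(1) r0 by (intro sum_divisors_mult_coprime) (auto simp: prime_gt_0_nat)
    moreover have "(\<Sum>d | d dvd p ^ k. f d) \<ge> 0" "(\<Sum>d | d dvd p ^ (2 * k). f d) \<ge> 1"
      using sum_divisors_prime_power[OF f range p(1)] by auto
    ultimately show ?thesis using IH mult_mono[of 1 _ 1 "\<Sum>d | d dvd r\<^sup>2. f d"] by auto
  qed
qed

section \<open>Monsky's argument for L(1, X) with real X\<close>

lemma geometric_sum_ge: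
  fixes y :: real
  assumes "y \<ge> 0"
  shows "(\<Sum>i<n. (y\<^sup>2) ^ i) \<ge> real n * y ^ (n - 1)"
proof -
  \<comment> \<open>The exponents i and n - 1 - i are paired; each pair is at least 2 y^(n - 1) by
    the inequality of arithmetic and geometric means.\<close>
  have "2 * (\<Sum>i<n. (y\<^sup>2) ^ i) = (\<Sum>i<n. (y\<^sup>2) ^ i) + (\<Sum>i<n. (y\<^sup>2) ^ (n - Suc i))"
    by (simp add: sum.nat_diff_reindex)
  also have "\<dots> = (\<Sum>i<n. (y\<^sup>2) ^ i + (y\<^sup>2) ^ (n - Suc i))" by (simp add: sum.distrib)
  also have "\<dots> \<ge> (\<Sum>i<n. 2 * y ^ (n - 1))"
  proof (rule sum_mono)
    fix i assume i: "i \<in> {..<n}"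
    have "y ^ i * y ^ (n - Suc i) = y ^ (n - 1)" using i by (simp flip: power_add)
    moreover have "2 * y ^ i * y ^ (n - Suc i) \<le> (y ^ i)\<^sup>2 + (y ^ (n - Suc i))\<^sup>2" by (rule sum_squares_bound)
    moreover have "(y ^ j)\<^sup>2 = (y\<^sup>2) ^ j" for j by (simp add: power_mult[symmetric] mult.commute)
    ultimately show "2 * y ^ (n - 1) \<le> (y\<^sup>2) ^ i + (y\<^sup>2) ^ (n - Suc i)" by (simp add: mult.assoc)
  qed
  finally show ?thesis by simp
qed

text \<open>The first part of \<open>b\<close> sums against X to a multiple of L(1, X), so if that
  value is 0, \<open>b\<close> may replace the Lambert coefficients up to sign, and unlike them it
  is bounded at n = 1 uniformly in x. With S n = (1 - x^n) / (1 - x), the difference of consecutive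
  values times 1 - x is 1 / (n (n + 1)) - x^n / (S n S (n + 1)), so the claim is n (n + 1) x^n <= S
  n S (n + 1).\<close>

lemma lambert_coeff_decreasing:
  fixes x :: real
  defines "b \<equiv> \<lambda>n. 1 / (real n * (1 - x)) - x ^ n / (1 - x ^ n)"
  assumes x: "0 < x" "x < 1" and n: "n > 0"
  shows "b (Suc n) \<le> b n" "0 \<le> b n"
proof -
  \<comment> \<open>The bounds for S involve half-integral powers of x, which are natural powers of
    y.\<close>
  define y where "y = sqrt x"
  have y: "y\<^sup>2 = x" "y > 0" "y < 1" using x by (auto simp: y_def)
  define S where "S = (\<lambda>n. \<Sum>i<n. x ^ i)"
  have S: "1 - x ^ k = (1 - x) * S k" for k by (simp add: S_def one_diff_power_eq)
  have Spos: "S k > 0" if "k > 0" for k unfolding S_def using that x by (intro sum_pos) auto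
  have Sge: "S k \<ge> real k * y ^ (k - 1)" for k
    using geometric_sum_ge[of y k] y by (simp add: S_def)
  have xn: "x ^ n = y ^ (2 * n)" by (simp add: y(1)[symmetric] power_mult)
  have "real n * x ^ n \<le> real n * y ^ (n - 1)"
    unfolding xn using y by (intro mult_left_mono power_decreasing) auto
  hence "real n * x ^ n \<le> S n" using Sge[of n] by linarith
  hence "x ^ n / S n \<le> 1 / real n" using n Spos[OF n] by (simp add: field_simps)
  moreover have "b n = (1 / real n - x ^ n / S n) / (1 - x)"
    unfolding b_def S by (simp add: diff_divide_distrib mult.commute)
  ultimately show "0 \<le> b n" using x by simp
  have "real n * real (Suc n) * x ^ n \<le> (real n * y ^ (n - 1)) * (real (Suc n) * y ^ n)"
  proof -
    have "x ^ n \<le> y ^ (n - 1) * y ^ n"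
      unfolding xn power_add[symmetric] using y by (intro power_decreasing) auto
    hence "real n * real (Suc n) * x ^ n \<le> real n * real (Suc n) * (y ^ (n - 1) * y ^ n)"
      by (intro mult_left_mono) auto
    thus ?thesis by (simp add: mult_ac)
  qed
  also have "\<dots> \<le> S n * S (Suc n)"
    using Sge[of n] Sge[of "Suc n"] y Spos[OF n] by (intro mult_mono) auto
  finally have key: "real n * real (Suc n) * x ^ n \<le> S n * S (Suc n)" .
  define A where "A = S n" define B where "B = S (Suc n)" define q where "q = x ^ n"
  have AB: "A > 0" "B > 0" using Spos n by (auto simp: A_def B_def)
  have BA: "B = A + q" by (simp add: A_def B_def q_def S_def)
  have AX: "(1 - x) * A = 1 - q" using S[of n] by (simp add: A_def q_def)
  have "(1 - x) * (b n - b (Suc n)) = 1 / real n - 1 / real (Suc n) - (q / A - x * q / B)"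
  proof -
    have "(1 - x) * (u / ((1 - x) * v)) = u / v" "(1 - x) * (u / (v * (1 - x))) = u / v" for u v
      using x by simp_all
    thus ?thesis unfolding b_def S A_def[symmetric] B_def[symmetric] power_Suc q_def[symmetric]
      by (simp only: right_diff_distrib)
  qed
  also have "1 / real n - 1 / real (Suc n) = 1 / (real n * real (Suc n))" using n by (simp add: field_simps)
  also have "q / A - x * q / B = q * (B - x * A) / (A * B)" using AB by (simp add: field_simps)
  also have "B - x * A = 1" using AX BA by (simp add: algebra_simps)
  also have "1 / (real n * real (Suc n)) - q * 1 / (A * B) \<ge> 0"
  proof -
    have "q / (A * B) \<le> 1 / (real n * real (Suc n))"
      using key AB n by (simp add: divide_simps A_def[symmetric] B_def[symmetric] q_def[symmetric] mult_ac del: of_nat_Suc)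
    thus ?thesis by simp
  qed
  finally show "b (Suc n) \<le> b n" using x by (simp add: zero_le_mult_iff)
qed

text \<open>Partial summation as an induction: once the boundary term with \<open>b N\<close> is
  removed, each step adds at most M (b N - b (N + 1)), and these amounts telescope.\<close>

lemma abel_sum_bound:
  fixes X b :: "nat \<Rightarrow> real"
  assumes X: "\<And>N. \<bar>\<Sum>n=1..N. X n\<bar> \<le> M" and b: "\<And>n. n > 0 \<Longrightarrow> b (Suc n) \<le> b n" "\<And>n. n > 0 \<Longrightarrow> 0 \<le> b n"
  shows "\<bar>\<Sum>n=1..N. X n * b n\<bar> \<le> M * b 1"
proof (cases "N = 0")
  case True
  thus ?thesis using X[of 0] b(2)[of 1] by auto
next
  case False
  have 1: "\<bar>(\<Sum>n=1..N. X n * b n) - (\<Sum>n=1..N. X n) * b N\<bar> \<le> M * (b 1 - b N)" if "N > 0" for N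
    using that
  proof (induction N rule: nat_induct_non_zero)
    case (Suc N)
    have "(\<Sum>n=1..Suc N. X n * b n) - (\<Sum>n=1..Suc N. X n) * b (Suc N)
        = ((\<Sum>n=1..N. X n * b n) - (\<Sum>n=1..N. X n) * b N) + (\<Sum>n=1..N. X n) * (b N - b (Suc N))"
      by (simp add: algebra_simps)
    also have "\<bar>\<dots>\<bar> \<le> M * (b 1 - b N) + M * (b N - b (Suc N))"
      using b(1)[OF Suc.hyps] X[of N]
      by (intro order_trans[OF abs_triangle_ineq] add_mono Suc.IH) (auto simp: abs_mult intro!: mult_right_mono)
    finally show ?case by (simp add: algebra_simps)
  qed auto
  have 2: "\<bar>(\<Sum>n=1..N. X n) * b N\<bar> \<le> M * b N"
    using X[of N] b(2)[of N] False by (auto simp: abs_mult intro!: mult_right_mono)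
  have "\<bar>\<Sum>n=1..N. X n * b n\<bar> \<le> \<bar>(\<Sum>n=1..N. X n * b n) - (\<Sum>n=1..N. X n) * b N\<bar> + \<bar>(\<Sum>n=1..N. X n) * b N\<bar>"
    by linarith
  also have "\<dots> \<le> M * (b 1 - b N) + M * b N" using 1[of N] 2 False by (intro add_mono) auto
  finally show ?thesis by (simp add: algebra_simps)
qed

text \<open>Expanding x^d / (1 - x^d) geometrically and regrouping by n = d j gives the power series
  with coefficients the divisor sums of X. They are nonnegative, and at least 1 at squares.\<close>

lemma real_char_lambert_lower:
  fixes X :: "nat \<Rightarrow> real"
  assumes X: "\<And>x y. X (x * y) = X x * X y" "X 1 = 1" and range: "\<And>x. X x \<in> {-1, 0, 1}" and x: "0 < x" "x < 1"
  shows "summable (\<lambda>n. X (Suc n) * (x ^ Suc n / (1 - x ^ Suc n)))"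
    "(\<Sum>k=1..K. x ^ k\<^sup>2) \<le> (\<Sum>n. X (Suc n) * (x ^ Suc n / (1 - x ^ Suc n)))"
proof -
  define T where "T = (\<lambda>d j. X d * x ^ (d * j))"
  have Xb: "\<bar>X d\<bar> \<le> 1" for d using range[of d] by auto
  have geo: "((\<lambda>j. x ^ (d * j)) has_sum (x ^ d / (1 - x ^ d))) {0<..}" if d: "d > 0" for d
  proof -
    have xd: "0 < x ^ d" "x ^ d < 1" using x d by (auto simp: power_less_one_iff)
    have "(\<lambda>j. x ^ d * (x ^ d) ^ j) sums (x ^ d * (1 / (1 - x ^ d)))"
      using xd by (intro sums_mult geometric_sums) auto
    hence "((\<lambda>j. x ^ d * (x ^ d) ^ j) has_sum (x ^ d * (1 / (1 - x ^ d)))) UNIV"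
      using xd x by (intro norm_summable_imp_has_sum) (auto intro!: summable_mult summable_geometric simp: sums_iff)
    hence "((\<lambda>j. x ^ (d * Suc j)) has_sum (x ^ d / (1 - x ^ d))) UNIV"
      by (simp add: power_mult power_add)
    moreover have "Suc ` UNIV = {0<..}" by (auto simp: image_iff gr0_conv_Suc)
    ultimately show ?thesis using has_sum_reindex[of Suc UNIV "\<lambda>j. x ^ (d * j)"] by (simp add: o_def)
  qed
  \<comment> \<open>Absolute summability of the double series: the inner sums are |X d| x^d / (1 -
    x^d), and these are at most x^d / (1 - x).\<close>
  have abs: "(\<lambda>p. norm (case p of (d, j) \<Rightarrow> T d j)) summable_on ({0<..} \<times> {0<..})"
  proof (subst Infinite_Sum.abs_summable_on_Sigma_iff, intro conjI ballI)
    fix d :: nat assume "d \<in> {0<..}"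
    hence "((\<lambda>j. \<bar>X d\<bar> * x ^ (d * j)) has_sum (\<bar>X d\<bar> * (x ^ d / (1 - x ^ d)))) {0<..}"
      by (intro has_sum_cmult_right geo) auto
    thus "(\<lambda>y. norm (case (d, y) of (d, j) \<Rightarrow> T d j)) summable_on {0<..}"
      using x by (simp add: T_def abs_mult has_sum_imp_summable)
  next
    have eq: "(\<Sum>\<^sub>\<infinity>j\<in>{0<..}. norm (case (d, j) of (d, j) \<Rightarrow> T d j)) = \<bar>X d\<bar> * (x ^ d / (1 - x ^ d))" if "d \<in> {0<..}" for d
    proof (rule infsumI)
      have "((\<lambda>j. \<bar>X d\<bar> * x ^ (d * j)) has_sum (\<bar>X d\<bar> * (x ^ d / (1 - x ^ d)))) {0<..}"
        using that by (intro has_sum_cmult_right geo) auto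
      thus "((\<lambda>j. norm (case (d, j) of (d, j) \<Rightarrow> T d j)) has_sum (\<bar>X d\<bar> * (x ^ d / (1 - x ^ d)))) {0<..}"
        using x by (simp add: T_def abs_mult)
    qed
    have "(\<lambda>d. x ^ d / (1 - x)) summable_on UNIV"
      using x by (intro summable_nonneg_imp_summable_on summable_divide summable_geometric) auto
    hence S: "(\<lambda>d. x ^ d / (1 - x)) summable_on {0<..}" by (rule summable_on_subset) auto
    have summ: "(\<lambda>d. \<bar>X d\<bar> * (x ^ d / (1 - x ^ d))) summable_on {0<..}"
    proof (rule summable_on_comparison_test[OF S])
      fix d :: nat assume "d \<in> {0<..}"
      hence d: "x ^ d \<le> x ^ 1" using x by (intro power_decreasing) auto
      have "\<bar>X d\<bar> * (x ^ d / (1 - x ^ d)) \<le> 1 * (x ^ d / (1 - x))"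
        using x d Xb[of d] by (intro mult_mono divide_left_mono) auto
      thus "\<bar>X d\<bar> * (x ^ d / (1 - x ^ d)) \<le> x ^ d / (1 - x)" by simp
      show "0 \<le> \<bar>X d\<bar> * (x ^ d / (1 - x ^ d))" using x d by auto
    qed
    have "\<bar>X d\<bar> * (x ^ d / (1 - x ^ d)) \<ge> 0" for d
      using x by (auto intro!: mult_nonneg_nonneg divide_nonneg_nonneg simp: power_le_one)
    hence norm_eq: "norm (\<Sum>\<^sub>\<infinity>j\<in>{0<..}. norm (case (d, j) of (d, j) \<Rightarrow> T d j)) = \<bar>X d\<bar> * (x ^ d / (1 - x ^ d))"
      if "d \<in> {0<..}" for d
      by (subst eq[OF that]) (simp only: real_norm_def abs_of_nonneg)
    show "(\<lambda>d. norm (\<Sum>\<^sub>\<infinity>j\<in>{0<..}. norm (case (d, j) of (d, j) \<Rightarrow> T d j))) summable_on {0<..}"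
      by (subst summable_on_cong[OF norm_eq]) (use summ in auto)
  qed
  define S where "S = infsum (\<lambda>(d, j). T d j) ({0<..} \<times> {0<..})"
  have hs: "((\<lambda>(d, j). T d j) has_sum S) ({0<..} \<times> {0<..})"
    unfolding S_def using abs_summable_summable[OF abs] by (rule has_sum_infsum)
  have "((\<lambda>d. X d * (x ^ d / (1 - x ^ d))) has_sum S) {0<..}"
  proof (rule has_sum_SigmaD[OF hs])
    fix d :: nat assume "d \<in> {0<..}"
    hence "((\<lambda>j. X d * x ^ (d * j)) has_sum (X d * (x ^ d / (1 - x ^ d)))) {0<..}"
      by (intro has_sum_cmult_right geo) auto
    thus "((\<lambda>j. case (d, j) of (d, j) \<Rightarrow> T d j) has_sum (X d * (x ^ d / (1 - x ^ d)))) {0<..}"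
      by (simp only: T_def prod.case)
  qed
  moreover have Suc_img: "Suc ` UNIV = {0<..}" by (auto simp: image_iff gr0_conv_Suc)
  ultimately have "((\<lambda>n. X (Suc n) * (x ^ Suc n / (1 - x ^ Suc n))) has_sum S) UNIV"
    using has_sum_reindex[of Suc UNIV "\<lambda>d. X d * (x ^ d / (1 - x ^ d))" S] by (simp add: o_def)
  hence sums: "(\<lambda>n. X (Suc n) * (x ^ Suc n / (1 - x ^ Suc n))) sums S" by (rule has_sum_imp_sums)
  thus "summable (\<lambda>n. X (Suc n) * (x ^ Suc n / (1 - x ^ Suc n)))" by (rule sums_summable)
  have "((\<lambda>n. \<Sum>d | d dvd n. T d (n div d)) has_sum S) {0<..}"
    by (rule has_sum_divisor_rearrange[OF hs])
  moreover have "(\<Sum>d | d dvd n. T d (n div d)) = (\<Sum>d | d dvd n. X d) * x ^ n" for n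
    by (simp add: T_def sum_distrib_right)
  ultimately have hs2: "((\<lambda>n. (\<Sum>d | d dvd n. X d) * x ^ n) has_sum S) {0<..}" by simp
  \<comment> \<open>All terms being nonnegative, only those at the squares 1, ..., K^2 are
    kept.\<close>
  have "(\<Sum>n\<in>(\<lambda>k. k\<^sup>2) ` {1..K}. (\<Sum>d | d dvd n. X d) * x ^ n) \<le> S"
  proof (rule has_sum_mono_neutral)
    show "((\<lambda>n. (\<Sum>d | d dvd n. X d) * x ^ n) has_sum (\<Sum>n\<in>(\<lambda>k. k\<^sup>2) ` {1..K}. (\<Sum>d | d dvd n. X d) * x ^ n)) ((\<lambda>k. k\<^sup>2) ` {1..K})"
      by (intro has_sum_finite) auto
    fix n assume "n \<in> {0<..} - (\<lambda>k. k\<^sup>2) ` {1..K}"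
    thus "0 \<le> (\<Sum>d | d dvd n. X d) * x ^ n"
      using sum_divisors_real_char_nonneg[OF X range, of n] x by auto
  qed (use hs2 in auto)
  moreover have "(\<Sum>k=1..K. x ^ k\<^sup>2) \<le> (\<Sum>n\<in>(\<lambda>k. k\<^sup>2) ` {1..K}. (\<Sum>d | d dvd n. X d) * x ^ n)"
  proof (subst sum.reindex)
    show "inj_on (\<lambda>k::nat. k\<^sup>2) {1..K}" by (auto intro!: inj_onI)
    show "(\<Sum>k=1..K. x ^ k\<^sup>2) \<le> sum ((\<lambda>n. (\<Sum>d | d dvd n. X d) * x ^ n) \<circ> (\<lambda>k. k\<^sup>2)) {1..K}"
    proof (rule sum_mono)
      fix k assume "k \<in> {1..K}"
      hence "1 * x ^ k\<^sup>2 \<le> (\<Sum>d | d dvd k\<^sup>2. X d) * x ^ k\<^sup>2"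
        using sum_divisors_real_char_nonneg[OF X range, of k] x by (intro mult_right_mono) auto
      thus "x ^ k\<^sup>2 \<le> ((\<lambda>n. (\<Sum>d | d dvd n. X d) * x ^ n) \<circ> (\<lambda>k. k\<^sup>2)) k" by simp
    qed
  qed
  ultimately show "(\<Sum>k=1..K. x ^ k\<^sup>2) \<le> (\<Sum>n. X (Suc n) * (x ^ Suc n / (1 - x ^ Suc n)))"
    using sums by (simp add: sums_iff)
qed

text \<open>If L were 0, the Lambert series would be minus the sum of X n b n, hence at most M b 1 =
  M in modulus for every x in (0, 1). Its lower bound tends to K as x tends to 1, and K is
  arbitrary.\<close>

theorem real_char_sum_nonzero:
  fixes X :: "nat \<Rightarrow> real"
  assumes X: "\<And>x y. X (x * y) = X x * X y" "X 1 = 1" and range: "\<And>x. X x \<in> {-1, 0, 1}"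
    and bounded: "\<And>N. \<bar>\<Sum>n=1..N. X n\<bar> \<le> M" and m: "m > 0"
    and lim: "(\<lambda>N. \<Sum>n=1..N*m. X n / real n) \<longlonglongrightarrow> L"
  shows "L \<noteq> 0"
proof
  assume L: "L = 0"
  have upper: "\<bar>\<Sum>n. X (Suc n) * (x ^ Suc n / (1 - x ^ Suc n))\<bar> \<le> M" if x: "0 < x" "x < 1" for x
  proof -
    define f where "f = (\<lambda>n. X n * (x ^ n / (1 - x ^ n)))"
    define b where "b = (\<lambda>n. 1 / (real n * (1 - x)) - x ^ n / (1 - x ^ n))"
    \<comment> \<open>The limit L is taken along multiples of m only, so the Lambert series is
      restricted to the same subsequence.\<close>
    have "filterlim (\<lambda>N. N * m) at_top sequentially"
      using m by (intro filterlim_at_top_mono[OF filterlim_ident] always_eventually) auto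
    moreover have "(\<lambda>N. \<Sum>n<N. f (Suc n)) \<longlonglongrightarrow> (\<Sum>n. f (Suc n))"
      using real_char_lambert_lower(1)[OF X range x] by (intro summable_LIMSEQ) (auto simp: f_def)
    ultimately have "(\<lambda>N. \<Sum>n<N*m. f (Suc n)) \<longlonglongrightarrow> (\<Sum>n. f (Suc n))"
      by (rule filterlim_compose[rotated])
    moreover have "(\<Sum>n<N. f (Suc n)) = (\<Sum>n=1..N. f n)" for N
      by (rule sum.reindex_bij_witness[of _ "\<lambda>n. n - 1" Suc]) auto
    ultimately have 1: "(\<lambda>N. \<Sum>n=1..N*m. f n) \<longlonglongrightarrow> (\<Sum>n. f (Suc n))" by simp
    have "f n = X n / real n * (1 / (1 - x)) - X n * b n" for n
      by (simp add: f_def b_def right_diff_distrib)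
    hence "(\<Sum>n=1..N*m. X n * b n) = (\<Sum>n=1..N*m. X n / real n) * (1 / (1 - x)) - (\<Sum>n=1..N*m. f n)" for N
      by (simp add: sum_subtractf sum_distrib_right sum_divide_distrib)
    moreover have "(\<lambda>N. (\<Sum>n=1..N*m. X n / real n) * (1 / (1 - x)) - (\<Sum>n=1..N*m. f n)) \<longlonglongrightarrow> L * (1 / (1 - x)) - (\<Sum>n. f (Suc n))"
      by (intro tendsto_diff tendsto_mult tendsto_const lim 1)
    ultimately have "(\<lambda>N. \<Sum>n=1..N*m. X n * b n) \<longlonglongrightarrow> - (\<Sum>n. f (Suc n))" using L by simp
    hence "(\<lambda>N. \<bar>\<Sum>n=1..N*m. X n * b n\<bar>) \<longlonglongrightarrow> \<bar>- (\<Sum>n. f (Suc n))\<bar>" by (rule tendsto_rabs)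
    moreover have "\<bar>\<Sum>n=1..N*m. X n * b n\<bar> \<le> M" for N
    proof -
      have "\<bar>\<Sum>n=1..N*m. X n * b n\<bar> \<le> M * b 1"
        by (intro abel_sum_bound bounded) (unfold b_def, use lambert_coeff_decreasing[OF x] in auto)
      also have "b 1 = 1" using x by (simp add: b_def field_simps)
      finally show ?thesis by simp
    qed
    ultimately have "\<bar>- (\<Sum>n. f (Suc n))\<bar> \<le> M" by (intro LIMSEQ_le_const2) auto
    thus ?thesis by (simp add: f_def)
  qed
  obtain K :: nat where K: "real K > M" using reals_Archimedean2 by blast
  have "((\<lambda>x::real. \<Sum>k=1..K. x ^ k\<^sup>2) \<longlongrightarrow> (\<Sum>k=1..K. 1 ^ k\<^sup>2)) (at_left 1)"
    by (intro tendsto_intros)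
  moreover have "eventually (\<lambda>x::real. (\<Sum>k=1..K. x ^ k\<^sup>2) \<le> M) (at_left 1)"
  proof (rule eventually_mono[OF eventually_at_left_real[OF zero_less_one]])
    fix x :: real assume "x \<in> {0<..<1}"
    thus "(\<Sum>k=1..K. x ^ k\<^sup>2) \<le> M" using real_char_lambert_lower(2)[OF X range, of x K] upper[of x] by auto
  qed
  ultimately have "(\<Sum>k=1..K. 1 ^ k\<^sup>2) \<le> M" by (intro tendsto_upperbound[of _ _ "at_left (1::real)"]) auto
  thus False using K by simp
qed

section \<open>Continuation and non-vanishing of the $L$-functions\<close>

text \<open>G is (s - 1) zeta(s). The terms (s - 1) n^(-s) are compared with the telescoping
  differences n^(1 - s) - (n + 1)^(1 - s); the errors form a series that converges on Re s >
  0.\<close>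

lemma zeta_continuation:
  obtains G where "G holomorphic_on {s. Re s > 0}" "G 1 = 1"
    "\<And>s. Re s > 1 \<Longrightarrow> (\<lambda>n. of_nat n powr (-s)) sums (G s / (s - 1))"
proof -
  define f :: "nat \<Rightarrow> complex \<Rightarrow> complex" where
    "f = (\<lambda>n s. of_nat n powr (-(s - 1)) - of_nat (Suc n) powr (-(s - 1)) - (s - 1) * of_nat n powr (-s))"
  obtain E where E: "E holomorphic_on {s. Re s > 0}" "\<And>s. Re s > 0 \<Longrightarrow> (\<lambda>n. f n s) sums E s"
  proof (rule entire_series_holomorphic[of f "\<lambda>t. (t + 1) * t"])
    show "f n holomorphic_on UNIV" for n unfolding f_def by (intro holomorphic_intros)
    show "norm (f n s) \<le> (norm s + 1) * norm s * real n powr (- Re s - 1)" if n: "n > 0" and s: "Re s > 0" for n s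
    proof -
      have "norm (f n s) \<le> norm (s - 1) * norm (s - 1 + 1) * real n powr (- Re (s - 1) - 2)"
        using norm_powr_second_diff_le[OF n, of "s - 1"] s by (simp add: f_def)
      also have "- Re (s - 1) - 2 = - Re s - 1" by simp
      also have "norm (s - 1) * norm (s - 1 + 1) * real n powr (- Re s - 1) \<le> (norm s + 1) * norm s * real n powr (- Re s - 1)"
        using norm_triangle_ineq4[of s 1] by (intro mult_right_mono mult_mono) auto
      finally show ?thesis .
    qed
    show "mono_on {0..} (\<lambda>t::real. (t + 1) * t)" by (intro mono_onI mult_mono) auto
  qed auto
  show ?thesis
  proof (rule that[of "\<lambda>s. - E s"])
    show "(\<lambda>s. - E s) holomorphic_on {s. Re s > 0}" by (intro holomorphic_intros E)
    \<comment> \<open>The whole value at s = 1 comes from n = 0, through the convention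
      \<open>0 powr 0 = 0\<close> against \<open>1 powr 0 = 1\<close>.\<close>
    have "(\<lambda>n. f n 1) = (\<lambda>n. if n = 0 then -1 else 0)" by (auto simp: f_def fun_eq_iff simp del: of_nat_Suc)
    hence "(\<lambda>n. f n 1) sums (-1)" using sums_single[of 0 "\<lambda>_. -1::complex"] by simp
    moreover have "(\<lambda>n. f n 1) sums E 1" by (rule E) auto
    ultimately have "E 1 = -1" by (rule sums_unique2[symmetric])
    thus "- E 1 = 1" by simp
    fix s :: complex assume s: "Re s > 1"
    have "(\<lambda>n. of_nat n powr (-(s - 1)) :: complex) \<longlonglongrightarrow> 0"
      using s by (intro tendsto_neg_powr_complex_of_nat filterlim_ident) auto
    from telescope_sums'[OF this] have "(\<lambda>n. of_nat n powr (-(s - 1)) - of_nat (Suc n) powr (-(s - 1)) :: complex) sums 0" by simp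
    from sums_diff[OF this E(2)[of s]] s have "(\<lambda>n. (s - 1) * of_nat n powr (-s)) sums (- E s)" by (simp add: f_def)
    hence "(\<lambda>n. (s - 1) * of_nat n powr (-s) / (s - 1)) sums (- E s / (s - 1))" by (rule sums_divide)
    moreover have "s \<noteq> 1" using s by auto
    ultimately show "(\<lambda>n. of_nat n powr (-s)) sums (- E s / (s - 1))" by simp
  qed
qed

lemma sum_periodic_shift:
  fixes f :: "nat \<Rightarrow> 'a :: ab_group_add"
  assumes "\<And>x. f (x + m) = f x"
  shows "(\<Sum>i=a..<a+m. f i) = (\<Sum>x<m. f x)"
proof (induction a)
  case 0
  thus ?case by (simp add: atLeast0LessThan)
next
  case (Suc a)
  show ?case
  proof (cases "m = 0")
    case False
    have "(\<Sum>i=a..<a+m. f i) = f a + (\<Sum>i=Suc a..<a+m. f i)" using False by (intro sum.atLeast_Suc_lessThan) auto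
    moreover have "(\<Sum>i=Suc a..<Suc a+m. f i) = (\<Sum>i=Suc a..<a+m. f i) + f (a + m)" using False by simp
    ultimately show ?thesis using Suc assms[of a] by (simp add: algebra_simps)
  qed auto
qed

lemma periodic_mod_eq:
  assumes "\<And>x. f (x + m) = f (x :: nat)"
  shows "f (x mod m) = f x"
proof -
  have "f (y + k * m) = f y" for y k
  proof (induction k)
    case (Suc k)
    have "f (y + Suc k * m) = f (y + k * m + m)" by (simp add: algebra_simps)
    thus ?case using Suc assms by simp
  qed simp
  from this[of "x mod m" "x div m"] show ?thesis by simp
qed

text \<open>The series is summed in blocks of one period. As f sums to 0 over a block, a constant
  power y^(-s) may be subtracted inside it, which gains a factor 1 / k and convergence on Re s > 0.
  For the series itself this yields limits along multiples of m, and the sum wherever it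
  converges.\<close>

lemma periodic_dirichlet_continuation:
  fixes f :: "nat \<Rightarrow> complex"
  assumes m: "m > 0" and per: "\<And>x. f (x + m) = f x" and zero: "(\<Sum>x<m. f x) = 0"
  obtains E where "E holomorphic_on {s. Re s > 0}"
    "\<And>s S. Re s > 0 \<Longrightarrow> (\<lambda>n. f n * of_nat n powr (-s)) sums S \<Longrightarrow> E s = S"
    "\<And>s. Re s > 0 \<Longrightarrow> (\<lambda>N. \<Sum>n=1..N*m. f n * of_nat n powr (-s)) \<longlonglongrightarrow> E s"
proof -
  define B where "B = (\<lambda>k s. \<Sum>i=k*m..<k*m+m. f (Suc i) * of_nat (Suc i) powr (-s))"
  define C where "C = (\<Sum>x<m. norm (f x))"
  have C: "norm (f x) \<le> C" for x
  proof -
    have "norm (f (x mod m)) \<le> C" unfolding C_def using m by (intro member_le_sum) auto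
    thus ?thesis using periodic_mod_eq[of f m x] per by simp
  qed
  have C0: "C \<ge> 0" unfolding C_def by (intro sum_nonneg) auto
  obtain E where E: "E holomorphic_on {s. Re s > 0}" "\<And>s. Re s > 0 \<Longrightarrow> (\<lambda>n. B n s) sums E s"
  proof (rule entire_series_holomorphic[of B "\<lambda>t. t * (real m * C * real m)"])
    show "B n holomorphic_on UNIV" for n unfolding B_def by (intro holomorphic_intros)
    show "norm (B k s) \<le> norm s * (real m * C * real m) * real k powr (- Re s - 1)" if k: "k > 0" and s: "Re s > 0" for k s
    proof -
      \<comment> \<open>The last index of the block; all others are within distance m of it and at
        least k.\<close>
      define y where "y = real (k * m + m)"
      have "(\<Sum>i=k*m..<k*m+m. f (Suc i)) = (\<Sum>i=Suc (k*m)..<Suc (k*m)+m. f i)"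
        by (simp only: sum.shift_bounds_Suc_ivl add_Suc)
      also have "\<dots> = (\<Sum>x<m. f x)" by (rule sum_periodic_shift) (rule per)
      also note zero
      finally have z: "(\<Sum>i=k*m..<k*m+m. f (Suc i)) = 0" .
      have "B k s = (\<Sum>i=k*m..<k*m+m. f (Suc i) * of_nat (Suc i) powr (-s)) - (\<Sum>i=k*m..<k*m+m. f (Suc i)) * of_real y powr (-s)"
        by (simp add: B_def z)
      also have "\<dots> = (\<Sum>i=k*m..<k*m+m. f (Suc i) * (of_real (real (Suc i)) powr (-s) - of_real y powr (-s)))"
        by (simp add: sum_distrib_right sum_subtractf right_diff_distrib)
      also have "norm \<dots> \<le> of_nat (card {k*m..<k*m+m}) * (C * (norm s * real k powr (- Re s - 1) * real m))"
      proof (rule sum_norm_bound)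
        fix i assume i: "i \<in> {k*m..<k*m+m}"
        have ki: "real k \<le> real (Suc i)"
        proof -
          have "k \<le> k * m" using m by simp
          also have "k * m \<le> i" using i by simp
          finally have "k \<le> Suc i" by simp
          thus ?thesis by (simp only: of_nat_le_iff)
        qed
        have yi: "real (Suc i) \<le> y" unfolding y_def of_nat_le_iff using i by simp
        have "k * m + m \<le> Suc i + m" using i by simp
        hence "real (k * m + m) \<le> real (Suc i + m)" by (simp only: of_nat_le_iff)
        hence ym: "y - real (Suc i) \<le> real m" by (simp add: y_def)
        have "norm (of_real (real (Suc i)) powr (-s) - of_real y powr (-s) :: complex) \<le> norm s * real (Suc i) powr (- Re s - 1) * (y - real (Suc i))"
          using yi s by (intro norm_powr_diff_le) auto
        also have "\<dots> \<le> norm s * real k powr (- Re s - 1) * real m"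
          using yi ym s k ki by (intro mult_mono powr_mono2') auto
        finally show "norm (f (Suc i) * (of_real (real (Suc i)) powr (-s) - of_real y powr (-s)))
             \<le> C * (norm s * real k powr (- Re s - 1) * real m)"
          using C[of "Suc i"] C0 by (subst norm_mult) (intro mult_mono, auto)
      qed
      finally show ?thesis by (simp add: mult_ac)
    qed
    show "mono_on {0..} (\<lambda>t::real. t * (real m * C * real m))" using C0 by (intro mono_onI mult_right_mono) auto
  qed (use C0 in auto)
  show ?thesis
  proof (rule that[OF E(1)])
    fix s S assume s: "Re s > 0" "(\<lambda>n. f n * of_nat n powr (-s)) sums S"
    have "(\<lambda>n. f (Suc n) * of_nat (Suc n) powr (-s)) sums S"
      using s(2) by (subst sums_Suc_iff) simp
    from sums_group[OF this m] have "(\<lambda>n. B n s) sums S" by (simp add: B_def)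
    thus "E s = S" using E(2)[OF s(1)] by (rule sums_unique2[symmetric])
  next
    fix s assume s: "Re s > 0"
    have "(\<Sum>k<N. B k s) = (\<Sum>n=1..N*m. f n * of_nat n powr (-s))" for N
    proof -
      have "(\<Sum>k<N. B k s) = (\<Sum>i<N*m. f (Suc i) * of_nat (Suc i) powr (-s))"
        unfolding B_def by (rule sum.nat_group)
      also have "\<dots> = (\<Sum>n=1..N*m. f n * of_nat n powr (-s))"
        by (rule sum.reindex_bij_witness[of _ "\<lambda>n. n - 1" Suc]) auto
      finally show ?thesis .
    qed
    thus "(\<lambda>N. \<Sum>n=1..N*m. f n * of_nat n powr (-s)) \<longlonglongrightarrow> E s" using E(2)[OF s] by (simp add: sums_def)
  qed
qed

section \<open>Convolution and the logarithmic derivative of L\<close>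

lemma abs_summable_dirichlet:
  fixes a :: "nat \<Rightarrow> complex"
  assumes "\<And>n. n > 0 \<Longrightarrow> norm (a n) \<le> c n" "summable (\<lambda>n. c n * real n powr (- Re s))"
  shows "summable (\<lambda>n. norm (a n * of_nat n powr (-s)))"
proof (rule summable_comparison_test'[OF assms(2), of 1])
  fix n :: nat assume n: "n \<ge> 1"
  have "norm (a n * of_nat n powr (-s)) = norm (a n) * real n powr (- Re s)"
    using n norm_powr_real_powr[of "of_nat n" "-s"] by (simp add: norm_mult)
  also have "\<dots> \<le> c n * real n powr (- Re s)" using n assms(1)[of n] by (intro mult_right_mono) auto
  finally show "norm (norm (a n * of_nat n powr (-s))) \<le> c n * real n powr (- Re s)" by simp
qed

lemma has_sum_Times_mult:
  fixes F G :: "nat \<Rightarrow> complex"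
  assumes F: "summable (\<lambda>n. norm (F n))" "F sums a" "F 0 = 0" and G: "summable (\<lambda>n. norm (G n))" "G sums b" "G 0 = 0"
  shows "((\<lambda>(d, j). F d * G j) has_sum (a * b)) ({0<..} \<times> {0<..})"
proof -
  have hs: "(H has_sum c) {0<..}" if "summable (\<lambda>n. norm (H n))" "H sums c" "H 0 = 0" for H :: "nat \<Rightarrow> complex" and c
    using norm_summable_imp_has_sum[OF that(1,2)] that(3)
    by (subst has_sum_cong_neutral[of UNIV "{0<..}" H H]) auto
  have nm: "(\<lambda>n. norm (H n)) summable_on {0<..}" if "summable (\<lambda>n. norm (H n))" for H :: "nat \<Rightarrow> complex"
    using that by (intro summable_on_subset[OF summable_nonneg_imp_summable_on]) auto
  have F': "(F has_sum a) {0<..}" and G': "(G has_sum b) {0<..}" using F G hs by auto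
  have "(\<lambda>p. norm (case p of (d, j) \<Rightarrow> F d * G j)) summable_on ({0<..} \<times> {0<..})"
  proof (subst Infinite_Sum.abs_summable_on_Sigma_iff, intro conjI ballI)
    show "(\<lambda>y. norm (case (d, y) of (d, j) \<Rightarrow> F d * G j)) summable_on {0<..}" for d
      using nm[OF G(1)] by (auto simp: norm_mult intro!: summable_on_cmult_right)
    have "(\<Sum>\<^sub>\<infinity>y\<in>{0<..}. norm (case (d, y) of (d, j) \<Rightarrow> F d * G j)) = norm (F d) * (\<Sum>\<^sub>\<infinity>y\<in>{0<..}. norm (G y))" for d
      using nm[OF G(1)] by (simp add: norm_mult infsum_cmult_right)
    moreover have "(\<Sum>\<^sub>\<infinity>y\<in>{0<..}. norm (G y)) \<ge> 0" by (intro infsum_nonneg) auto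
    ultimately show "(\<lambda>d. norm (\<Sum>\<^sub>\<infinity>y\<in>{0<..}. norm (case (d, y) of (d, j) \<Rightarrow> F d * G j))) summable_on {0<..}"
      using nm[OF F(1)] by (auto simp: abs_mult intro!: summable_on_cmult_left)
  qed
  hence "(\<lambda>(d, j). F d * G j) summable_on ({0<..} \<times> {0<..})" by (rule abs_summable_summable)
  moreover have "((\<lambda>d. F d * b) has_sum (a * b)) {0<..}" using F' by (rule has_sum_cmult_left)
  ultimately show ?thesis
    by (intro has_sum_SigmaI[where g = "\<lambda>d. F d * b"]) (auto intro!: has_sum_cmult_right G')
qed

text \<open>The identity - L'/L = sum of \<Lambda>(n) X(n) n^(-s) in product form: complete
  multiplicativity pulls X n and n^(-s) out of the divisor sum, and the von Mangoldt values add up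
  to ln n.\<close>

lemma dirichlet_char_convolution:
  assumes m: "m > 0" and X: "X \<in> dchars m" and s: "Re s > 1"
    and L: "(\<lambda>n. X n * of_nat n powr (-s)) sums L"
    and H: "(\<lambda>n. mangoldt n * X n * of_nat n powr (-s)) sums H"
    and D: "(\<lambda>n. of_real (ln (real n)) * X n * of_nat n powr (-s)) sums D"
  shows "H * L = D"
proof -
  let ?D = "\<lambda>n. of_real (ln (real n)) * X n * of_nat n powr (-s)"
  let ?S = "\<lambda>n. \<Sum>d | d dvd n. (mangoldt d * X d * of_nat d powr (-s)) * (X (n div d) * of_nat (n div d) powr (-s))"
  have sL: "summable (\<lambda>n. norm (X n * of_nat n powr (-s)))"
    using s norm_dchars_le[OF m X] by (intro abs_summable_dirichlet[where c = "\<lambda>_. 1"]) (auto simp: summable_real_powr_iff)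
  have bH: "norm (mangoldt n * X n) \<le> ln (real n)" if "n > 0" for n
    using mult_mono[OF mangoldt_le[OF that] norm_dchars_le[OF m X, of n]] that by (simp add: norm_mult)
  have sH: "summable (\<lambda>n. norm (mangoldt n * X n * of_nat n powr (-s)))"
    using s bH by (intro abs_summable_dirichlet[where c = "\<lambda>n. ln (real n)"] summable_ln_powr) auto
  have "(?S has_sum (H * L)) {0<..}"
    by (intro has_sum_divisor_rearrange has_sum_Times_mult sH sL H L) auto
  also have "?this \<longleftrightarrow> (?D has_sum (H * L)) {0<..}"
  proof (rule has_sum_cong)
    fix n :: nat assume n: "n \<in> {0<..}"
    have "?S n = (\<Sum>d | d dvd n. mangoldt d * (X n * of_nat n powr (-s)))"
    proof (intro sum.cong refl)
      fix d assume "d \<in> {d. d dvd n}"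
      hence d: "n = d * (n div d)" by simp
      have "X n = X d * X (n div d)" by (subst d) (rule dchars_mult[OF X])
      moreover have "(of_nat n :: complex) powr (-s) = of_nat d powr (-s) * of_nat (n div d) powr (-s)"
      proof -
        have "(of_nat n :: complex) = of_nat d * of_nat (n div d)" by (subst d) (rule of_nat_mult)
        thus ?thesis by (simp add: powr_times_real)
      qed
      ultimately show "(mangoldt d * X d * of_nat d powr (-s)) * (X (n div d) * of_nat (n div d) powr (-s)) = mangoldt d * (X n * of_nat n powr (-s))"
        by (simp add: mult_ac)
    qed
    also have "\<dots> = ?D n"
      using n mangoldt_sum[of n, where ?'a = complex] by (simp add: sum_distrib_right[symmetric] mult_ac)
    finally show "?S n = ?D n" .
  qed
  finally have "(?D has_sum (H * L)) UNIV"
    by (subst (asm) has_sum_cong_neutral[where T = UNIV and g = ?D]) auto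
  hence "?D sums (H * L)" by (rule has_sum_imp_sums)
  thus ?thesis using D by (rule sums_unique2)
qed

text \<open>\<open>P\<close> is the continuation of \<open>L(s, X)\<close>, multiplied by \<open>s - 1\<close> if \<open>X\<close> is principal,
  and \<open>H\<close> is \<open>- L'/L\<close>.\<close>

definition L_data :: "nat \<Rightarrow> (nat \<Rightarrow> complex) \<Rightarrow> (complex \<Rightarrow> complex) \<Rightarrow> (complex \<Rightarrow> complex) \<Rightarrow> bool" where
  "L_data m X P H \<longleftrightarrow> P holomorphic_on {s. Re s > 0} \<and> H holomorphic_on {s. Re s > 1} \<and>
     (\<forall>s. Re s > 1 \<longrightarrow> (\<lambda>n. mangoldt n * X n * of_nat n powr (-s)) sums H s) \<and>
     (\<forall>s. Re s > 1 \<longrightarrow> H s * P s = (if X = dchar0 m then P s / (s - 1) else 0) - deriv P s) \<and>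
     P 3 \<noteq> 0 \<and> (X = dchar0 m \<longrightarrow> P 1 \<noteq> 0) \<and>
     (X \<noteq> dchar0 m \<longrightarrow> (\<lambda>N. \<Sum>n=1..N*m. X n / of_nat n) \<longlonglongrightarrow> P 1)"

lemma L_data_sums:
  "L_data m X P H \<Longrightarrow> Re s > 1 \<Longrightarrow> (\<lambda>n. mangoldt n * X n * of_nat n powr (-s)) sums H s"
  unfolding L_data_def by blast

text \<open>Subtracting the mean value \<open>c\<close> from X leaves a periodic function with
  period sum 0, whose series continues; \<open>c\<close> times zeta is added back. Only for
  principal X is \<open>c\<close> nonzero, and there the factor s - 1 clears the pole and leaves the
  value \<open>c\<close> at 1.\<close>

lemma L_continuation:
  assumes m: "m > 0" and X: "X \<in> dchars m"
  obtains P where "P holomorphic_on {s. Re s > 0}"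
    "\<And>s. Re s > 1 \<Longrightarrow> (\<lambda>n. X n * of_nat n powr (-s)) sums (P s / (if X = dchar0 m then s - 1 else 1))"
    "X = dchar0 m \<Longrightarrow> P 1 \<noteq> 0"
    "X \<noteq> dchar0 m \<Longrightarrow> (\<lambda>N. \<Sum>n=1..N*m. X n / of_nat n) \<longlonglongrightarrow> P 1"
proof -
  let ?D = "\<lambda>s::complex. if X = dchar0 m then s - 1 else 1"
  define c :: complex where "c = (if X = dchar0 m then of_nat (totient m) / of_nat m else 0)"
  define f where "f = (\<lambda>n. X n - c)"
  have per: "f (x + m) = f x" for x using dchars_add_mult[OF X, of x 1] by (simp add: f_def)
  have zero: "(\<Sum>x<m. f x) = 0"
    using m sum_dchars_residues[OF m X] by (simp add: f_def sum_subtractf c_def)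
  obtain E where E: "E holomorphic_on {s. Re s > 0}"
    "\<And>s S. Re s > 0 \<Longrightarrow> (\<lambda>n. f n * of_nat n powr (-s)) sums S \<Longrightarrow> E s = S"
    "\<And>s. Re s > 0 \<Longrightarrow> (\<lambda>N. \<Sum>n=1..N*m. f n * of_nat n powr (-s)) \<longlonglongrightarrow> E s"
    using periodic_dirichlet_continuation[OF m per zero] by blast
  obtain G where G: "G holomorphic_on {s. Re s > 0}" "G 1 = 1"
    "\<And>s. Re s > 1 \<Longrightarrow> (\<lambda>n. of_nat n powr (-s)) sums (G s / (s - 1))"
    using zeta_continuation by blast
  show ?thesis
  proof (rule that[of "\<lambda>s. ?D s * E s + c * G s"])
    show "(\<lambda>s. ?D s * E s + c * G s) holomorphic_on {s. Re s > 0}"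
      by (cases "X = dchar0 m") (auto intro!: holomorphic_intros E G)
    fix s :: complex assume s: "Re s > 1"
    have "summable (\<lambda>n. norm (X n * of_nat n powr (-s)))"
      using s norm_dchars_le[OF m X] by (intro abs_summable_dirichlet[where c = "\<lambda>_. 1"]) (auto simp: summable_real_powr_iff)
    hence "summable (\<lambda>n. X n * of_nat n powr (-s))" by (rule summable_norm_cancel)
    then obtain S where S: "(\<lambda>n. X n * of_nat n powr (-s)) sums S" by (auto simp: summable_def)
    have "(\<lambda>n. X n * of_nat n powr (-s) - c * of_nat n powr (-s)) sums (S - c * (G s / (s - 1)))"
      by (intro sums_diff sums_mult S G s)
    hence Es: "E s = S - c * (G s / (s - 1))" using s by (intro E(2)) (auto simp: f_def algebra_simps)
    have "s \<noteq> 1" using s by auto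
    hence "S = (?D s * E s + c * G s) / ?D s"
    proof (cases "X = dchar0 m")
      case True
      have "s - 1 \<noteq> 0" using \<open>s \<noteq> 1\<close> by simp
      hence "(s - 1) * (S - c * (G s / (s - 1))) + c * G s = (s - 1) * S" by (simp add: right_diff_distrib)
      thus ?thesis using True \<open>s - 1 \<noteq> 0\<close> by (simp add: Es)
    qed (simp add: Es c_def)
    with S show "(\<lambda>n. X n * of_nat n powr (-s)) sums ((?D s * E s + c * G s) / ?D s)"
      by simp
  next
    show "X = dchar0 m \<Longrightarrow> ?D 1 * E 1 + c * G 1 \<noteq> 0"
      using m G(2) by (simp add: c_def)
  next
    assume "X \<noteq> dchar0 m"
    thus "(\<lambda>N. \<Sum>n=1..N*m. X n / of_nat n) \<longlonglongrightarrow> ?D 1 * E 1 + c * G 1"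
      using E(3)[of 1] by (simp add: c_def f_def powr_minus divide_inverse)
  qed
qed

lemma has_field_derivative_of_nat_powr_minus:
  "((\<lambda>s. (of_nat n :: complex) powr (-s)) has_field_derivative - (of_real (ln (real n)) * of_nat n powr (-s))) (at s)"
  by (cases "n = 0") (auto simp: powr_def Ln_of_nat intro!: derivative_eq_intros)

lemma L_data_exists:
  assumes m: "m > 0" and X: "X \<in> dchars m"
  obtains P H where "L_data m X P H"
proof -
  let ?F = "\<lambda>n s. mangoldt n * X n * of_nat n powr (-s)"
  define D where "D = (\<lambda>s::complex. if X = dchar0 m then s - 1 else 1)"
  define \<delta> :: complex where "\<delta> = (if X = dchar0 m then 1 else 0)"
  obtain P where P: "P holomorphic_on {s. Re s > 0}"
    "\<And>s. Re s > 1 \<Longrightarrow> (\<lambda>n. X n * of_nat n powr (-s)) sums (P s / D s)"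
    "X = dchar0 m \<Longrightarrow> P 1 \<noteq> 0"
    "X \<noteq> dchar0 m \<Longrightarrow> (\<lambda>N. \<Sum>n=1..N*m. X n / of_nat n) \<longlonglongrightarrow> P 1"
    unfolding D_def using L_continuation[OF m X] by blast
  have nb: "norm (a * (of_nat n :: complex) powr (-s)) = norm a * real n powr (- Re s)" if "n > 0" for a n s
    using that norm_powr_real_powr[of "of_nat n" "-s"] by (simp add: norm_mult)
  obtain L where L: "L holomorphic_on {s. Re s > 1}" "\<And>s. Re s > 1 \<Longrightarrow> (\<lambda>n. X n * of_nat n powr (-s)) sums L s"
    "\<And>s. Re s > 1 \<Longrightarrow> (\<lambda>n. - (of_real (ln (real n)) * X n * of_nat n powr (-s))) sums deriv L s"
  proof (rule dirichlet_type_series_holomorphic[of 1 "\<lambda>n s. X n * of_nat n powr (-s)"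
      "\<lambda>n s. - (of_real (ln (real n)) * X n * of_nat n powr (-s))" "\<lambda>_. 1" "\<lambda>_. 1"])
    show "((\<lambda>s. X n * of_nat n powr (-s)) has_field_derivative - (of_real (ln (real n)) * X n * of_nat n powr (-s))) (at s)" for n s
      using DERIV_cmult[OF has_field_derivative_of_nat_powr_minus, of "X n"] by (simp add: mult_ac)
    show "norm (X n * of_nat n powr (-s)) \<le> 1 * 1 * real n powr (- Re s)" if "n > 0" for n s
      unfolding nb[OF that] using norm_dchars_le[OF m X] by (simp add: mult_left_le_one_le)
  qed (auto simp: summable_real_powr_iff mono_on_def)
  obtain H where H: "H holomorphic_on {s. Re s > 1}" "\<And>s. Re s > 1 \<Longrightarrow> (\<lambda>n. ?F n s) sums H s"
  proof (rule dirichlet_type_series_holomorphic[of 1 ?F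
      "\<lambda>n s. - (of_real (ln (real n)) * ?F n s)" "\<lambda>_. 1" "\<lambda>n. ln (real n)"])
    show "(?F n has_field_derivative - (of_real (ln (real n)) * ?F n s)) (at s)" for n s
      using DERIV_cmult[OF has_field_derivative_of_nat_powr_minus, of "mangoldt n * X n"] by (simp add: mult_ac)
    show "norm (?F n s) \<le> 1 * ln (real n) * real n powr (- Re s)" if "n > 0" for n s
    proof -
      have "norm (mangoldt n * X n) \<le> ln (real n) * 1"
        unfolding norm_mult norm_mangoldt using that norm_dchars_le[OF m X] by (intro mult_mono mangoldt_le) auto
      thus ?thesis unfolding nb[OF that] by (simp add: mult_right_mono)
    qed
    show "ln (real n) \<ge> 0" for n by (cases "n = 0") auto
  qed (auto simp: summable_ln_powr mono_on_def)
  have LP: "L s = P s / D s" if "Re s > 1" for s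
    using L(2)[OF that] P(2)[OF that] by (rule sums_unique2)
  show ?thesis
  proof (rule that[of P H], unfold L_data_def, intro conjI allI impI)
    fix s assume s: "Re s > 1"
    have HL: "H s * L s = - deriv L s"
    proof (rule dirichlet_char_convolution[OF m X s L(2)[OF s] H(2)[OF s]])
      show "(\<lambda>n. of_real (ln (real n)) * X n * of_nat n powr (-s)) sums - deriv L s"
        using sums_minus[OF L(3)[OF s]] by simp
    qed
    have Dnz: "D s \<noteq> 0" using s by (auto simp: D_def)
    \<comment> \<open>Since \<open>P\<close> is \<open>L * D\<close> for Re w > 1, its derivative is
      L' D + \<delta> L; multiplying H L = - L' by \<open>D\<close> then gives the required relation
      between H and P.\<close>
    have PL: "P w = L w * D w" if "Re w > 1" for w using LP[OF that] that by (auto simp: D_def)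
    have "deriv P s = deriv (\<lambda>w. L w * D w) s"
      using s PL by (intro deriv_cong_ev refl eventually_mono[OF eventually_nhds_in_open[of "{s. Re s > 1}"]])
        (auto simp: open_halfspace_Re_gt)
    also have "((\<lambda>w. L w * D w) has_field_derivative (deriv L s * D s + \<delta> * L s)) (at s)"
    proof -
      have "(D has_field_derivative \<delta>) (at s)" unfolding D_def \<delta>_def by (auto intro!: derivative_eq_intros)
      moreover have "(L has_field_derivative deriv L s) (at s)"
        using s by (intro holomorphic_derivI[OF L(1)]) (auto simp: open_halfspace_Re_gt)
      ultimately show ?thesis by (auto intro!: derivative_eq_intros simp: mult_ac)
    qed
    hence "deriv (\<lambda>w. L w * D w) s = deriv L s * D s + \<delta> * L s" by (rule DERIV_imp_deriv)
    finally have "deriv P s = - (H s * P s) + \<delta> * L s" using HL by (simp add: PL[OF s] mult.assoc[symmetric])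
    thus "H s * P s = (if X = dchar0 m then P s / (s - 1) else 0) - deriv P s"
      by (simp add: LP[OF s] \<delta>_def D_def)
  next
    \<comment> \<open>The tail estimate with N = 1 and z = 2 bounds |L(3) - 1| by 1 / 2. One nonzero
      value is needed to exclude a zero of infinite order.\<close>
    have "norm (L (1 + 2) - (\<Sum>n=1..1. X n * of_nat n powr (-(1 + 2)))) \<le> 1 * (real 1 powr (- Re 2) / Re 2)"
      by (rule norm_dirichlet_tail_le) (use norm_dchars_le[OF m X] L(2)[of 3] in auto)
    hence "norm (L 3 - 1) \<le> 1 / 2" using dchars_1[OF X] by simp
    hence "L 3 \<noteq> 0" by auto
    thus "P 3 \<noteq> 0" using LP[of 3] by auto
  qed (use P H in auto)
qed

section \<open>Orders of zeros and the 3-4-1 inequality\<close>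

lemma holomorphic_log_deriv_order:
  assumes P: "P holomorphic_on S" and S: "open S" "connected S" and z: "z \<in> S" and nz: "w0 \<in> S" "P w0 \<noteq> 0"
  obtains k :: nat where "((\<lambda>w. (w - z) * (deriv P w / P w)) \<longlongrightarrow> of_nat k) (at z)" "k = 0 \<longleftrightarrow> P z \<noteq> 0"
    "eventually (\<lambda>w. P w \<noteq> 0) (at z)"
proof (cases "P z = 0")
  case False
  have P': "deriv P holomorphic_on S" using P S(1) by (rule holomorphic_deriv)
  have cont: "isCont P z" "isCont (deriv P) z"
    using P P' S z by (auto intro!: continuous_on_interior[OF holomorphic_on_imp_continuous_on] simp: interior_open)
  have "((\<lambda>w. (w - z) * (deriv P w / P w)) \<longlongrightarrow> (z - z) * (deriv P z / P z)) (at z)"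
    using cont False by (intro tendsto_intros) (auto simp: isCont_def)
  moreover have "eventually (\<lambda>w. P w \<noteq> 0) (at z)"
    using cont(1) False by (intro tendsto_imp_eventually_ne) (auto simp: isCont_def)
  ultimately show ?thesis using False by (intro that[of 0]) auto
next
  case True
  \<comment> \<open>The point \<open>w0\<close> with P w0 nonzero guarantees a zero of finite order,
    so P = (w - z)^n g with g nonvanishing near z.\<close>
  have "\<not> P constant_on S"
  proof
    assume "P constant_on S"
    then obtain c where "\<And>x. x \<in> S \<Longrightarrow> P x = c" unfolding constant_on_def by blast
    thus False using True z nz by metis
  qed
  from holomorphic_factor_zero_nonconstant[OF P S z True this]
  obtain g r n where g: "0 < n" "0 < r" "ball z r \<subseteq> S" "g holomorphic_on ball z r"
    "\<And>w. w \<in> ball z r \<Longrightarrow> P w = (w - z) ^ n * g w" "\<And>w. w \<in> ball z r \<Longrightarrow> g w \<noteq> 0"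
    by metis
  have g': "deriv g holomorphic_on ball z r" using g(4) by (intro holomorphic_deriv) auto
  have cont: "isCont g z" "isCont (deriv g) z"
    using g(2,4) g' by (auto intro!: continuous_on_interior[OF holomorphic_on_imp_continuous_on] simp: interior_open)
  have ev: "eventually (\<lambda>w. w \<in> ball z r \<and> w \<noteq> z) (at z)"
    using eventually_at_in_open[of "ball z r" z] g(2) by (auto elim: eventually_mono)
  \<comment> \<open>The logarithmic derivative of the factorization: its polar part n / (w - z)
    shows that the limit is the order of the zero.\<close>
  have eq: "(w - z) * (deriv P w / P w) = of_nat n + (w - z) * (deriv g w / g w)" if w: "w \<in> ball z r \<and> w \<noteq> z" for w
  proof -
    have "deriv P w = deriv (\<lambda>w. (w - z) ^ n * g w) w"
      using w g(5) by (intro deriv_cong_ev refl eventually_mono[OF eventually_nhds_in_open[of "ball z r"]]) auto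
    also have "((\<lambda>w. (w - z) ^ n * g w) has_field_derivative (of_nat n * (w - z) ^ (n - 1) * g w + (w - z) ^ n * deriv g w)) (at w)"
    proof -
      have "(g has_field_derivative deriv g w) (at w)" using w g(4) by (intro holomorphic_derivI[of g "ball z r"]) auto
      thus ?thesis by (auto intro!: derivative_eq_intros)
    qed
    hence "deriv (\<lambda>w. (w - z) ^ n * g w) w = of_nat n * (w - z) ^ (n - 1) * g w + (w - z) ^ n * deriv g w"
      by (rule DERIV_imp_deriv)
    finally have "(w - z) * deriv P w = of_nat n * ((w - z) * (w - z) ^ (n - 1)) * g w + (w - z) * (w - z) ^ n * deriv g w"
      by (simp add: algebra_simps)
    also have "(w - z) * (w - z) ^ (n - 1) = (w - z) ^ n" using g(1) by (simp add: power_eq_if)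
    finally have eq: "(w - z) * deriv P w = of_nat n * (w - z) ^ n * g w + (w - z) * (w - z) ^ n * deriv g w" .
    have "(w - z) * deriv P w = (of_nat n + (w - z) * (deriv g w / g w)) * P w"
    proof -
      have "(w - z) * (deriv g w / g w) * P w = (w - z) * (w - z) ^ n * deriv g w"
        using w g(5,6)[of w] by simp
      thus ?thesis using eq w g(5)[of w] by (simp add: distrib_right)
    qed
    moreover have "P w \<noteq> 0" using w g(5,6)[of w] by simp
    ultimately show ?thesis by simp
  qed
  have "((\<lambda>w. of_nat n + (w - z) * (deriv g w / g w)) \<longlongrightarrow> of_nat n + (z - z) * (deriv g z / g z)) (at z)"
    using cont g(2,6) by (intro tendsto_intros) (auto simp: isCont_def)
  hence "((\<lambda>w. (w - z) * (deriv P w / P w)) \<longlongrightarrow> of_nat n) (at z)"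
    by (subst tendsto_cong[OF eventually_mono[OF ev eq]]) auto
  moreover have "eventually (\<lambda>w. P w \<noteq> 0) (at z)"
    using ev by eventually_elim (use g(5,6) in auto)
  ultimately show ?thesis using True g(1) by (intro that[of n]) auto
qed

text \<open>As H is - L'/L, e H (z + e) tends to minus the order of L at z. The zeros of
  \<open>P\<close> count negatively, and the pole of L at 1 for principal X counts 1.\<close>

lemma L_data_order:
  assumes D: "L_data m X P H" and z: "Re z \<ge> 1"
  obtains k :: nat where
    "((\<lambda>e. of_real e * H (z + of_real e)) \<longlongrightarrow> (if X = dchar0 m \<and> z = 1 then 1 else 0) - of_nat k) (at_right 0)"
    "k = 0 \<longleftrightarrow> P z \<noteq> 0"
proof -
  have P: "P holomorphic_on {s. Re s > 0}" "P 3 \<noteq> 0"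
    and HP: "\<And>s. Re s > 1 \<Longrightarrow> H s * P s = (if X = dchar0 m then P s / (s - 1) else 0) - deriv P s"
    using D by (auto simp: L_data_def)
  obtain k where k: "((\<lambda>w. (w - z) * (deriv P w / P w)) \<longlongrightarrow> of_nat k) (at z)" "k = 0 \<longleftrightarrow> P z \<noteq> 0"
    "eventually (\<lambda>w. P w \<noteq> 0) (at z)"
    by (rule holomorphic_log_deriv_order[OF P(1) _ _ _ _ P(2), of z])
       (use z in \<open>auto simp: open_halfspace_Re_gt intro!: convex_connected convex_halfspace_Re_gt\<close>)
  have lim: "filterlim (\<lambda>e. z + of_real e) (at z) (at_right (0::real))"
  proof (rule filterlim_atI)
    have "((\<lambda>e. z + of_real e) \<longlongrightarrow> z + of_real 0) (at_right (0::real))" by (intro tendsto_intros)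
    thus "((\<lambda>e. z + of_real e) \<longlongrightarrow> z) (at_right (0::real))" by simp
    show "\<forall>\<^sub>F x in at_right (0::real). z + of_real x \<noteq> z"
      by (rule eventually_mono[OF eventually_at_right_less[of 0]]) auto
  qed
  define \<delta> :: complex where "\<delta> = (if X = dchar0 m \<and> z = 1 then 1 else 0)"
  have 1: "((\<lambda>e. of_real e * (deriv P (z + of_real e) / P (z + of_real e))) \<longlongrightarrow> of_nat k) (at_right (0::real))"
    using filterlim_compose[OF k(1) lim] by simp
  have 2: "((\<lambda>e. if X = dchar0 m then of_real e / (z + of_real e - 1) else 0) \<longlongrightarrow> \<delta>) (at_right (0::real))"
  proof (cases "X = dchar0 m")
    case True
    show ?thesis
    proof (cases "z = 1")
      case z1: True
      have "eventually (\<lambda>e::real. of_real e / (z + of_real e - 1) = (1::complex)) (at_right 0)"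
        using eventually_at_right_less by eventually_elim (auto simp: z1)
      thus ?thesis using True z1 by (auto simp: \<delta>_def intro: tendsto_eventually)
    next
      case False
      have "((\<lambda>e. of_real e / (z + of_real e - 1)) \<longlongrightarrow> of_real 0 / (z + of_real 0 - 1)) (at_right (0::real))"
        using False by (intro tendsto_intros) auto
      thus ?thesis using True False by (simp add: \<delta>_def)
    qed
  qed (simp add: \<delta>_def)
  have "eventually (\<lambda>e. P (z + of_real e) \<noteq> 0) (at_right (0::real))"
    using lim k(3) by (rule filterlim_iff[THEN iffD1, rule_format])
  hence "eventually (\<lambda>e. (if X = dchar0 m then of_real e / (z + of_real e - 1) else 0)
       - of_real e * (deriv P (z + of_real e) / P (z + of_real e)) = of_real e * H (z + of_real e)) (at_right (0::real))"
    using eventually_at_right_less[of "0::real"]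
  proof eventually_elim
    case (elim e)
    have R: "Re (z + of_real e) > 1" using z elim by simp
    hence "z + of_real e - 1 \<noteq> 0" by (auto simp: complex_eq_iff)
    have "H (z + of_real e) = (if X = dchar0 m then 1 / (z + of_real e - 1) else 0) - deriv P (z + of_real e) / P (z + of_real e)"
      using HP[OF R] elim(1) by (auto simp: field_simps)
    thus ?case by (auto simp: right_diff_distrib)
  qed
  with tendsto_diff[OF 2 1] have "((\<lambda>e. of_real e * H (z + of_real e)) \<longlongrightarrow> \<delta> - of_nat k) (at_right 0)"
    by (rule Lim_transform_eventually)
  thus ?thesis using k(2) that by (simp add: \<delta>_def)
qed

text \<open>With u = X n n^(-it) of modulus 1, the n-th term is a nonnegative multiple of Re (3 + 4
  u + u^2) = 2 (1 + Re u)^2. The terms with n not coprime to m vanish.\<close>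

lemma mangoldt_char_341:
  assumes m: "m > 0" and X: "X \<in> dchars m" and D0: "L_data m (dchar0 m) P0 H0" and D1: "L_data m X P1 H1"
    and D2: "L_data m (\<lambda>n. X n * X n) P2 H2" and e: "e > 0"
  shows "0 \<le> Re (3 * H0 (1 + of_real e) + 4 * H1 (1 + \<i> * of_real t + of_real e) + H2 (1 + \<i> * of_real (2 * t) + of_real e))"
proof -
  have H: "(\<lambda>n. mangoldt n * dchar0 m n * of_nat n powr (-(1 + of_real e))) sums H0 (1 + of_real e)"
    "(\<lambda>n. mangoldt n * X n * of_nat n powr (-(1 + \<i> * of_real t + of_real e))) sums H1 (1 + \<i> * of_real t + of_real e)"
    "(\<lambda>n. mangoldt n * (X n * X n) * of_nat n powr (-(1 + \<i> * of_real (2 * t) + of_real e))) sums H2 (1 + \<i> * of_real (2 * t) + of_real e)"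
    by (rule L_data_sums[OF D0], use e in simp, rule L_data_sums[OF D1], use e in simp, rule L_data_sums[OF D2], use e in simp)
  note sums = sums_Re[OF sums_add[OF sums_add[OF sums_mult[OF H(1), of 3] sums_mult[OF H(2), of 4]] H(3)]]
  show ?thesis
  proof (rule sums_le[OF _ sums_zero sums])
    fix n :: nat
    show "0 \<le> Re (3 * (mangoldt n * dchar0 m n * of_nat n powr (-(1 + of_real e))) +
       4 * (mangoldt n * X n * of_nat n powr (-(1 + \<i> * of_real t + of_real e))) +
       mangoldt n * (X n * X n) * of_nat n powr (-(1 + \<i> * of_real (2 * t) + of_real e)))" (is "0 \<le> Re ?T")
    proof (cases "n > 0 \<and> coprime n m")
      case False
      hence "?T = 0" using dchars_eq_0_iff[OF X, of n] by (cases "n = 0") (auto simp: dchar0_def)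
      thus ?thesis by simp
    next
      case True
      define v :: complex where "v = of_nat n powr (- \<i> * of_real t)"
      define u where "u = X n * v"
      have e1: "(of_nat n :: complex) powr (-(1 + of_real e)) = of_real (real n powr (-(1 + e)))"
        using powr_of_real[of "real n" "-(1 + e)"] by simp
      have e2: "(of_nat n :: complex) powr (-(1 + \<i> * of_real t + of_real e)) = of_nat n powr (-(1 + of_real e)) * v"
        unfolding v_def by (simp add: powr_add[symmetric] algebra_simps)
      have e3: "(of_nat n :: complex) powr (-(1 + \<i> * of_real (2 * t) + of_real e)) = of_nat n powr (-(1 + of_real e)) * (v * v)"
        unfolding v_def by (simp add: powr_add[symmetric] algebra_simps)
      have T: "?T = of_real (mangoldt n * real n powr (-(1 + e))) * (3 + 4 * u + u\<^sup>2)"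
        unfolding e1 e2 e3 using True
        by (simp add: dchar0_def u_def power2_eq_square algebra_simps)
      have "norm v = 1" using True norm_powr_real_powr[of "of_nat n" "- \<i> * of_real t"] by (simp add: v_def)
      hence "norm u = 1" using norm_dchars[OF m X, of n] True by (simp add: u_def norm_mult)
      hence u1: "(Re u)\<^sup>2 + (Im u)\<^sup>2 = 1" by (simp add: cmod_def)
      have "Re (3 + 4 * u + u\<^sup>2) = 3 + 4 * Re u + ((Re u)\<^sup>2 - (Im u)\<^sup>2)" by (simp add: Re_power2)
      also have "\<dots> = 2 * (1 + Re u)\<^sup>2" using u1 by (simp add: power2_eq_square algebra_simps)
      finally have "Re (3 + 4 * u + u\<^sup>2) \<ge> 0" by simp
      thus ?thesis unfolding T by (simp add: mangoldt_nonneg)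
    qed
  qed
qed

text \<open>For Re z > 1, H is continuous at z, so e H (z + e) tends to 0 and the order is 0. On the
  line Re z = 1 the 3-4-1 inequality is multiplied by e and e tends to 0, which turns it into an
  inequality between orders at 1, 1 + it and 1 + 2it.\<close>

theorem L_data_nonzero:
  assumes m: "m > 0" and X: "X \<in> dchars m" and D: "L_data m X P H" and z: "Re z \<ge> 1"
  shows "P z \<noteq> 0"
proof (cases "Re z > 1")
  case True
  obtain k where k: "((\<lambda>e. of_real e * H (z + of_real e)) \<longlongrightarrow> (if X = dchar0 m \<and> z = 1 then 1 else 0) - of_nat k) (at_right 0)"
    "k = 0 \<longleftrightarrow> P z \<noteq> 0"
    using L_data_order[OF D z] by blast
  have "H holomorphic_on {s. Re s > 1}" using D by (simp add: L_data_def)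
  hence "isCont H z" using True
    by (intro continuous_on_interior[OF holomorphic_on_imp_continuous_on]) (auto simp: interior_open open_halfspace_Re_gt)
  moreover have "((\<lambda>e. z + of_real e) \<longlongrightarrow> z + of_real 0) (at_right (0::real))" by (intro tendsto_intros)
  ultimately have "((\<lambda>e. H (z + of_real e)) \<longlongrightarrow> H z) (at_right (0::real))"
    using isCont_tendsto_compose[of z H "\<lambda>e. z + of_real e" "at_right (0::real)"] by simp
  hence "((\<lambda>e. of_real e * H (z + of_real e)) \<longlongrightarrow> of_real 0 * H z) (at_right (0::real))" by (intro tendsto_intros)
  from tendsto_unique[OF _ k(1) this] True have "k = 0" by (auto split: if_splits)
  thus ?thesis using k by simp
next
  case False
  define t where "t = Im z"
  have zt: "z = 1 + \<i> * of_real t" using z False by (simp add: t_def complex_eq_iff)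
  show ?thesis
  proof
    assume Pz: "P z = 0"
    have pr: "dchar0 m \<in> dchars m" by (rule dchar0_in)
    have X2: "(\<lambda>n. X n * X n) \<in> dchars m" by (rule dchars_times[OF X X])
    obtain P0 H0 where D0: "L_data m (dchar0 m) P0 H0" using L_data_exists[OF m pr] .
    obtain P2 H2 where D2: "L_data m (\<lambda>n. X n * X n) P2 H2" using L_data_exists[OF m X2] .
    obtain k0 where k0: "((\<lambda>e. of_real e * H0 (1 + of_real e)) \<longlongrightarrow> (if dchar0 m = dchar0 m \<and> (1::complex) = 1 then 1 else 0) - of_nat k0) (at_right 0)"
      "k0 = 0 \<longleftrightarrow> P0 1 \<noteq> 0" using L_data_order[OF D0, of 1] by auto
    have "k0 = 0" using D0 k0 by (simp add: L_data_def)
    obtain k1 where k1: "((\<lambda>e. of_real e * H (z + of_real e)) \<longlongrightarrow> (if X = dchar0 m \<and> z = 1 then 1 else 0) - of_nat k1) (at_right 0)"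
      "k1 = 0 \<longleftrightarrow> P z \<noteq> 0" using L_data_order[OF D z] by blast
    have k1pos: "k1 \<ge> 1" using k1(2) Pz by auto
    have not1: "\<not> (X = dchar0 m \<and> z = 1)" using D Pz by (auto simp: L_data_def)
    define z2 where "z2 = 1 + \<i> * of_real (2 * t)"
    obtain k2 where k2: "((\<lambda>e. of_real e * H2 (z2 + of_real e)) \<longlongrightarrow> (if (\<lambda>n. X n * X n) = dchar0 m \<and> z2 = 1 then 1 else 0) - of_nat k2) (at_right 0)"
      using L_data_order[OF D2, of z2] by (auto simp: z2_def)
    define f :: "real \<Rightarrow> complex" where "f = (\<lambda>e. 3 * (of_real e * H0 (1 + of_real e)) + 4 * (of_real e * H (z + of_real e)) + of_real e * H2 (z2 + of_real e))"
    let ?c = "3 * (1 - of_nat 0) + 4 * (0 - of_nat k1) + ((if (\<lambda>n. X n * X n) = dchar0 m \<and> z2 = 1 then 1 else 0) - of_nat k2) :: complex"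
    have "(f \<longlongrightarrow> ?c) (at_right 0)"
      unfolding f_def using k0(1) k1(1) k2 not1 \<open>k0 = 0\<close> by (intro tendsto_intros) auto
    hence "((\<lambda>e. Re (f e)) \<longlongrightarrow> Re ?c) (at_right 0)"
      by (rule tendsto_Re)
    moreover have "eventually (\<lambda>e. 0 \<le> Re (f e)) (at_right 0)"
      using eventually_at_right_less[of "0::real"]
    proof eventually_elim
      case (elim e)
      have "f e = of_real e * (3 * H0 (1 + of_real e) + 4 * H (z + of_real e) + H2 (z2 + of_real e))"
        by (simp add: f_def algebra_simps)
      thus ?case using mangoldt_char_341[OF m X D0 D D2 elim, of t] elim by (simp add: zt z2_def)
    qed
    ultimately have "0 \<le> Re ?c" by (intro tendsto_lowerbound[of _ _ "at_right (0::real)"]) auto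
    \<comment> \<open>The limit reads 3 - 4 k1 + (1 or 0) - k2 >= 0 with k1 >= 1. This leaves only
      k1 = 1 and k2 = 0 together with a pole of L(s, X^2) at 1 + 2it.\<close>
    hence sq: "(\<lambda>n. X n * X n) = dchar0 m" and t0: "t = 0"
      using k1pos by (auto simp: z2_def complex_eq_iff split: if_splits)
    have z1: "z = 1" by (simp add: zt t0)
    hence np: "X \<noteq> dchar0 m" using not1 by simp
    define Y where "Y = (\<lambda>n. Re (X n))"
    have range: "X n \<in> {-1, 0, 1}" for n
      using fun_cong[OF sq, of n] by (auto simp: dchar0_def square_eq_1_iff split: if_splits)
    have XY: "X n = of_real (Y n)" "Y n \<in> {-1, 0, 1}" for n using range[of n] by (auto simp: Y_def)
    have "P 1 = of_real (Re (P 1)) \<and> Re (P 1) \<noteq> 0"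
    proof -
      have lim: "(\<lambda>N. \<Sum>n=1..N*m. X n / of_nat n) \<longlonglongrightarrow> P 1" using D np by (simp add: L_data_def)
      have eq: "(\<Sum>n=1..N*m. X n / of_nat n) = of_real (\<Sum>n=1..N*m. Y n / real n)" for N
        by (simp add: XY(1))
      from tendsto_Re[OF lim] have limY: "(\<lambda>N. \<Sum>n=1..N*m. Y n / real n) \<longlonglongrightarrow> Re (P 1)"
        unfolding eq by simp
      have "Re (P 1) \<noteq> 0"
      proof (rule real_char_sum_nonzero[OF _ _ XY(2) _ m limY])
        show "Y (x * y) = Y x * Y y" for x y
        proof -
          have "of_real (Y (x * y)) = (of_real (Y x * Y y) :: complex)"
            using dchars_mult[OF X, of x y] by (simp add: XY(1)[symmetric])
          thus ?thesis by (simp only: of_real_eq_iff)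
        qed
        show "Y 1 = 1" using dchars_1[OF X] by (simp add: Y_def)
        \<comment> \<open>Full periods cancel, and fewer than m terms of modulus at most 1
          remain.\<close>
        show "\<bar>\<Sum>n=1..N. Y n\<bar> \<le> real m" for N
        proof -
          have per: "Y (x + m) = Y x" for x using dchars_add_mult[OF X, of x 1] by (simp add: Y_def)
          have zero: "(\<Sum>x<m. Y x) = 0"
          proof -
            have "of_real (\<Sum>x<m. Y x) = (0 :: complex)"
              using sum_dchars_residues[OF m X] np by (simp add: XY(1)[symmetric])
            thus ?thesis by (simp only: of_real_eq_0_iff)
          qed
          have full: "(\<Sum>n=1..<1+q*m. Y n) = 0" for q
          proof (induction q)
            case (Suc q)
            have "(\<Sum>n=1..<1+Suc q*m. Y n) = (\<Sum>n=1..<1+q*m. Y n) + (\<Sum>n=1+q*m..<1+q*m+m. Y n)"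
              by (subst sum.atLeastLessThan_concat) (auto simp: algebra_simps)
            also have "(\<Sum>n=1+q*m..<1+q*m+m. Y n) = (\<Sum>x<m. Y x)" by (rule sum_periodic_shift) (rule per)
            also note zero
            finally show ?case using Suc by simp
          qed simp
          define q where "q = N div m"
          have N: "N = q * m + N mod m" "N mod m < m" using m by (simp_all add: q_def)
          have "{1..N} = {1..<1+N}" by auto
          hence "(\<Sum>n=1..N. Y n) = (\<Sum>n=1..<1+q*m. Y n) + (\<Sum>n=1+q*m..<1+N. Y n)"
            using N(1) by (subst sum.atLeastLessThan_concat) auto
          hence "\<bar>\<Sum>n=1..N. Y n\<bar> = \<bar>\<Sum>n=1+q*m..<1+N. Y n\<bar>" by (simp only: full)
          also have "\<dots> \<le> (\<Sum>n=1+q*m..<1+N. 1)"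
            using XY(2) by (intro order_trans[OF sum_abs] sum_mono) (metis abs_minus_cancel abs_one abs_zero empty_iff insert_iff order_refl zero_le_one)
          also have "\<dots> = real (1 + N - (1 + q * m))" by simp
          also have "\<dots> \<le> real m" unfolding of_nat_le_iff using N by linarith
          finally show ?thesis .
        qed
      qed
      thus ?thesis using LIMSEQ_unique[OF lim[unfolded eq] tendsto_of_real[OF limY]] by simp
    qed
    thus False using Pz z1 by auto
  qed
qed

section \<open>The prime number theorem for arithmetic progressions\<close>

text \<open>If A N / N is at least l + e, monotonicity keeps A n / n above l + e / 2 for N <= n <=
  (1 + d) N, and this block of the series exceeds a fixed amount, against the Cauchy criterion. If
  it is at most l - e, the block (1 - d) N <= n <= N serves.\<close>

lemma tendsto_of_summable_monotone:
  fixes A :: "nat \<Rightarrow> real"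
  assumes mono: "\<And>m n. m \<le> n \<Longrightarrow> A m \<le> A n" and nonneg: "\<And>n. A n \<ge> 0" and l: "l > 0"
    and summable: "summable (\<lambda>n. (A n / real n - l) / real n)"
  shows "(\<lambda>n. A n / real n) \<longlonglongrightarrow> l"
proof (rule LIMSEQ_I)
  fix e :: real assume e: "e > 0"
  define f where "f = (\<lambda>n. (A n / real n - l) / real n)"
  \<comment> \<open>Chosen so that (l + e / 2) (1 + d) = l + e.\<close>
  define d where "d = e / (2 * l + e)"
  have d: "d > 0" "d < 1" using e l by (auto simp: d_def field_simps)
  \<comment> \<open>In the upper case there are at least d N terms, each at least e / 2 / ((1 + d)
    N); the lower case gives the larger amount d e / 2.\<close>
  define h where "h = e / 2 * (d / (1 + d))"
  have eta: "h > 0" using e d by (simp add: h_def)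
  obtain N0 where N0: "\<And>m n. m \<ge> N0 \<Longrightarrow> norm (sum f {m..<n}) < h"
    using summable eta unfolding summable_Cauchy f_def by blast
  \<comment> \<open>Beyond N1 even the lower block, which starts near (1 - d) N, lies past
    N0.\<close>
  obtain N1 :: nat where N1: "real N1 > real N0 / (1 - d)" using reals_Archimedean2 by blast
  have key: "\<bar>A N / real N - l\<bar> < e" if N: "N \<ge> N1" "N \<ge> N0" "N > 0" for N
  proof (rule ccontr)
    assume "\<not> \<bar>A N / real N - l\<bar> < e"
    then consider "A N / real N \<ge> l + e" | "A N / real N \<le> l - e" by linarith
    thus False
    proof cases
      case 1
      hence AN: "A N \<ge> (l + e) * real N" using N by (simp add: field_simps)
      define t where "t = e / 2 / ((1 + d) * real N)"
      define M where "M = nat \<lfloor>(1 + d) * real N\<rfloor>"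
      have M: "real M \<le> (1 + d) * real N" "(1 + d) * real N < real M + 1"
        using d by (auto simp: M_def)
      have M0: "real M > 0"
      proof -
        have "real N \<le> (1 + d) * real N" using d by (simp add: algebra_simps)
        hence "N \<le> M" unfolding M_def using le_nat_floor by blast
        thus ?thesis using N by simp
      qed
      have "t \<le> f n" if n: "n \<in> {N..<Suc M}" for n
      proof -
        have n0: "real n > 0" "real n \<le> (1 + d) * real N" using n N M by auto
        have "(l + e / 2) * (1 + d) = l + e" using e l by (simp add: d_def field_simps)
        hence "(l + e / 2) * ((1 + d) * real N) = (l + e) * real N" by (simp add: mult.assoc[symmetric])
        moreover have "(l + e / 2) * real n \<le> (l + e / 2) * ((1 + d) * real N)"
          using n0 e l by (intro mult_left_mono) auto
        moreover have "A N \<le> A n" using n by (intro mono) auto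
        ultimately have "(l + e / 2) * real n \<le> A n" using AN by linarith
        hence "e / 2 \<le> A n / real n - l" using n0 by (simp add: field_simps)
        moreover have "t \<le> e / 2 / real n"
          unfolding t_def using n0 e d N by (intro divide_left_mono) auto
        ultimately show ?thesis unfolding f_def using n0 by (meson divide_right_mono less_imp_le order_trans)
      qed
      hence "real (card {N..<Suc M}) * t \<le> sum f {N..<Suc M}"
        by (intro sum_bounded_below) auto
      moreover have "h \<le> real (card {N..<Suc M}) * t"
      proof -
        have "d * real N \<le> real (card {N..<Suc M})" using M by (simp add: algebra_simps)
        hence "d * real N * t \<le> real (card {N..<Suc M}) * t"
          using e d by (intro mult_right_mono) (auto simp: t_def)
        moreover have "d * real N * t = h"
        proof -
          define D where "D = 1 + d"
          have "D > 0" using d by (simp add: D_def)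
          thus ?thesis unfolding t_def h_def D_def[symmetric] using N by (simp add: field_simps)
        qed
        ultimately show ?thesis by simp
      qed
      ultimately show False using N0[OF N(2), of "Suc M"] unfolding real_norm_def by linarith
    next
      case 2
      hence AN: "A N \<le> (l - e) * real N" using N by (simp add: field_simps)
      hence le: "l - e \<ge> 0" using nonneg[of N] N by (metis mult_neg_pos not_le of_nat_0_less_iff order_trans)
      define M where "M = nat \<lceil>(1 - d) * real N\<rceil>"
      have M: "(1 - d) * real N \<le> real M" "real M < (1 - d) * real N + 1"
      proof -
        have "real M = of_int \<lceil>(1 - d) * real N\<rceil>" using d by (simp add: M_def)
        thus "(1 - d) * real N \<le> real M" "real M < (1 - d) * real N + 1"
          using ceiling_correct[of "(1 - d) * real N"] by linarith+
      qed
      have MN0: "M \<ge> N0"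
      proof -
        have "real N0 < (1 - d) * real N1" using N1 d by (simp add: field_simps)
        also have "\<dots> \<le> (1 - d) * real N" using N d by (intro mult_left_mono) auto
        finally show ?thesis using M by linarith
      qed
      have "f n \<le> - (e / 2 / real N)" if n: "n \<in> {M..<Suc N}" for n
      proof -
        have n0: "(1 - d) * real N \<le> real n" "real n \<le> real N" using n M by auto
        have npos: "real n > 0" using n0(1) d N by (smt (verit) mult_pos_pos of_nat_0_less_iff)
        have "(l - e) \<le> (l - e / 2) * (1 - d)"
        proof -
          have "(l - e / 2) * d \<le> (l + e / 2) * d" using e d by (intro mult_right_mono) auto
          also have "(l + e / 2) * d = e / 2" using e l by (simp add: d_def field_simps)
          finally have "(l - e / 2) * d \<le> e / 2" .
          moreover have "(l - e / 2) * (1 - d) = (l - e / 2) - (l - e / 2) * d" by (simp add: right_diff_distrib)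
          ultimately show ?thesis by linarith
        qed
        hence "(l - e) * real N \<le> (l - e / 2) * ((1 - d) * real N)"
          by (simp add: mult.assoc[symmetric] mult_right_mono)
        moreover have "(l - e / 2) * ((1 - d) * real N) \<le> (l - e / 2) * real n"
          using n0 le e by (intro mult_left_mono) auto
        moreover have "A n \<le> A N" using n by (intro mono) auto
        ultimately have "A n \<le> (l - e / 2) * real n" using AN by linarith
        hence "A n / real n - l \<le> - (e / 2)" using npos by (simp add: field_simps)
        hence "f n \<le> - (e / 2) / real n" unfolding f_def using npos by (intro divide_right_mono) auto
        moreover have "e / 2 / real N \<le> e / 2 / real n" using n0 npos e N by (intro divide_left_mono) auto
        ultimately show ?thesis by simp
      qed
      hence "sum f {M..<Suc N} \<le> real (card {M..<Suc N}) * (- (e / 2 / real N))"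
        by (intro sum_bounded_above) auto
      moreover have "h \<le> real (card {M..<Suc N}) * (e / 2 / real N)"
      proof -
        have "d * real N \<le> real N + 1 - real M" using M by (simp add: algebra_simps)
        also have "\<dots> \<le> real (card {M..<Suc N})" by (simp add: of_nat_diff_real)
        finally have "d * real N * (e / 2 / real N) \<le> real (card {M..<Suc N}) * (e / 2 / real N)"
          using e by (intro mult_right_mono) auto
        moreover have "d * real N * (e / 2 / real N) = e / 2 * d" using N by simp
        moreover have "h \<le> e / 2 * d" unfolding h_def using e d by (intro mult_left_mono) (auto simp: field_simps)
        ultimately show ?thesis by simp
      qed
      ultimately show False using N0[OF MN0, of "Suc N"] unfolding real_norm_def by linarith
    qed
  qed
  show "\<exists>no. \<forall>n\<ge>no. norm (A n / real n - l) < e"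
    using key by (intro exI[of _ "max N1 (max N0 1)"]) auto
qed

section \<open>The Chebyshev function of a residue class\<close>

definition psi_ap :: "nat \<Rightarrow> nat \<Rightarrow> nat \<Rightarrow> real" where
  "psi_ap m c n = (\<Sum>k | k \<in> {1..n} \<and> [k = c] (mod m). mangoldt k)"

lemma psi_ap_nonneg: "psi_ap m c n \<ge> 0"
  unfolding psi_ap_def by (intro sum_nonneg mangoldt_nonneg)

lemma psi_ap_mono: "n \<le> n' \<Longrightarrow> psi_ap m c n \<le> psi_ap m c n'"
  unfolding psi_ap_def by (intro sum_mono2) (auto simp: mangoldt_nonneg)

lemma psi_ap_le: "psi_ap m c n \<le> 6 * real n"
proof -
  have "psi_ap m c n \<le> psi n"
    unfolding psi_ap_def psi_def by (intro sum_mono2) (auto simp: mangoldt_nonneg)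
  thus ?thesis using psi_le[of n] by linarith
qed

lemma psi_ap_0 [simp]: "psi_ap m c 0 = 0"
  by (simp add: psi_ap_def)

lemma psi_ap_Suc: "psi_ap m c (Suc n) = psi_ap m c n + (if [Suc n = c] (mod m) then mangoldt (Suc n) else 0)"
proof -
  have "{k. k \<in> {1..Suc n} \<and> [k = c] (mod m)} =
     (if [Suc n = c] (mod m) then insert (Suc n) {k. k \<in> {1..n} \<and> [k = c] (mod m)} else {k. k \<in> {1..n} \<and> [k = c] (mod m)})"
    by (auto simp: le_Suc_eq)
  thus ?thesis by (simp add: psi_ap_def)
qed

lemma abel_summation_sums:
  fixes A lam u :: "nat \<Rightarrow> complex"
  assumes "A 0 = 0" "lam 0 = 0" "\<And>n. A (Suc n) = A n + lam (Suc n)"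
    and "(\<lambda>n. lam n * u n) sums S" "(\<lambda>n. A n * u (Suc n)) \<longlonglongrightarrow> 0"
  shows "(\<lambda>n. A n * (u n - u (Suc n))) sums S"
proof -
  have eq: "(\<Sum>n<Suc N. A n * (u n - u (Suc n))) = (\<Sum>n<Suc N. lam n * u n) - A N * u (Suc N)" for N
  proof (induction N)
    case (Suc N)
    have "(\<Sum>n<Suc (Suc N). A n * (u n - u (Suc n))) = (\<Sum>n<Suc N. A n * (u n - u (Suc n))) + A (Suc N) * (u (Suc N) - u (Suc (Suc N)))"
      by simp
    also have "\<dots> = (\<Sum>n<Suc N. lam n * u n) - A N * u (Suc N) + A (Suc N) * (u (Suc N) - u (Suc (Suc N)))"
      by (simp only: Suc.IH)
    also have "\<dots> = (\<Sum>n<Suc (Suc N). lam n * u n) - A (Suc N) * u (Suc (Suc N))"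
      by (simp add: assms(3) algebra_simps)
    finally show ?case .
  qed (simp add: assms)
  have "(\<lambda>N. (\<Sum>n<Suc N. lam n * u n) - A N * u (Suc N)) \<longlonglongrightarrow> S - 0"
    using assms(4) unfolding sums_def by (intro tendsto_diff assms(5)) (rule LIMSEQ_Suc)
  hence "(\<lambda>N. \<Sum>n<Suc N. A n * (u n - u (Suc n))) \<longlonglongrightarrow> S" by (simp only: eq diff_zero)
  thus ?thesis unfolding sums_def by (subst (asm) filterlim_sequentially_Suc)
qed

text \<open>Chebyshev's bound costs one power of n and the second difference saves two, which leaves
  terms of size n^(-Re s - 1).\<close>

lemma holomorphic_psi_ap_remainder:
  obtains R where "R holomorphic_on {s. Re s > 0}"
    "\<And>s. Re s > 0 \<Longrightarrow> (\<lambda>n. of_real (psi_ap m c n) * (of_nat n powr (-s) - of_nat (Suc n) powr (-s) - s * of_nat n powr (-s - 1))) sums R s"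
proof -
  let ?f = "\<lambda>n s. of_real (psi_ap m c n) * (of_nat n powr (-s) - of_nat (Suc n) powr (-s) - s * of_nat n powr (-s - 1)) :: complex"
  show ?thesis
  proof (rule entire_series_holomorphic[of ?f "\<lambda>t. 6 * (t * (t + 1))"])
    fix n :: nat and s :: complex
    show "?f n holomorphic_on UNIV" by (intro holomorphic_intros)
    assume n: "n > 0" and s: "Re s > 0"
    have "norm (?f n s) \<le> (6 * real n) * (norm s * norm (s + 1) * real n powr (- Re s - 2))"
      unfolding norm_mult using n s psi_ap_le psi_ap_nonneg by (intro mult_mono norm_powr_second_diff_le) auto
    also have "\<dots> \<le> (6 * real n) * (norm s * (norm s + 1) * real n powr (- Re s - 2))"
      using norm_triangle_ineq[of s 1] by (intro mult_left_mono mult_right_mono) auto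
    also have "\<dots> = 6 * (norm s * (norm s + 1)) * (real n * real n powr (- Re s - 2))" by simp
    also have "real n * real n powr (- Re s - 2) = real n powr (- Re s - 1)"
      by (simp add: powr_mult_base minus_diff_commute)
    finally show "norm (?f n s) \<le> 6 * (norm s * (norm s + 1)) * real n powr (- Re s - 1)" .
  next
    show "mono_on {0..} (\<lambda>t::real. 6 * (t * (t + 1)))" by (intro mono_onI mult_left_mono mult_mono) auto
  qed (use that in auto)
qed

text \<open>By orthogonality \<open>Hc\<close> is the series of \<Lambda> over the class of c, and
  Abel summation writes it as s times the series of psi(n) / n plus \<open>R\<close>. Hence (Hc - R)
  / s minus zeta / \<phi> is the Dirichlet series of the bounded coefficients \<open>a\<close>;
  Newman's theorem needs its continuation across Re s = 1.\<close>

theorem prime_number_theorem_ap: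
  assumes m: "m > 0" and c: "coprime c m"
  shows "(\<lambda>n. psi_ap m c n / real n) \<longlonglongrightarrow> 1 / real (totient m)"
proof -
  define \<phi> where "\<phi> = real (totient m)"
  have phi: "\<phi> \<ge> 1" using m by (simp add: \<phi>_def Suc_le_eq)
  define A where "A = psi_ap m c"
  have "\<forall>X\<in>dchars m. \<exists>PH. L_data m X (fst PH) (snd PH)"
    using L_data_exists[OF m] by (metis fst_conv snd_conv)
  then obtain PH where PH: "\<And>X. X \<in> dchars m \<Longrightarrow> L_data m X (fst (PH X)) (snd (PH X))" by metis
  define P where "P = (\<lambda>X. fst (PH X))"
  define H where "H = (\<lambda>X. snd (PH X))"
  have D: "L_data m X (P X) (H X)" if "X \<in> dchars m" for X using PH[OF that] by (simp add: P_def H_def)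
  have fin: "finite (dchars m)" by (rule finite_dchars[OF m])
  define Hc where "Hc = (\<lambda>s. (\<Sum>X\<in>dchars m. cnj (X c) * H X s) / of_real \<phi>)"
  define lam :: "nat \<Rightarrow> complex" where "lam = (\<lambda>n. if [n = c] (mod m) then mangoldt n else 0)"
  have Hc: "(\<lambda>n. lam n * of_nat n powr (-s)) sums Hc s" if s: "Re s > 1" for s
  proof -
    have "(\<lambda>n. (\<Sum>X\<in>dchars m. cnj (X c) * (mangoldt n * X n * of_nat n powr (-s))) / of_real \<phi>) sums Hc s"
      unfolding Hc_def by (intro sums_divide sums_sum sums_mult L_data_sums[OF D] s)
    moreover have "(\<Sum>X\<in>dchars m. cnj (X c) * (mangoldt n * X n * of_nat n powr (-s))) / of_real \<phi> = lam n * of_nat n powr (-s)" for n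
    proof -
      have "(\<Sum>X\<in>dchars m. cnj (X c) * (mangoldt n * X n * of_nat n powr (-s)))
         = (\<Sum>X\<in>dchars m. cnj (X c) * X n) * (mangoldt n * of_nat n powr (-s))"
        unfolding sum_distrib_right by (intro sum.cong refl) (simp add: mult_ac)
      also have "\<dots> = of_real \<phi> * (lam n * of_nat n powr (-s))"
        unfolding dchars_orthogonality[OF m c] by (simp add: \<phi>_def lam_def)
      finally show ?thesis using phi by simp
    qed
    ultimately show ?thesis by simp
  qed
  have abel: "(\<lambda>n. of_real (A n) * (of_nat n powr (-s) - of_nat (Suc n) powr (-s))) sums Hc s" if s: "Re s > 1" for s
  proof (rule abel_summation_sums[OF _ _ _ Hc[OF s]])
    show "of_real (A (Suc n)) = of_real (A n) + lam (Suc n)" for n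
      by (simp add: A_def psi_ap_Suc lam_def)
    show "(\<lambda>n. of_real (A n) * of_nat (Suc n) powr (-s)) \<longlonglongrightarrow> 0"
    proof (rule Lim_null_comparison)
      show "\<forall>\<^sub>F n in sequentially. norm (of_real (A n) * of_nat (Suc n) powr (-s)) \<le> 6 * real (Suc n) powr (1 - Re s)"
      proof (intro always_eventually allI)
        fix n
        have "norm (of_real (A n) * of_nat (Suc n) powr (-s) :: complex) = A n * real (Suc n) powr (- Re s)"
          using norm_powr_real_powr[of "of_nat (Suc n)" "-s"] psi_ap_nonneg by (simp add: norm_mult A_def del: of_nat_Suc)
        also have "\<dots> \<le> (6 * real (Suc n)) * real (Suc n) powr (- Re s)"
          using psi_ap_le[of m c n] by (intro mult_right_mono) (auto simp: A_def)
        also have "\<dots> = 6 * real (Suc n) powr (1 - Re s)"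
          by (simp add: powr_diff powr_minus field_simps del: of_nat_Suc)
        finally show "norm (of_real (A n) * of_nat (Suc n) powr (-s) :: complex) \<le> 6 * real (Suc n) powr (1 - Re s)" .
      qed
      show "(\<lambda>n. 6 * real (Suc n) powr (1 - Re s)) \<longlonglongrightarrow> 0" using s by real_asymp
    qed
  qed (simp_all add: A_def lam_def)
  obtain R where R: "R holomorphic_on {s. Re s > 0}"
    "\<And>s. Re s > 0 \<Longrightarrow> (\<lambda>n. of_real (A n) * (of_nat n powr (-s) - of_nat (Suc n) powr (-s) - s * of_nat n powr (-s - 1))) sums R s"
    unfolding A_def using holomorphic_psi_ap_remainder[of m c] by blast
  obtain G where G: "G holomorphic_on {s. Re s > 0}" "G 1 = 1"
    "\<And>s. Re s > 1 \<Longrightarrow> (\<lambda>n. of_nat n powr (-s)) sums (G s / (s - 1))"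
    using zeta_continuation by blast
  define a :: "nat \<Rightarrow> complex" where "a = (\<lambda>n. of_real (A n / real n - 1 / \<phi>))"
  have a_sums: "(\<lambda>n. a n * of_nat n powr (-s)) sums ((Hc s - R s) / s - G s / (s - 1) / of_real \<phi>)" if s: "Re s > 1" for s
  proof -
    have s0: "s \<noteq> 0" "Re s > 0" using s by auto
    have "(\<lambda>n. of_real (A n) * (of_nat n powr (-s) - of_nat (Suc n) powr (-s))
       - of_real (A n) * (of_nat n powr (-s) - of_nat (Suc n) powr (-s) - s * of_nat n powr (-s - 1))) sums (Hc s - R s)"
      by (intro sums_diff abel s R(2) s0)
    hence "(\<lambda>n. (of_real (A n) * (s * of_nat n powr (-s - 1))) / s - of_nat n powr (-s) / of_real \<phi>) sums ((Hc s - R s) / s - G s / (s - 1) / of_real \<phi>)"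
      by (intro sums_diff sums_divide G(3) s) (simp add: right_diff_distrib)
    moreover have "(of_real (A n) * (s * of_nat n powr (-s - 1))) / s - of_nat n powr (-s) / of_real \<phi> = a n * of_nat n powr (-s)" for n
      using s0 by (cases "n = 0") (simp_all add: a_def powr_diff left_diff_distrib)
    ultimately show ?thesis by simp
  qed
  \<comment> \<open>The region where no \<open>P X\<close> vanishes; it is open because there are
    finitely many characters, and contains Re s >= 1 by the nonvanishing theorem.\<close>
  define U where "U = {s. Re s > 0} \<inter> (\<Inter>X\<in>dchars m. {s. Re s > 0} \<inter> P X -` (- {0}))"
  have U_open: "open U" unfolding U_def
  proof (rule open_Int[OF open_halfspace_Re_gt], rule open_INT[OF fin], rule ballI)
    fix X assume X: "X \<in> dchars m"
    have "P X holomorphic_on {s. Re s > 0}" using D[OF X] by (simp add: L_data_def)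
    thus "open ({s. Re s > 0} \<inter> P X -` (- {0}))"
      by (intro continuous_open_preimage holomorphic_on_imp_continuous_on open_halfspace_Re_gt) auto
  qed
  have U1: "{s. Re s \<ge> 1} \<subseteq> U" using L_data_nonzero[OF m _ D] by (auto simp: U_def)
  have U0: "U \<subseteq> {s. Re s > 0}" by (auto simp: U_def)
  define W where "W = (\<lambda>s. (\<Sum>X\<in>dchars m. cnj (X c) * (- deriv (P X) s / P X s)) / of_real \<phi>)"
  have W: "W holomorphic_on U"
  proof -
    have "(\<lambda>s. - deriv (P X) s / P X s) holomorphic_on U" if X: "X \<in> dchars m" for X
    proof (intro holomorphic_on_divide holomorphic_on_minus)
      have P: "P X holomorphic_on {s. Re s > 0}" using D[OF X] by (simp add: L_data_def)
      show "P X holomorphic_on U" by (rule holomorphic_on_subset[OF P U0])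
      show "deriv (P X) holomorphic_on U"
        by (rule holomorphic_on_subset[OF holomorphic_deriv[OF P open_halfspace_Re_gt] U0])
      show "P X s \<noteq> 0" if "s \<in> U" for s using that X unfolding U_def by blast
    qed
    hence "(\<lambda>s. \<Sum>X\<in>dchars m. cnj (X c) * (- deriv (P X) s / P X s)) holomorphic_on U"
      by (intro holomorphic_on_sum) (rule holomorphic_on_mult[OF holomorphic_on_const])
    thus ?thesis unfolding W_def by (rule holomorphic_on_divide[OF _ holomorphic_on_const]) (use phi in simp)
  qed
  have HcW: "Hc s = W s + 1 / (of_real \<phi> * (s - 1))" if s: "Re s > 1" for s
  proof -
    have "H X s = - deriv (P X) s / P X s + (if X = dchar0 m then 1 / (s - 1) else 0)" if X: "X \<in> dchars m" for X
    proof -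
      have nz: "P X s \<noteq> 0" using L_data_nonzero[OF m X D[OF X], of s] s by simp
      have "H X s * P X s = (if X = dchar0 m then P X s / (s - 1) else 0) - deriv (P X) s"
        using D[OF X] s unfolding L_data_def by blast
      hence "H X s = ((if X = dchar0 m then P X s / (s - 1) else 0) - deriv (P X) s) / P X s"
        using nz by (simp add: eq_divide_eq)
      thus ?thesis using nz by (auto simp: diff_divide_distrib)
    qed
    hence "(\<Sum>X\<in>dchars m. cnj (X c) * H X s) = (\<Sum>X\<in>dchars m. cnj (X c) * (- deriv (P X) s / P X s)
        + (if X = dchar0 m then cnj (X c) * (1 / (s - 1)) else 0))"
      by (intro sum.cong refl) (auto simp: distrib_left right_diff_distrib)
    \<comment> \<open>Only the principal character contributes a pole, with weight 1 as c is coprime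
      to m.\<close>
    also have "\<dots> = (\<Sum>X\<in>dchars m. cnj (X c) * (- deriv (P X) s / P X s)) + 1 / (s - 1)"
      using fin dchar0_in[of m] c by (subst sum.distrib) (simp add: dchar0_def[of m c])
    finally show ?thesis by (simp add: Hc_def W_def add_divide_distrib)
  qed
  \<comment> \<open>The poles of Hc / s and of zeta / \<phi> at 1 combine to - (s G s - 1) / (s - 1)
    / (s \<phi>), and G 1 = 1 makes this singularity removable.\<close>
  define Q where "Q = (\<lambda>s. if s = 1 then deriv (\<lambda>s. s * G s) 1 else (s * G s - 1 * G 1) / (s - 1))"
  have Q: "Q holomorphic_on {s. Re s > 0}"
    unfolding Q_def
    by (rule pole_lemma[of "\<lambda>s. s * G s"]) (auto intro!: holomorphic_intros G simp: interior_open open_halfspace_Re_gt)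
  define F where "F = (\<lambda>s. (W s - R s) / s - Q s / (s * of_real \<phi>))"
  have "F holomorphic_on U" unfolding F_def
    using U0 phi by (intro holomorphic_intros W holomorphic_on_subset[OF R(1)] holomorphic_on_subset[OF Q]) auto
  moreover have "F s = (Hc s - R s) / s - G s / (s - 1) / of_real \<phi>" if s: "Re s > 1" for s
  proof -
    have nz: "s \<noteq> 0" "s - 1 \<noteq> 0" "of_real \<phi> \<noteq> (0::complex)" using s phi by (auto simp: complex_eq_iff)
    have "Q s = (s * G s - 1) / (s - 1)" using nz(2) by (simp add: Q_def G(2))
    hence "F s = (W s - R s) / s - (s * G s - 1) / (s - 1) / (s * of_real \<phi>)" by (simp add: F_def)
    also have "(s * G s - 1) / (s - 1) / (s * of_real \<phi>) = G s / (s - 1) / of_real \<phi> - 1 / (of_real \<phi> * (s - 1)) / s"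
    proof -
      have "(t * g - 1) / u / (t * f) = g / u / f - 1 / (f * u) / t" if "t \<noteq> 0" "u \<noteq> 0" "f \<noteq> 0" for t g u f :: complex
        using that by (simp add: field_simps)
      from this[OF nz] show ?thesis .
    qed
    also have "(W s - R s) / s - (G s / (s - 1) / of_real \<phi> - 1 / (of_real \<phi> * (s - 1)) / s) = (Hc s - R s) / s - G s / (s - 1) / of_real \<phi>"
      unfolding HcW[OF s] by (simp add: add_divide_distrib diff_divide_distrib)
    finally show ?thesis .
  qed
  moreover have "norm (a n) \<le> 7" for n
  proof -
    have "0 \<le> A n / real n" "A n / real n \<le> 6" using psi_ap_le[of m c n] psi_ap_nonneg[of m c n]
      by (cases "n = 0"; simp add: A_def field_simps)+
    moreover have "0 \<le> 1 / \<phi>" "1 / \<phi> \<le> 1" using phi by auto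
    ultimately show ?thesis unfolding a_def norm_of_real by linarith
  qed
  ultimately have "(\<lambda>n. a n / of_nat n) sums F 1"
    using a_sums by (intro newman_tauberian[where C = 7, OF _ U_open U1]) auto
  hence "summable (\<lambda>n. Re (a n / of_nat n))" by (rule sums_summable[OF sums_Re])
  hence "summable (\<lambda>n. (A n / real n - 1 / \<phi>) / real n)" by (simp add: a_def)
  thus ?thesis unfolding A_def \<phi>_def[symmetric]
    using phi by (intro tendsto_of_summable_monotone psi_ap_mono psi_ap_nonneg) auto
qed

section \<open>The least common multiple\<close>

lemma sum_UN_le_sum:
  fixes f :: "'b \<Rightarrow> real"
  assumes "finite Y" "\<And>y. y \<in> Y \<Longrightarrow> finite (B y)" "\<And>x. f x \<ge> 0"
  shows "sum f (\<Union>y\<in>Y. B y) \<le> (\<Sum>y\<in>Y. sum f (B y))"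
  using assms(1,2)
proof (induction Y rule: finite_induct)
  case (insert y Y)
  have "sum f (B y \<union> (\<Union>y\<in>Y. B y)) \<le> sum f (B y) + sum f (\<Union>y\<in>Y. B y)"
    using insert sum_nonneg[of "B y \<inter> (\<Union>y\<in>Y. B y)" f] assms(3) by (subst sum_Un) auto
  thus ?case using insert by simp
qed simp

lemma residue_class_solvable:
  fixes a b r :: int
  assumes a: "a \<ge> 1" and ab: "coprime a b" and r: "coprime r a"
  obtains c :: nat where "[int c * r = b] (mod a)" "coprime c (nat a)"
proof -
  obtain x where x: "[r * x = 1] (mod a)" using cong_solve_coprime_int[OF r] by blast
  define c where "c = nat ((x * b) mod a)"
  have ic: "int c = (x * b) mod a" using a by (simp add: c_def)
  have "[int c = x * b] (mod a)" unfolding ic by simp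
  hence "[int c * r = x * b * r] (mod a)" by (rule cong_scalar_right)
  moreover have "[r * x * b = 1 * b] (mod a)" by (rule cong_scalar_right[OF x])
  ultimately have 1: "[int c * r = b] (mod a)" using cong_trans by (fastforce simp: mult_ac)
  hence "gcd (int c * r) a = gcd b a" by (rule cong_gcd_eq)
  hence "coprime (int c * r) a" using ab by (simp add: coprime_iff_gcd_eq_1 gcd.commute)
  hence "coprime (int c) (int (nat a))" using a by simp
  thus ?thesis using 1 by (intro that[of c]) (simp_all only: coprime_int_iff)
qed

text \<open>V sums \<Lambda> over \<open>D\<close>, the divisors of terms, and W over the disjoint
  classes \<open>Q r\<close>. A divisor of a term belongs to some \<open>Q r\<close> because its
  cofactor can be lowered to its residue r. Conversely, a q in \<open>Q r\<close> outside
  \<open>D\<close> divides one of the a |b| integers just beyond T, and the \<Lambda>-sum over the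
  divisors of such an integer y is ln y.\<close>

lemma lcm_progression_bounds:
  fixes l m a b :: int and n :: nat and c :: "int \<Rightarrow> nat"
  assumes "m \<ge> 0" "l > m" and a: "a \<ge> 1" and ab: "a + b \<ge> 1" and cop: "gcd a b = 1"
    and l: "l \<ge> (a + 1) * m" and n: "n > 0"
    and c: "\<And>r. r \<in> {1..a} \<Longrightarrow> gcd r a = 1 \<Longrightarrow> [int (c r) * r = b] (mod a)"
  defines "T \<equiv> a * l * int n + b"
  defines "V \<equiv> ln (real_of_int (Lcm ((\<lambda>i. a * i + b) ` {i. m * int n < i \<and> i \<le> l * int n})))"
  defines "W \<equiv> (\<Sum>r | r \<in> {1..a} \<and> gcd r a = 1. psi_ap (nat a) (c r) (nat T div nat r))"
  shows "V \<le> W" "W \<le> V + real_of_int (a * \<bar>b\<bar>) * ln (real_of_int (T + a * \<bar>b\<bar>))"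
proof -
  define I where "I = {i. m * int n < i \<and> i \<le> l * int n}"
  define A where "A = (\<lambda>i. nat (a * i + b)) ` I"
  define R where "R = {r. r \<in> {1..a} \<and> gcd r a = 1}"
  define D where "D = {q::nat. \<exists>i\<in>I. int q dvd a * i + b}"
  define Q where "Q = (\<lambda>r. {k. k \<in> {1..nat T div nat r} \<and> [k = c r] (mod nat a)})"
  have pos: "a * i + b \<ge> 1" if "i \<in> I" for i
  proof -
    have "0 \<le> m * int n" using assms(1) by simp
    hence "i \<ge> 1" using that by (simp add: I_def)
    hence "a * 1 \<le> a * i" using a by (intro mult_left_mono) auto
    thus ?thesis using ab by simp
  qed
  have "I \<subseteq> {m * int n..l * int n}" by (auto simp: I_def)
  hence finI: "finite I" by (rule finite_subset) simp
  have l1: "l * int n \<ge> 1"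
  proof -
    have "1 * 1 \<le> l * int n" using assms(1,2) n by (intro mult_mono) auto
    thus ?thesis by simp
  qed
  have T1: "T \<ge> 1"
  proof -
    have "a * 1 \<le> a * (l * int n)" using a l1 by (intro mult_left_mono) auto
    thus ?thesis using ab by (simp add: T_def mult.assoc)
  qed
  have Tge: "a * i + b \<le> T" if "i \<in> I" for i
  proof -
    have "a * i \<le> a * (l * int n)" using that a by (intro mult_left_mono) (auto simp: I_def)
    thus ?thesis by (simp add: T_def mult.assoc)
  qed
  have finR: "finite R" by (rule finite_subset[of _ "{1..a}"]) (auto simp: R_def)
  have imgA: "(\<lambda>i. a * i + b) ` I = int ` A"
    unfolding A_def image_image using pos by (intro image_cong refl) (simp add: order_trans[OF zero_le_one])
  have A0: "0 \<notin> A" using pos by (fastforce simp: A_def)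
  have DA: "D = {q. \<exists>x\<in>A. q dvd x}"
  proof -
    have "int q dvd a * i + b \<longleftrightarrow> q dvd nat (a * i + b)" if "i \<in> I" for q i
      using pos[OF that] int_dvd_int_iff[of q "nat (a * i + b)"] by simp
    thus ?thesis by (auto simp: D_def A_def)
  qed
  have V: "V = (\<Sum>q\<in>D. mangoldt q)"
  proof -
    have "V = ln (real (Lcm A))" unfolding V_def I_def[symmetric] imgA by simp
    thus ?thesis using ln_Lcm_eq_sum_mangoldt[of A] finI A0 by (simp add: DA A_def)
  qed
  have Q_iff: "k \<in> Q r \<longleftrightarrow> k \<ge> 1 \<and> int k * r \<le> T \<and> [int k * r = b] (mod a)" if r: "r \<in> R" for k r
  proof -
    have r0: "r > 0" "coprime r a" using r by (auto simp: R_def coprime_iff_gcd_eq_1)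
    have "k \<le> nat T div nat r \<longleftrightarrow> k * nat r \<le> nat T" using r0 by (intro less_eq_div_iff_mult_less_eq) auto
    also have "\<dots> \<longleftrightarrow> int (k * nat r) \<le> int (nat T)" by (simp only: of_nat_le_iff)
    also have "\<dots> \<longleftrightarrow> int k * r \<le> T" using r0 T1 by simp
    finally have 1: "k \<le> nat T div nat r \<longleftrightarrow> int k * r \<le> T" .
    have "[k = c r] (mod nat a) \<longleftrightarrow> [int k = int (c r)] (mod a)"
      using a cong_int_iff[of k "c r" "nat a"] by simp
    also have "\<dots> \<longleftrightarrow> [int k * r = int (c r) * r] (mod a)"
      using r0(2) by (rule cong_mult_rcancel[symmetric])
    also have "\<dots> \<longleftrightarrow> [int k * r = b] (mod a)"
      using c[of r] r cong_trans cong_sym unfolding R_def by blast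
    finally show ?thesis unfolding Q_def using 1 by auto
  qed
  have cop_of_cong: "coprime x a \<and> coprime y a" if "[x * y = b] (mod a)" for x y
  proof -
    have "gcd (x * y) a = gcd b a" using that by (rule cong_gcd_eq)
    hence "coprime (x * y) a" using cop by (simp add: coprime_iff_gcd_eq_1 gcd.commute)
    thus ?thesis by simp
  qed
  have disj: "Q r \<inter> Q r' = {}" if rr: "r \<in> R" "r' \<in> R" "r \<noteq> r'" for r r'
  proof (rule ccontr)
    assume "Q r \<inter> Q r' \<noteq> {}"
    then obtain k where "k \<in> Q r" "k \<in> Q r'" by blast
    hence k: "[int k * r = b] (mod a)" "[int k * r' = b] (mod a)" using Q_iff rr by auto
    have "[int k * r = int k * r'] (mod a)" using k cong_trans cong_sym by blast
    hence "[r = r'] (mod a)" using cop_of_cong[OF k(1)] by (simp add: cong_mult_lcancel)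
    hence "a dvd r - r'" by (simp add: cong_iff_dvd_diff)
    moreover have "\<bar>r - r'\<bar> < a" using rr by (auto simp: R_def)
    ultimately have "r - r' = 0" using dvd_imp_le_int[of "r - r'" a] by linarith
    thus False using rr by simp
  qed
  have W: "W = (\<Sum>q\<in>(\<Union>r\<in>R. Q r). mangoldt q)"
  proof -
    have "W = (\<Sum>r\<in>R. \<Sum>q\<in>Q r. mangoldt q)" by (simp only: W_def psi_ap_def Q_def R_def)
    also have "\<dots> = (\<Sum>q\<in>(\<Union>r\<in>R. Q r). mangoldt q)"
      using disj finR by (intro sum.UNION_disjoint[symmetric]) (auto simp: Q_def)
    finally show ?thesis .
  qed
  have finQ: "finite (\<Union>r\<in>R. Q r)" using finR by (auto simp: Q_def)
  have sub: "D \<subseteq> (\<Union>r\<in>R. Q r)"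
  proof
    fix q assume "q \<in> D"
    then obtain i k where i: "i \<in> I" "a * i + b = int q * k" by (auto simp: D_def dvd_def)
    have qk: "int q * k \<ge> 1" using pos[OF i(1)] i(2) by simp
    have q0: "int q > 0" using qk by (cases "q = 0") auto
    have k0: "k > 0" using qk q0 by (smt (verit) mult_nonneg_nonpos)
    \<comment> \<open>The shift by 1 selects the representative of the cofactor in 1..a instead of
      0..a - 1; it never exceeds k.\<close>
    define r where "r = (k - 1) mod a + 1"
    have "0 < a" using a by simp
    hence "0 \<le> (k - 1) mod a" "(k - 1) mod a < a" by simp_all
    hence r: "1 \<le> r" "r \<le> a" by (simp_all add: r_def)
    have rk: "r \<le> k" using k0 a zmod_le_nonneg_dividend[of "k - 1" a] by (simp add: r_def)
    have "[r = k] (mod a)"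
    proof -
      have "[(k - 1) mod a + 1 = (k - 1) + 1] (mod a)" by (intro cong_add) auto
      thus ?thesis by (simp add: r_def)
    qed
    hence "[int q * r = int q * k] (mod a)" by (rule cong_scalar_left)
    moreover have "[int q * k = b] (mod a)" unfolding i(2)[symmetric] by (simp add: cong_iff_dvd_diff)
    ultimately have qr: "[int q * r = b] (mod a)" by (rule cong_trans)
    have "r \<in> R" using r cop_of_cong[OF qr] by (auto simp: R_def coprime_iff_gcd_eq_1)
    moreover have "int q * r \<le> T"
      using mult_left_mono[OF rk, of "int q"] Tge[OF i(1)] i(2) by simp
    ultimately have "q \<in> Q r" using Q_iff qr q0 by simp
    thus "q \<in> (\<Union>r\<in>R. Q r)" using \<open>r \<in> R\<close> by blast
  qed
  show "V \<le> W" unfolding V W by (intro sum_mono2 finQ sub mangoldt_nonneg)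
  define Y where "Y = {nat T + 1..nat (T + a * \<bar>b\<bar>)}"
  have exc: "\<exists>y\<in>Y. q dvd y" if q: "q \<in> Q r" "r \<in> R" "q \<notin> D" for q r
  proof -
    have q': "q \<ge> 1" "int q * r \<le> T" "[int q * r = b] (mod a)" using q Q_iff by auto
    \<comment> \<open>The terms of the progression are exactly the numbers congruent to b modulo a
      in (T0, T], and \<open>x j\<close> enumerates multiples of q congruent to b.\<close>
    define T0 where "T0 = a * m * int n + b"
    define x where "x = (\<lambda>j::nat. int q * (r + a * int j))"
    have x_cong: "a dvd x j - b" for j
    proof -
      have "a dvd (int q * r - b) + a * (int q * int j)"
        using q'(3) by (intro dvd_add) (auto simp: cong_iff_dvd_diff)
      thus ?thesis by (simp add: x_def algebra_simps)
    qed
    have inD: False if "T0 < x j" "x j \<le> T" for j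
    proof -
      obtain i where i: "x j - b = a * i" using x_cong[of j] by (auto simp: dvd_def)
      have "a * (m * int n) < a * i" using that(1) i by (simp add: T0_def mult.assoc)
      moreover have "a * i \<le> a * (l * int n)" using that(2) i by (simp add: T_def mult.assoc)
      ultimately have "i \<in> I" using a by (simp add: I_def)
      moreover have "int q dvd a * i + b" using i by (simp add: x_def flip: i)
      ultimately show False using q(3) by (auto simp: D_def)
    qed
    have ex: "\<exists>j. T0 < x j"
    proof (intro exI)
      have "1 * (int (nat \<bar>T0\<bar>) + 1) \<le> int q * (r + a * int (nat \<bar>T0\<bar>))"
      proof (intro mult_mono)
        have "1 * int (nat \<bar>T0\<bar>) \<le> a * int (nat \<bar>T0\<bar>)" using a by (intro mult_right_mono) auto
        thus "int (nat \<bar>T0\<bar>) + 1 \<le> r + a * int (nat \<bar>T0\<bar>)" using q(2) by (simp add: R_def)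
      qed (use q' in auto)
      thus "T0 < x (nat \<bar>T0\<bar>)" by (simp add: x_def)
    qed
    define j where "j = (LEAST j. T0 < x j)"
    have j: "T0 < x j" unfolding j_def by (rule LeastI_ex[OF ex])
    \<comment> \<open>The first multiple x 0 = q r is at most T; were it beyond T0, it would be a
      term and q would lie in \<open>D\<close>.\<close>
    have "j \<noteq> 0"
    proof
      assume "j = 0"
      hence "x j \<le> T" using q' by (simp add: x_def)
      thus False using inD j by blast
    qed
    then obtain j' where j': "j = Suc j'" by (cases j) auto
    have "\<not> T0 < x j'" using not_less_Least[of j' "\<lambda>j. T0 < x j"] j' by (simp add: j_def)
    hence le: "x j' \<le> T0" by simp
    have "int q * 1 \<le> x j'" unfolding x_def using q(2) a by (intro mult_left_mono) (auto simp: R_def intro: add_increasing2)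
    hence qT: "int q \<le> T0" using le by simp
    \<comment> \<open>One step adds a q, and q <= x j' <= T0, so x j <= (a + 1) T0 = a (a + 1) m n +
      b + a b. Here \<open>l \<ge> (a + 1) * m\<close> enters; the surplus a |b| over T fixes the
      length of \<open>Y\<close>.\<close>
    have "x j = x j' + a * int q" by (simp add: x_def j' algebra_simps)
    also have "\<dots> \<le> T0 + a * T0" using le qT a by (intro add_mono mult_left_mono) auto
    also have "\<dots> = a * ((a + 1) * m * int n) + b + a * b" by (simp add: T0_def algebra_simps)
    also have "\<dots> \<le> a * (l * int n) + b + a * \<bar>b\<bar>"
      using a l by (intro add_mono mult_left_mono mult_right_mono) auto
    also have "\<dots> = T + a * \<bar>b\<bar>" by (simp add: T_def mult.assoc)
    finally have up: "x j \<le> T + a * \<bar>b\<bar>" .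
    have lo: "T < x j"
    proof (rule ccontr)
      assume "\<not> T < x j"
      thus False using inD[OF j] by simp
    qed
    have "nat (x j) \<in> Y" unfolding Y_def using up lo T1 by auto
    moreover have "int q dvd int (nat (x j))" using lo T1 by (simp add: x_def)
    hence "q dvd nat (x j)" by (simp only: int_dvd_int_iff)
    ultimately show ?thesis by blast
  qed
  have fin_div: "finite {q. q dvd y}" if "y \<in> Y" for y using that by (auto simp: Y_def)
  have finY: "finite Y" by (simp add: Y_def)
  define E where "E = (\<Union>y\<in>Y. {q. q dvd y})"
  have finE: "finite E" unfolding E_def using fin_div finY by blast
  have finD: "finite D" using finite_subset[OF sub finQ] .
  have "W \<le> (\<Sum>q\<in>D \<union> E. mangoldt q)"
    unfolding W using exc finD finE by (intro sum_mono2 mangoldt_nonneg) (auto simp: E_def)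
  also have "\<dots> \<le> (\<Sum>q\<in>D. mangoldt q) + (\<Sum>q\<in>E. mangoldt q)"
    using finD finE sum_nonneg[of "D \<inter> E" "mangoldt :: nat \<Rightarrow> real"] mangoldt_nonneg by (simp add: sum.union_inter_neutral sum_Un)
  also have "(\<Sum>q\<in>E. mangoldt q) \<le> (\<Sum>y\<in>Y. \<Sum>q | q dvd y. mangoldt q :: real)"
    unfolding E_def using finY fin_div by (intro sum_UN_le_sum mangoldt_nonneg) auto
  also have "\<dots> = (\<Sum>y\<in>Y. ln (real y))"
    by (intro sum.cong refl ln_eq_sum_mangoldt[symmetric]) (auto simp: Y_def)
  also have "\<dots> \<le> real (card Y) * ln (real_of_int (T + a * \<bar>b\<bar>))"
  proof (rule sum_bounded_above)
    fix y assume y: "y \<in> Y"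
    hence "int y \<le> int (nat (T + a * \<bar>b\<bar>))" "y > 0" by (auto simp only: Y_def of_nat_le_iff atLeastAtMost_iff)
    moreover have "0 \<le> T + a * \<bar>b\<bar>" using T1 a by simp
    ultimately have "real_of_int (int y) \<le> real_of_int (T + a * \<bar>b\<bar>)" "real y > 0" unfolding of_int_le_iff by auto
    thus "ln (real y) \<le> ln (real_of_int (T + a * \<bar>b\<bar>))" by (subst ln_le_cancel_iff) auto
  qed
  also have "real (card Y) = real_of_int (a * \<bar>b\<bar>)"
  proof -
    have "nat (T + a * \<bar>b\<bar>) = nat T + nat (a * \<bar>b\<bar>)" using T1 a by (intro nat_add_distrib) auto
    hence "card Y = nat (a * \<bar>b\<bar>)" by (simp add: Y_def)
    thus ?thesis using a by simp
  qed
  finally show "W \<le> V + real_of_int (a * \<bar>b\<bar>) * ln (real_of_int (T + a * \<bar>b\<bar>))" unfolding V by simp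
qed

section \<open>The asymptotic formula\<close>

theorem corollary1p2:
  fixes l m a b :: int
  assumes "m \<ge> 0" and "l > m"
    and "a \<ge> 1" and "a + b \<ge> 1" and "gcd a b = 1"
    and "l \<ge> (a + 1) * m"
  shows "(\<lambda>n::nat. ln (real_of_int (Lcm ((\<lambda>i. a * i + b) ` {i. m * int n < i \<and> i \<le> l * int n}))))
           \<sim>[sequentially]
         (\<lambda>n. real_of_int (a * l * int n) / real (totient (nat a)) *
               (\<Sum>r | r \<in> {1..a} \<and> gcd r a = 1. 1 / real_of_int r))"
proof -
  define \<phi> where "\<phi> = real (totient (nat a))"
  have phi: "\<phi> > 0" using assms(3) by (simp add: \<phi>_def)
  define R where "R = {r. r \<in> {1..a} \<and> gcd r a = 1}"
  have finR: "finite R" by (rule finite_subset[of _ "{1..a}"]) (auto simp: R_def)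
  have "\<forall>r\<in>R. \<exists>c::nat. [int c * r = b] (mod a) \<and> coprime c (nat a)"
  proof
    fix r assume "r \<in> R"
    thus "\<exists>c::nat. [int c * r = b] (mod a) \<and> coprime c (nat a)"
      using residue_class_solvable[of a b r] assms(3,5) by (metis (mono_tags, lifting) R_def coprime_iff_gcd_eq_1 mem_Collect_eq)
  qed
  then obtain c :: "int \<Rightarrow> nat" where c: "\<And>r. r \<in> R \<Longrightarrow> [int (c r) * r = b] (mod a)" "\<And>r. r \<in> R \<Longrightarrow> coprime (c r) (nat a)"
    by metis
  define T where "T = (\<lambda>n::nat. a * l * int n + b)"
  define V where "V = (\<lambda>n::nat. ln (real_of_int (Lcm ((\<lambda>i. a * i + b) ` {i. m * int n < i \<and> i \<le> l * int n}))))"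
  define W where "W = (\<lambda>n. \<Sum>r\<in>R. psi_ap (nat a) (c r) (nat (T n) div nat r))"
  define S where "S = (\<Sum>r\<in>R. 1 / real_of_int r)"
  define E where "E = (\<lambda>n. real_of_int (a * \<bar>b\<bar>) * ln (real_of_int (T n + a * \<bar>b\<bar>)))"
  have "a * l > 0" using assms(1-3) by (intro mult_pos_pos) auto
  hence al: "a * l \<ge> 1" and al0: "real_of_int (a * l) > 0" by (simp, simp only: of_int_0_less_iff)
  have bounds: "V n \<le> W n" "W n \<le> V n + E n" if "n > 0" for n
    using lcm_progression_bounds[OF assms that, of c] c(1) unfolding V_def W_def E_def T_def R_def by auto
  \<comment> \<open>Rounding down T / r changes it by less than 1, so X n / n tends to a l / r, and
    the prime number theorem is composed with \<open>X\<close>.\<close>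
  have lim_r: "(\<lambda>n. psi_ap (nat a) (c r) (nat (T n) div nat r) / real n) \<longlonglongrightarrow> 1 / \<phi> * (real_of_int (a * l) / real_of_int r)"
    if r: "r \<in> R" for r
  proof -
    define X where "X = (\<lambda>n. nat (T n) div nat r)"
    let ?u = "\<lambda>n. (real_of_int (a * l) * real n + real_of_int b) / real_of_int r" and ?p = "\<lambda>n. psi_ap (nat a) (c r) (X n)"
    let ?q = "real_of_int (a * l) / real_of_int r"
    have r0: "r > 0" using r by (simp add: R_def)
    have real_T: "real (nat (T n)) = real_of_int (a * l) * real n + real_of_int b" if "n > 0" for n
    proof -
      have "a * l * 1 \<le> a * l * int n" using that al by (intro mult_left_mono) auto
      moreover have "a * 1 \<le> a * l" using assms(1-3) by (intro mult_left_mono) auto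
      ultimately have "T n \<ge> 0" using assms(4) by (simp add: T_def)
      thus ?thesis by (simp add: T_def)
    qed
    have X_lim: "(\<lambda>n. real (X n) / real n) \<longlonglongrightarrow> ?q"
    proof (rule tendsto_sandwich)
      have up: "real (X n) \<le> real (nat (T n)) / real (nat r)" for n unfolding X_def by (rule of_nat_div_le_of_nat)
      have lo: "real (nat (T n)) / real (nat r) - 1 \<le> real (X n)" for n
      proof -
        have "real (nat (T n)) = real (nat r * (nat (T n) div nat r) + nat (T n) mod nat r)" by simp
        hence "real (nat (T n)) = real (nat r) * real (X n) + real (nat (T n) mod nat r)"
          by (simp only: X_def of_nat_add of_nat_mult)
        moreover have "real (nat (T n) mod nat r) < real (nat r)" using r0 unfolding of_nat_less_iff by simp
        ultimately have "real (nat (T n)) \<le> real (nat r) * (real (X n) + 1)" by (simp add: distrib_left)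
        hence "real (nat (T n)) / real (nat r) \<le> real (X n) + 1" using r0 by (simp add: divide_le_eq mult.commute)
        thus ?thesis by simp
      qed
      show "\<forall>\<^sub>F n in sequentially. real (X n) / real n \<le> ?u n / real n"
        using eventually_gt_at_top[of 0]
      proof eventually_elim
        case (elim n)
        have "real (X n) \<le> ?u n"
          using up[of n] r0 unfolding real_T[OF elim] by simp
        thus ?case by (rule divide_right_mono) simp
      qed
      show "\<forall>\<^sub>F n in sequentially. (?u n - 1) / real n \<le> real (X n) / real n"
        using eventually_gt_at_top[of 0]
      proof eventually_elim
        case (elim n)
        have "?u n - 1 \<le> real (X n)"
          using lo[of n] r0 unfolding real_T[OF elim] by simp
        thus ?case by (rule divide_right_mono) simp
      qed
      show "(\<lambda>n. ?u n / real n) \<longlonglongrightarrow> ?q"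
        using r0 by (real_asymp; simp add: divide_inverse)
      show "(\<lambda>n. (?u n - 1) / real n) \<longlonglongrightarrow> ?q"
        using r0 by (real_asymp; simp add: divide_inverse)
    qed
    have pos: "?q > 0" using r0 by (intro divide_pos_pos al0) simp
    have "filterlim (\<lambda>n. real (X n) / real n * real n) at_top sequentially"
      by (rule filterlim_tendsto_pos_mult_at_top[OF X_lim pos filterlim_real_sequentially])
    moreover have "eventually (\<lambda>n. real (X n) / real n * real n = real (X n)) sequentially"
      using eventually_gt_at_top[of 0] by eventually_elim auto
    ultimately have "filterlim (\<lambda>n. real (X n)) at_top sequentially"
      by (rule filterlim_cong[THEN iffD1, OF refl refl, rotated])
    hence X_top: "filterlim X at_top sequentially" by (simp add: filterlim_sequentially_iff_filterlim_real)
    have "(\<lambda>n. ?p n / real (X n)) \<longlonglongrightarrow> 1 / \<phi>"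
      unfolding \<phi>_def by (rule filterlim_compose[OF prime_number_theorem_ap X_top]) (use assms(3) c(2)[OF r] in auto)
    from tendsto_mult[OF this X_lim]
    have "(\<lambda>n. ?p n / real (X n) * (real (X n) / real n)) \<longlonglongrightarrow> 1 / \<phi> * ?q" .
    moreover have "(\<lambda>n. ?p n / real (X n) * (real (X n) / real n)) = (\<lambda>n. ?p n / real n)"
    proof
      \<comment> \<open>For X n = 0 the quotient \<open>?p n / real (X n)\<close> is 0 by
        convention, which agrees as \<open>psi_ap\<close> vanishes at 0.\<close>
      fix n show "?p n / real (X n) * (real (X n) / real n) = ?p n / real n"
        by (cases "X n = 0") auto
    qed
    ultimately have "(\<lambda>n. ?p n / real n) \<longlonglongrightarrow> 1 / \<phi> * ?q"
      by (simp only:)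
    thus ?thesis unfolding X_def .
  qed
  define K where "K = real_of_int (a * l) / \<phi> * S"
  have "(\<lambda>n. \<Sum>r\<in>R. psi_ap (nat a) (c r) (nat (T n) div nat r) / real n) \<longlonglongrightarrow> (\<Sum>r\<in>R. 1 / \<phi> * (real_of_int (a * l) / real_of_int r))"
    by (intro tendsto_sum lim_r)
  also have "(\<lambda>n. \<Sum>r\<in>R. psi_ap (nat a) (c r) (nat (T n) div nat r) / real n) = (\<lambda>n. W n / real n)"
    by (simp add: W_def sum_divide_distrib)
  also have "(\<Sum>r\<in>R. 1 / \<phi> * (real_of_int (a * l) / real_of_int r)) = K"
    by (simp add: K_def S_def sum_distrib_left sum_divide_distrib mult_ac)
  finally have W_lim: "(\<lambda>n. W n / real n) \<longlonglongrightarrow> K" .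
  have E_lim: "(\<lambda>n. E n / real n) \<longlonglongrightarrow> 0"
  proof -
    have "(\<lambda>n. ln (real_of_int (a * l) * real n + (real_of_int b + real_of_int (a * \<bar>b\<bar>))) / real n) \<longlonglongrightarrow> 0"
      using al0 by real_asymp
    from tendsto_mult_right_zero[OF this, of "real_of_int (a * \<bar>b\<bar>)"] show ?thesis by (simp add: E_def T_def algebra_simps)
  qed
  have V_lim: "(\<lambda>n. V n / real n) \<longlonglongrightarrow> K"
  proof (rule tendsto_sandwich[OF _ _ _ W_lim])
    show "\<forall>\<^sub>F n in sequentially. W n / real n - E n / real n \<le> V n / real n"
      using eventually_gt_at_top[of 0]
    proof eventually_elim
      case (elim n)
      have "(W n - E n) / real n \<le> V n / real n" using bounds(2)[OF elim] by (intro divide_right_mono) auto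
      thus ?case by (simp add: diff_divide_distrib)
    qed
    show "\<forall>\<^sub>F n in sequentially. V n / real n \<le> W n / real n"
      using eventually_gt_at_top[of 0] by eventually_elim (auto intro!: divide_right_mono bounds)
    show "(\<lambda>n. W n / real n - E n / real n) \<longlonglongrightarrow> K" using tendsto_diff[OF W_lim E_lim] by simp
  qed
  \<comment> \<open>The residue r = 1 always occurs, so K is nonzero and the limit of V n / n is an
    asymptotic equivalence.\<close>
  have "S > 0" unfolding S_def
  proof (rule sum_pos[OF finR])
    have "1 \<in> R" using assms(3) by (simp add: R_def)
    thus "R \<noteq> {}" by blast
  qed (auto simp: R_def)
  hence K0: "K > 0" unfolding K_def by (intro mult_pos_pos divide_pos_pos al0 phi)
  have "V \<sim>[sequentially] (\<lambda>n. K * real n)"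
  proof (rule asymp_equivI')
    have "(\<lambda>n. V n / real n / K) \<longlonglongrightarrow> K / K" using V_lim K0 by (intro tendsto_intros) auto
    thus "(\<lambda>n. V n / (K * real n)) \<longlonglongrightarrow> 1" using K0 by (simp add: mult.commute)
  qed
  also have "(\<lambda>n. K * real n) = (\<lambda>n. real_of_int (a * l * int n) / \<phi> * S)"
    by (simp add: K_def fun_eq_iff)
  finally show ?thesis unfolding V_def S_def R_def \<phi>_def .
qed

end
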